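(* There is some non-negative constant $\ell$ such that $$\ell=\lim_{n\to\infty}\frac{l(X_n)}{n}=\frac{\Delta}{\Lambda}>0\quad\text{almost surely},$$ where $$\Delta:=\sum_{abc,\,def\in\overline{A}^3}\nu(def)\,l(a)\,\frac{\xi(abc)}{\xi(def)}\,\mathcal{K}(ef,abc|1),$$ $$\Lambda:=\sum_{abc,\,def\in\overline{A}^3}\nu(def)\cdot\frac{\xi(abc)}{\xi(def)}\cdot\frac{\partial}{\partial z}\biggl[\sum_{gh\in A^2}p(ef,agh)\cdot z\cdot\overline{G}(gh,bc|z)\biggr]\Biggl|_{z=1}.$$ In particular, $\lim_{n\to\infty}|X_n|/n=1/\Lambda$ almost surely.
   Context: Setting. $A$ is a finite alphabet, $\varepsilon$ the empty word, $A^\ast=\bigcup_{n\ge1}A^n\cup\{\varepsilon\}$ the set of all finite words, $|w|$ the number of letters of $w$ (so $|\varepsilon|=0$); $ww'$ denotes concatenation. $(X_n)_{n\in\mathbb{N}_0}$ is a time-homogeneous Markov chain on $A^\ast$ with $X_0=\varepsilon$ in which in each step only the last two letters may be modified, only one letter may be adjoined or deleted (at the end of the word), and the probabilities depend only on the last two letters of the current word: for $w\in A^\ast$, $a,a',b\in A$, $b',c'\in A\cup\{\varepsilon\}$, $$\mathbb{P}[X_{n+1}=wa'b'c'\mid X_n=wab]=p(ab,a'b'c'),\quad \mathbb{P}[X_{n+1}=b'c'\mid X_n=a]=p(a,b'c'),\quad \mathbb{P}[X_{n+1}=b'\mid X_n=\varepsilon]=p(\varepsilon,b').$$ $\mathbb{P}_w$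 denotes the law of the chain started at $w$. Standing assumptions. The chain is transient and suffix-irreducible: for all $w\in A^\ast$ with $\mathbb{P}[X_m=w]>0$ for some $m\in\mathbb{N}$ and all $ab\in A^2$ there is $n\in\mathbb{N}$ such that $\mathbb{P}_w[\exists w_1\in A^\ast: X_n=ww_1ab,\ \forall k<n: |X_k|\ge|w|]>0$. Length function. $l:A\to[0,\infty)$ is a given function, extended to $A^\ast$ by $l(a_1\dots a_n)=\sum_{i=1}^n l(a_i)$, $l(\varepsilon)=0$. Notation. For $a,b,c,d,e\in A$ and real $z>0$: $$H(ab,c|z)=\sum_{n\ge1}\mathbb{P}_{ab}[X_n=c,\ \forall m<n:|X_m|>1]\,z^n,$$ $$\xi(abc)=\sum_{a'b'c'\in A^3}p(bc,a'b'c')\Bigl(1-\sum_{d\in A}H(b'c',d|1)\Bigr),\qquad \overline{A}^3=\{abc\in A^3:\xi(abc)>0\},$$ $$\overline{G}(ab,cd|z)=\sum_{n\ge0}\mathbb{P}_{ab}[X_n=cd,\ \forall m\le n:|X_m|\ge2]\,z^n,$$ $$\mathcal{K}(ab,cde|z)=\sum_{n\ge1}\mathbb{P}_{ab}[X_n=cde,\ \forall m\in\{1,\dots,n\}:|X_m|\ge3]\,z^n=\sum_{fg\in A^2}p(ab,cfg)\,z\,\overline{G}(fg,de|z).$$ Let $\mathbf{e}_k=\sup\{m\in\mathbb{N}_0:|X_m|=k\}$ (almost surely finite), $\mathbf{W}_k=X_{\mathbf{e}_k}$, and $[a_1\dots a_n]_3=a_{n-2}a_{n-1}a_n$ for $n\ge3$.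 Then $([\mathbf{W}_k]_3)_{k\ge3}$ is a Markov chain on $\overline{A}^3$ with transition probabilities $$\tilde q(abc,a'b'c')=\frac{\xi(a'b'c')}{\xi(abc)}\,\mathcal{K}(bc,a'b'c'|1),$$ which is irreducible by suffix-irreducibility, and $\nu$ denotes its invariant probability measure.
   Formalization: Strict positivity of Δ/Λ, which fails for l = 0, is claimed only when some letter a with l(a) > 0 satisfies p(ef,agh) > 0 for some letters e,f,g,h; this condition is necessary for Δ > 0, and everything else is stated for every l ≥ 0. *)

theory Defs
  imports "HOL-Probability.Probability"
begin

text \<open>Words over the alphabet \<open>A\<close> are lists over a finite type; the end of the word is the end of
  the list.\<close>

definition markov_chain_from ::
    "'w measure \<Rightarrow> (nat \<Rightarrow> 'w \<Rightarrow> 's) \<Rightarrow> ('s \<Rightarrow> 's pmf) \<Rightarrow> 's \<Rightarrow> bool" where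
  "markov_chain_from M X k s \<longleftrightarrow>
     prob_space M \<and>
     (\<forall>n. X n \<in> measurable M (count_space UNIV)) \<and>
     (AE \<omega> in M. X 0 \<omega> = s) \<and>
     (\<forall>n x. \<P>(\<omega> in M. \<forall>i\<le>Suc n. X i \<omega> = x i) =
            \<P>(\<omega> in M. \<forall>i\<le>n. X i \<omega> = x i) * pmf (k (x n)) (x (Suc n)))"

text \<open>\<open>pmf (p u) v\<close> is the transition probability \<open>p(u,v)\<close>. Only words \<open>u\<close> with at most two
  letters matter, and \<open>v\<close> has at most one letter more or less than \<open>u\<close>; since subtraction is
  truncated, this reads \<open>1 \<le> |v| \<le> 3\<close>, \<open>|v| \<le> 2\<close> and \<open>|v| \<le> 1\<close> for \<open>|u| = 2, 1, 0\<close>.\<close>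

definition suffix_rule :: "('a list \<Rightarrow> 'a list pmf) \<Rightarrow> bool" where
  "suffix_rule p \<longleftrightarrow>
     (\<forall>u. length u \<le> 2 \<longrightarrow>
        (\<forall>v\<in>set_pmf (p u). length u - 1 \<le> length v \<and> length v \<le> length u + 1))"

definition suffix_step :: "('a list \<Rightarrow> 'a list pmf) \<Rightarrow> 'a list \<Rightarrow> 'a list pmf" where
  "suffix_step p w =
     map_pmf (\<lambda>v. take (length w - 2) w @ v) (p (drop (length w - 2) w))"

text \<open>\<open>P w\<close> is the law of the chain started at \<open>w\<close>; the process \<open>X\<close> is the same under all of them.\<close>

definition suffix_chain ::
    "('a list \<Rightarrow> 'w measure) \<Rightarrow> (nat \<Rightarrow> 'w \<Rightarrow> 'a list) \<Rightarrow> ('a list \<Rightarrow> 'a list pmf) \<Rightarrow> bool" where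
  "suffix_chain P X p \<longleftrightarrow>
     suffix_rule p \<and> (\<forall>w. markov_chain_from (P w) X (suffix_step p) w)"

text \<open>Every state that the chain started at the empty word can visit is transient. Words that are
  never visited are not constrained.\<close>

definition transient_chain ::
    "('a list \<Rightarrow> 'w measure) \<Rightarrow> (nat \<Rightarrow> 'w \<Rightarrow> 'a list) \<Rightarrow> bool" where
  "transient_chain P X \<longleftrightarrow>
     (\<forall>w. (\<exists>m. \<P>(\<omega> in P []. X m \<omega> = w) > 0) \<longrightarrow>
          \<P>(\<omega> in P w. \<exists>n\<ge>1. X n \<omega> = w) < 1)"

definition suffix_irreducible ::
    "('a list \<Rightarrow> 'w measure) \<Rightarrow> (nat \<Rightarrow> 'w \<Rightarrow> 'a list) \<Rightarrow> bool" where
  "suffix_irreducible P X \<longleftrightarrow>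
     (\<forall>w. (\<exists>m\<ge>1. \<P>(\<omega> in P []. X m \<omega> = w) > 0) \<longrightarrow>
       (\<forall>a b. \<exists>n\<ge>1. \<P>(\<omega> in P w. (\<exists>w1. X n \<omega> = w @ w1 @ [a, b]) \<and>
                              (\<forall>k<n. length (X k \<omega>) \<ge> length w)) > 0))"

definition word_length :: "('a \<Rightarrow> real) \<Rightarrow> 'a list \<Rightarrow> real" where
  "word_length l w = sum_list (map l w)"

definition H_fun ::
    "('a list \<Rightarrow> 'w measure) \<Rightarrow> (nat \<Rightarrow> 'w \<Rightarrow> 'a list) \<Rightarrow> 'a \<times> 'a \<Rightarrow> 'a \<Rightarrow> real \<Rightarrow> real" where
  "H_fun P X = (\<lambda>(a, b) c z.
     \<Sum>n. \<P>(\<omega> in P [a, b]. X (Suc n) \<omega> = [c] \<and> (\<forall>m<Suc n. length (X m \<omega>) > 1)) * z ^ Suc n)"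

definition Gbar ::
    "('a list \<Rightarrow> 'w measure) \<Rightarrow> (nat \<Rightarrow> 'w \<Rightarrow> 'a list) \<Rightarrow> 'a \<times> 'a \<Rightarrow> 'a \<times> 'a \<Rightarrow> real \<Rightarrow> real" where
  "Gbar P X = (\<lambda>(a, b) (c, d) z.
     \<Sum>n. \<P>(\<omega> in P [a, b]. X n \<omega> = [c, d] \<and> (\<forall>m\<le>n. length (X m \<omega>) \<ge> 2)) * z ^ n)"

definition K_fun ::
    "('a list \<Rightarrow> 'w measure) \<Rightarrow> (nat \<Rightarrow> 'w \<Rightarrow> 'a list) \<Rightarrow> 'a \<times> 'a \<Rightarrow> 'a \<times> 'a \<times> 'a \<Rightarrow> real \<Rightarrow> real" where
  "K_fun P X = (\<lambda>(a, b) (c, d, e) z.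
     \<Sum>n. \<P>(\<omega> in P [a, b]. X (Suc n) \<omega> = [c, d, e] \<and>
              (\<forall>m\<in>{1..Suc n}. length (X m \<omega>) \<ge> 3)) * z ^ Suc n)"

definition xi ::
    "('a::finite list \<Rightarrow> 'w measure) \<Rightarrow> (nat \<Rightarrow> 'w \<Rightarrow> 'a list) \<Rightarrow> ('a list \<Rightarrow> 'a list pmf) \<Rightarrow>
      'a \<times> 'a \<times> 'a \<Rightarrow> real" where
  "xi P X p = (\<lambda>(a, b, c).
     \<Sum>(a', b', c')\<in>UNIV. pmf (p [b, c]) [a', b', c'] * (1 - (\<Sum>d\<in>UNIV. H_fun P X (b', c') d 1)))"

definition A3bar ::
    "('a::finite list \<Rightarrow> 'w measure) \<Rightarrow> (nat \<Rightarrow> 'w \<Rightarrow> 'a list) \<Rightarrow> ('a list \<Rightarrow> 'a list pmf) \<Rightarrow>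
      ('a \<times> 'a \<times> 'a) set" where
  "A3bar P X p = {t. xi P X p t > 0}"

definition q_tilde ::
    "('a::finite list \<Rightarrow> 'w measure) \<Rightarrow> (nat \<Rightarrow> 'w \<Rightarrow> 'a list) \<Rightarrow> ('a list \<Rightarrow> 'a list pmf) \<Rightarrow>
      'a \<times> 'a \<times> 'a \<Rightarrow> 'a \<times> 'a \<times> 'a \<Rightarrow> real" where
  "q_tilde P X p = (\<lambda>(a, b, c) t'.
     xi P X p t' / xi P X p (a, b, c) * K_fun P X (b, c) t' 1)"

definition invariant_measure ::
    "('a::finite list \<Rightarrow> 'w measure) \<Rightarrow> (nat \<Rightarrow> 'w \<Rightarrow> 'a list) \<Rightarrow> ('a list \<Rightarrow> 'a list pmf) \<Rightarrow>
      ('a \<times> 'a \<times> 'a) pmf \<Rightarrow> bool" where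
  "invariant_measure P X p \<nu> \<longleftrightarrow>
     set_pmf \<nu> \<subseteq> A3bar P X p \<and>
     (\<forall>t'\<in>A3bar P X p. (\<Sum>t\<in>A3bar P X p. pmf \<nu> t * q_tilde P X p t t') = pmf \<nu> t')"

definition Delta ::
    "('a::finite list \<Rightarrow> 'w measure) \<Rightarrow> (nat \<Rightarrow> 'w \<Rightarrow> 'a list) \<Rightarrow> ('a list \<Rightarrow> 'a list pmf) \<Rightarrow>
      ('a \<times> 'a \<times> 'a) pmf \<Rightarrow> ('a \<Rightarrow> real) \<Rightarrow> real" where
  "Delta P X p \<nu> l =
     (\<Sum>(a, b, c)\<in>A3bar P X p. \<Sum>(d, e, f)\<in>A3bar P X p.
        pmf \<nu> (d, e, f) * l a * (xi P X p (a, b, c) / xi P X p (d, e, f)) *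
        K_fun P X (e, f) (a, b, c) 1)"

definition Lambda ::
    "('a::finite list \<Rightarrow> 'w measure) \<Rightarrow> (nat \<Rightarrow> 'w \<Rightarrow> 'a list) \<Rightarrow> ('a list \<Rightarrow> 'a list pmf) \<Rightarrow>
      ('a \<times> 'a \<times> 'a) pmf \<Rightarrow> real" where
  "Lambda P X p \<nu> =
     (\<Sum>(a, b, c)\<in>A3bar P X p. \<Sum>(d, e, f)\<in>A3bar P X p.
        pmf \<nu> (d, e, f) * (xi P X p (a, b, c) / xi P X p (d, e, f)) *
        deriv (\<lambda>z. \<Sum>(g, h)\<in>UNIV. pmf (p [e, f]) [a, g, h] * z * Gbar P X (g, h) (b, c) z) 1)"

end

theory Submission imports Defs begin

text \<open>
  Write $u(ab)$ for the probability that the walk started at $ab$ never gets shorter than two letters; $u$ is a positive fixed vector of a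
  nonnegative irreducible matrix $M$ on pairs of letters, obtained by skipping the excursions that
  end one letter lower. Every function $\beta$ on pairs extends recursively to a bounded function on
  words, and applying the transition operator to the extension adds $(M-1)\beta$ at the last pair.
  Solving the Poisson equation $(M-1)\beta = L - \mathrm{drift}$ therefore turns $l(X_n) - nL$ into a
  martingale up to a bounded term and finitely many visits to short words, so that a second moment
  bound along squares gives $l(X_n)/n \to L$.
  The invariant measure $\nu$ yields a left fixed vector $\mu$ of $M$; pairing $\mu$ with the Poisson
  equation gives $L \cdot \sum\mu = \Delta$. For $l = 1$ this shows $L > 0$, hence an exponential
  supermartingale, hence convergence of all generating functions beyond $z = 1$; differentiating
  their equations at $1$ and pairing with $\mu$ again gives $\Lambda = \sum\mu$.
\<close>

section \<open>Path probabilities of a Markov chain\<close>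

text \<open>Last exit times never enter: \<open>\<nu>\<close> is used only through its invariance
  equation, and the process almost only through the operators \<open>step\<close> and
  \<open>run\<close>. The obstacle to a description by the last pair is that a deletion uncovers an
  older letter. After a step from \<open>s\<close> to \<open>d # r\<close>, however,
  \<open>d\<close> stays untouched until the word collapses to \<open>[d, e]\<close>, with weights
  that depend on \<open>r\<close> only; so \<open>M0\<close> can absorb the excursion through
  \<open>h\<close>. \<open>M\<close> fixes \<open>u\<close>, so \<open>M - 1\<close> is singular,
  and the constant \<open>L\<close> is the extra unknown that restores solvability. The maximum
  principle behind this concerns \<open>\<beta> / u\<close> and needs \<open>u > 0\<close>
  everywhere. Here transience enters: if \<open>u\<close> vanished, the walk would return forever to
  the finitely many words of at most one letter. Pairing with \<open>\<mu>\<close> kills every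
  \<open>M \<beta> - \<beta>\<close>. The drift and the expected length of a letter written for good
  differ by such a term, which identifies \<open>L\<close>; and the differentiated equations of
  \<open>h\<close> and \<open>g\<close> share one source term, which turns the derivative in
  \<Lambda> into a sum.\<close>

primrec path_pmf :: "('s \<Rightarrow> 's pmf) \<Rightarrow> nat \<Rightarrow> 's \<Rightarrow> 's list pmf" where
  "path_pmf k 0 s = return_pmf [s]"
| "path_pmf k (Suc n) s = bind_pmf (k s) (\<lambda>t. map_pmf ((#) s) (path_pmf k n t))"

primrec path_prob :: "('s \<Rightarrow> 's pmf) \<Rightarrow> nat \<Rightarrow> (nat \<Rightarrow> 's set) \<Rightarrow> 's \<Rightarrow> real" where
  "path_prob k 0 A s = indicator (A 0) s"
| "path_prob k (Suc n) A s =
     indicator (A 0) s * measure_pmf.expectation (k s) (path_prob k n (\<lambda>i. A (Suc i)))"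

lemma measure_bind_pmf: "measure (bind_pmf M N) B = measure_pmf.expectation M (\<lambda>x. measure (N x) B)"
proof -
  have "ennreal (measure (bind_pmf M N) B) = (\<integral>\<^sup>+x. ennreal (measure (N x) B) \<partial>M)"
    by (simp add: measure_pmf.emeasure_eq_measure[symmetric])
  also have "\<dots> = ennreal (measure_pmf.expectation M (\<lambda>x. measure (N x) B))"
    by (intro nn_integral_eq_integral measure_pmf.integrable_const_bound[where B=1]) auto
  finally show ?thesis by (simp add: integral_nonneg_AE)
qed

lemma length_path_pmf: "xs \<in> set_pmf (path_pmf k n s) \<Longrightarrow> length xs = Suc n"
  by (induction n arbitrary: s xs) auto

lemma path_pmf_nth_0: "xs \<in> set_pmf (path_pmf k n s) \<Longrightarrow> xs ! 0 = s"
  by (cases n) auto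

lemma path_pmf_step:
  "xs \<in> set_pmf (path_pmf k n s) \<Longrightarrow> i < n \<Longrightarrow> xs ! Suc i \<in> set_pmf (k (xs ! i))"
proof (induction n arbitrary: s xs i)
  case (Suc n)
  then obtain t ys where t: "t \<in> set_pmf (k s)" "ys \<in> set_pmf (path_pmf k n t)" "xs = s # ys"
    by auto
  show ?case
  proof (cases i)
    case 0
    then show ?thesis using t path_pmf_nth_0[OF t(2)] by simp
  next
    case (Suc j)
    then show ?thesis using Suc.IH[OF t(2), of j] Suc.prems t by simp
  qed
qed simp

lemma pmf_path_pmf:
  "pmf (path_pmf k n s) (map x [0..<Suc n]) =
     (if x 0 = s then \<Prod>i<n. pmf (k (x i)) (x (Suc i)) else 0)"
proof (induction n arbitrary: s x)
  case (Suc n)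
  let ?y = "\<lambda>i. x (Suc i)" and ?ys = "map (\<lambda>i. x (Suc i)) [0..<Suc n]"
  have split: "map x [0..<Suc (Suc n)] = x 0 # ?ys"
    by (subst upt_conv_Cons) (auto simp del: upt_Suc simp: map_Suc_upt[symmetric])
  have cons: "pmf (map_pmf ((#) s) (path_pmf k n t)) (x 0 # ?ys) =
      (if x 0 = s then (\<Prod>i<n. pmf (k (?y i)) (?y (Suc i))) * indicator {?y 0} t else 0)" for t
  proof (cases "x 0 = s")
    case True
    then show ?thesis
      using pmf_map_inj'[of "(#) s" "path_pmf k n t" ?ys] Suc.IH[of t ?y]
      by (auto simp del: upt_Suc simp: indicator_def)
  next
    case False
    then have "x 0 # ?ys \<notin> (#) s ` set_pmf (path_pmf k n t)" by auto
    from pmf_map_outside[OF this] False show ?thesis by (simp del: upt_Suc)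
  qed
  show ?case
    unfolding split path_pmf.simps pmf_bind cons
    by (simp add: prod.lessThan_Suc_shift measure_pmf_single del: prod.lessThan_Suc)
qed simp

lemma all_le_Suc_iff: "(\<forall>i\<le>Suc n. P i) \<longleftrightarrow> P 0 \<and> (\<forall>i\<le>n. P (Suc i))"
  using All_less_Suc2[of "Suc n" P] by (simp only: less_Suc_eq_le)

lemma measure_path_pmf:
  "measure (path_pmf k n s) {xs. \<forall>i\<le>n. xs ! i \<in> A i} = path_prob k n A s"
proof (induction n arbitrary: s A)
  case (Suc n)
  have "(#) s -` {xs. \<forall>i\<le>Suc n. xs ! i \<in> A i} =
      (if s \<in> A 0 then {xs. \<forall>i\<le>n. xs ! i \<in> A (Suc i)} else {})"
    unfolding all_le_Suc_iff by auto
  then show ?case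
    by (simp add: measure_bind_pmf Suc.IH)
qed (simp add: indicator_def)

lemma markov_chain_cylinder:
  assumes "markov_chain_from M X k s"
  shows "\<P>(\<omega> in M. \<forall>i\<le>n. X i \<omega> = x i) =
    (if x 0 = s then \<Prod>i<n. pmf (k (x i)) (x (Suc i)) else 0)"
proof (induction n)
  case 0
  interpret prob_space M using assms by (simp add: markov_chain_from_def)
  have ae: "AE \<omega> in M. X 0 \<omega> = s" and X: "X 0 \<in> measurable M (count_space UNIV)"
    using assms by (auto simp: markov_chain_from_def)
  show ?case
  proof (cases "x 0 = s")
    case True
    have "prob {\<omega> \<in> space M. X 0 \<omega> = x 0} = 1"
      using ae X True by (subst prob_Collect_eq_1) auto
    then show ?thesis using True by simp
  next
    case False
    have "prob {\<omega> \<in> space M. X 0 \<omega> = x 0} = 0"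
      using ae X False by (subst prob_Collect_eq_0) auto
    then show ?thesis using False by simp
  qed
next
  case (Suc n)
  then show ?case using assms by (auto simp: markov_chain_from_def)
qed

text \<open>\<open>markov_chain_from\<close> prescribes only cylinder probabilities. Paths of a
  fixed length form a countable set, so these point masses determine the law, and every event about
  finitely many steps can be computed under \<open>path_pmf\<close>.\<close>

lemma distr_path:
  fixes X :: "nat \<Rightarrow> 'w \<Rightarrow> 's::countable"
  assumes mc: "markov_chain_from M X k s"
  shows "(\<lambda>\<omega>. map (\<lambda>i. X i \<omega>) [0..<Suc n]) \<in> measurable M (count_space UNIV)" (is "?Y \<in> _")
    and "distr M (count_space UNIV) (\<lambda>\<omega>. map (\<lambda>i. X i \<omega>) [0..<Suc n]) = measure_pmf (path_pmf k n s)"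
proof -
  interpret prob_space M using mc by (simp add: markov_chain_from_def)
  have X[measurable]: "X i \<in> measurable M (count_space UNIV)" for i
    using mc by (simp add: markov_chain_from_def)
  have pre: "?Y -` {ys} \<inter> space M =
      (if length ys = Suc n then {\<omega> \<in> space M. \<forall>i\<le>n. X i \<omega> = ys ! i} else {})" for ys
  proof -
    have nth: "?Y \<omega> ! i = X i \<omega>" if "i \<le> n" for i \<omega>
      using that nth_map_upt[of i "Suc n" 0 "\<lambda>i. X i \<omega>"] by (simp del: upt_Suc)
    have "?Y \<omega> = ys \<longleftrightarrow> length ys = Suc n \<and> (\<forall>i\<le>n. X i \<omega> = ys ! i)" for \<omega>
      unfolding list_eq_iff_nth_eq using nth[of _ \<omega>] by (simp add: less_Suc_eq_le del: upt_Suc) metis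
    then show ?thesis by auto
  qed
  show meas: "?Y \<in> measurable M (count_space UNIV)"
    by (subst measurable_count_space_eq2_countable) (simp_all add: pre del: upt_Suc)
  show "distr M (count_space UNIV) ?Y = measure_pmf (path_pmf k n s)"
  proof (rule measure_eqI_countable[where A=UNIV])
    fix ys :: "'s list"
    have "emeasure (distr M (count_space UNIV) ?Y) {ys} = ennreal (prob (?Y -` {ys} \<inter> space M))"
      by (subst emeasure_distr[OF meas]) (auto simp: emeasure_eq_measure)
    also have "prob (?Y -` {ys} \<inter> space M) = pmf (path_pmf k n s) ys"
    proof (cases "length ys = Suc n")
      case True
      then have "map ((!) ys) [0..<Suc n] = ys" using map_nth[of ys] by simp
      then have "pmf (path_pmf k n s) ys = \<P>(\<omega> in M. \<forall>i\<le>n. X i \<omega> = ys ! i)"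
        using markov_chain_cylinder[OF mc, of n "(!) ys"] pmf_path_pmf[of k n s "(!) ys"]
        by (simp del: upt_Suc)
      then show ?thesis using True unfolding pre by simp
    next
      case False
      then have "ys \<notin> set_pmf (path_pmf k n s)" using False length_path_pmf[of ys k n s] by auto
      then show ?thesis using False unfolding pre by (simp add: pmf_eq_0_set_pmf)
    qed
    finally show "emeasure (distr M (count_space UNIV) ?Y) {ys} = emeasure (path_pmf k n s) {ys}"
      by (simp add: emeasure_pmf_single)
  qed auto
qed

lemma prob_path_event:
  fixes X :: "nat \<Rightarrow> 'w \<Rightarrow> 's::countable"
  assumes mc: "markov_chain_from M X k s"
  shows "\<P>(\<omega> in M. \<forall>i\<le>n. X i \<omega> \<in> A i) = path_prob k n A s"
proof -
  let ?Y = "\<lambda>\<omega>. map (\<lambda>i. X i \<omega>) [0..<Suc n]"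
  have "{\<omega> \<in> space M. \<forall>i\<le>n. X i \<omega> \<in> A i} = ?Y -` {xs. \<forall>i\<le>n. xs ! i \<in> A i} \<inter> space M"
  proof -
    have "?Y \<omega> ! i = X i \<omega>" if "i \<le> n" for i \<omega>
      using that nth_map_upt[of i "Suc n" 0 "\<lambda>i. X i \<omega>"] by (simp del: upt_Suc)
    then show ?thesis by (simp add: set_eq_iff del: upt_Suc) blast
  qed
  then show ?thesis
    using measure_distr[OF distr_path(1)[OF mc], of "{xs. \<forall>i\<le>n. xs ! i \<in> A i}" n]
    by (simp add: distr_path(2)[OF mc] measure_path_pmf del: upt_Suc)
qed

text \<open>Increments are bounded only along the support of the kernel; this transfers the bound to
  almost every trajectory.\<close>

lemma AE_markov_step:
  fixes X :: "nat \<Rightarrow> 'w \<Rightarrow> 's::countable"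
  assumes mc: "markov_chain_from M X k s"
  shows "AE \<omega> in M. \<forall>n. X (Suc n) \<omega> \<in> set_pmf (k (X n \<omega>))"
proof (subst AE_all_countable, rule allI)
  fix n
  let ?Y = "\<lambda>\<omega>. map (\<lambda>i. X i \<omega>) [0..<Suc (Suc n)]"
  have "AE xs in distr M (count_space UNIV) ?Y. xs ! Suc n \<in> set_pmf (k (xs ! n))"
    unfolding distr_path(2)[OF mc] by (auto simp: AE_measure_pmf_iff intro!: path_pmf_step simp del: path_pmf.simps)
  then have "AE \<omega> in M. ?Y \<omega> ! Suc n \<in> set_pmf (k (?Y \<omega> ! n))"
    using AE_distrD[OF distr_path(1)[OF mc]] by blast
  then show "AE \<omega> in M. X (Suc n) \<omega> \<in> set_pmf (k (X n \<omega>))"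
    by (simp add: nth_append)
qed

section \<open>Auxiliary analysis and linear algebra\<close>

lemma sum_cauchy_le:
  fixes a b :: "nat \<Rightarrow> real"
  assumes "\<And>n. 0 \<le> a n" "\<And>n. 0 \<le> b n"
  shows "(\<Sum>n\<le>N. \<Sum>k\<le>n. a k * b (n - k)) \<le> (\<Sum>n\<le>N. a n) * (\<Sum>n\<le>N. b n)"
proof -
  have "(\<Sum>n\<le>N. \<Sum>k\<le>n. a k * b (n - k)) = (\<Sum>(i, j)\<in>{(i, j). i + j \<le> N}. a i * b j)"
    by (rule sum.triangle_reindex_eq[symmetric])
  also have "\<dots> \<le> (\<Sum>(i, j)\<in>{..N} \<times> {..N}. a i * b j)"
    by (rule sum_mono2) (auto simp: assms)
  also have "\<dots> = (\<Sum>n\<le>N. a n) * (\<Sum>n\<le>N. b n)"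
    by (simp add: sum_product sum.cartesian_product)
  finally show ?thesis .
qed

lemma sum_UNIV_prod: "(\<Sum>t\<in>(UNIV :: ('b::finite \<times> 'c::finite) set). f t) = (\<Sum>a\<in>UNIV. \<Sum>b\<in>UNIV. f (a, b))"
  unfolding UNIV_Times_UNIV[symmetric] sum.cartesian_product by simp

declare split_paired_All [simp del] split_paired_Ex [simp del]

lemma sum_of_bool_mult [simp]:
  fixes f :: "'n::finite \<Rightarrow> real"
  shows "(\<Sum>r\<in>UNIV. of_bool (i = r) * f r) = f i" "(\<Sum>r\<in>UNIV. f r * of_bool (r = i)) = f i"
proof -
  have "(\<Sum>r\<in>UNIV. of_bool (i = r) * f r) = (\<Sum>r\<in>UNIV. if i = r then f r else 0)"
    by (intro sum.cong) auto
  then show "(\<Sum>r\<in>UNIV. of_bool (i = r) * f r) = f i" by simp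
  have "(\<Sum>r\<in>UNIV. f r * of_bool (r = i)) = (\<Sum>r\<in>UNIV. if r = i then f r else 0)"
    by (intro sum.cong) auto
  then show "(\<Sum>r\<in>UNIV. f r * of_bool (r = i)) = f i" by simp
qed

text \<open>First-step arguments give one of the two inverse equations for the Green function
  \<open>g\<close>; this supplies the other.\<close>

lemma finite_matrix_left_inverse:
  fixes A B :: "'n::finite \<Rightarrow> 'n \<Rightarrow> real"
  assumes "\<And>i j. (\<Sum>k\<in>UNIV. A i k * B k j) = of_bool (i = j)"
  shows "(\<Sum>k\<in>UNIV. B i k * A k j) = of_bool (i = j)"
proof -
  let ?m = "\<lambda>A :: 'n \<Rightarrow> 'n \<Rightarrow> real. (\<chi> i j. A i j)"
  have "?m A ** ?m B = mat 1"
    using assms by (simp add: matrix_matrix_mult_def mat_def vec_eq_iff of_bool_def)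
  then have "?m B ** ?m A = mat 1" by (simp add: matrix_left_right_inverse)
  then show ?thesis by (simp add: matrix_matrix_mult_def mat_def vec_eq_iff of_bool_def)
qed

lemma finite_linear_injective_imp_surjective:
  fixes F :: "('n::finite \<Rightarrow> real) \<Rightarrow> 'n \<Rightarrow> real"
  assumes add: "\<And>x y. F (\<lambda>i. x i + y i) = (\<lambda>i. F x i + F y i)"
    and scale: "\<And>c x. F (\<lambda>i. c * x i) = (\<lambda>i. c * F x i)"
    and inj: "\<And>x. F x = (\<lambda>i. 0) \<Longrightarrow> x = (\<lambda>i. 0)"
  shows "\<exists>x. F x = y"
proof -
  define G :: "real ^ 'n \<Rightarrow> real ^ 'n" where "G v = (\<chi> i. F (($) v) i)" for v
  have lin: "linear G"
  proof (rule linearI)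
    show "G (v + w) = G v + G w" for v w
      using add[of "($) v" "($) w"] by (simp add: G_def vec_eq_iff plus_vec_def vec_lambda_inverse)
    show "G (c *\<^sub>R v) = c *\<^sub>R G v" for c v
      using scale[of c "($) v"] by (simp add: G_def vec_eq_iff scaleR_vec_def vec_lambda_inverse)
  qed
  have "inj G"
  proof (subst linear_injective_0[OF lin], intro allI impI)
    fix v assume "G v = 0"
    then have "F (($) v) = (\<lambda>i. 0)" by (auto simp: G_def vec_eq_iff)
    then show "v = 0" using inj by (metis vec_eq_iff zero_index)
  qed
  then have "surj G" using linear_injective_imp_surjective lin by blast
  then obtain v where "G v = (\<chi> i. y i)" by (metis surjD)
  then have "F (($) v) = y" by (auto simp: G_def vec_eq_iff)
  then show ?thesis by blast
qed

lemma obtain_argmax: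
  fixes f :: "'n::finite \<Rightarrow> real"
  obtains t where "\<And>s. f s \<le> f t"
proof -
  have "Max (range f) \<in> range f" by (rule Max_in) auto
  then obtain t where "Max (range f) = f t" by blast
  then have "f s \<le> f t" for s using Max_ge[of "range f" "f s"] by auto
  then show ?thesis by (rule that)
qed

lemma exp_le_quadratic:
  fixes x :: real
  assumes "\<bar>x\<bar> \<le> 1"
  shows "exp x \<le> 1 + x + x\<^sup>2"
proof (cases "0 \<le> x")
  case True
  then show ?thesis using exp_bound[of x] assms by simp
next
  case False
  then have x: "x < 0" by simp
  have "1 - x \<le> exp (- x)" using exp_ge_add_one_self[of "- x"] by simp
  then have "(1 - x) * exp x \<le> exp (- x) * exp x" by (intro mult_right_mono) auto
  then have "(1 - x) * exp x \<le> 1" by (simp add: exp_minus)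
  \<comment> \<open>For negative \<open>x\<close> the bound \<open>1 / (1 - x)\<close> of the
    exponential already lies below the quadratic, because the product here is
    \<open>1 - x ^ 3\<close>.\<close>
  also have "1 \<le> (1 - x) * (1 + x + x\<^sup>2)"
  proof -
    have "(1 - x) * (1 + x + x\<^sup>2) = 1 - x ^ 3" by (simp add: algebra_simps power2_eq_square power3_eq_cube)
    moreover have "x ^ 3 \<le> 0" using x by (simp add: power_le_zero_eq_numeral)
    ultimately show ?thesis by simp
  qed
  finally show ?thesis using x by (simp add: mult_le_cancel_left)
qed

text \<open>Variance bounds are summable only along squares. An index \<open>n\<close> is within
  \<open>2 * sqrt n\<close> of the square below it, so bounded increments fill the gap at cost
  \<open>O(sqrt n)\<close>.\<close>

lemma tendsto_quotient_from_squares: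
  fixes x :: "nat \<Rightarrow> real"
  assumes C: "\<And>n. \<bar>x (Suc n) - x n\<bar> \<le> C"
    and sq: "(\<lambda>k. x (k\<^sup>2) / real (k\<^sup>2)) \<longlonglongrightarrow> L"
  shows "(\<lambda>n. x n / real n) \<longlonglongrightarrow> L"
proof -
  define k where "k n = nat \<lfloor>sqrt (real n)\<rfloor>" for n
  have C0: "0 \<le> C" using C[of 0] by linarith
  have k: "real (k n) \<le> sqrt (real n)" "sqrt (real n) < real (k n) + 1" for n
    by (auto simp: k_def)
  have k_sq: "(k n)\<^sup>2 \<le> n" for n
  proof -
    have "(real (k n))\<^sup>2 \<le> (sqrt (real n))\<^sup>2" using k(1)[of n] by (intro power_mono) auto
    then have "real ((k n)\<^sup>2) \<le> real n" by simp
    then show ?thesis by (simp only: of_nat_le_iff)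
  qed
  have diff: "\<bar>x (m + i) - x m\<bar> \<le> C * real i" for m i
  proof (induction i)
    case (Suc i)
    then show ?case using C[of "m + i"] by (simp add: algebra_simps)
  qed simp
  have close: "\<bar>x n - x ((k n)\<^sup>2)\<bar> \<le> C * (2 * sqrt (real n))" for n
  proof -
    have n: "n = (k n)\<^sup>2 + (n - (k n)\<^sup>2)" using k_sq[of n] by simp
    have "\<bar>x n - x ((k n)\<^sup>2)\<bar> \<le> C * real (n - (k n)\<^sup>2)"
      using diff[of "(k n)\<^sup>2" "n - (k n)\<^sup>2"] n by simp
    also have "real (n - (k n)\<^sup>2) \<le> 2 * sqrt (real n)"
    proof -
      have "real (n - (k n)\<^sup>2) = sqrt (real n) * sqrt (real n) - real (k n) * real (k n)"
        using k_sq[of n] by (simp add: of_nat_diff power2_eq_square)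
      also have "\<dots> = (sqrt (real n) - real (k n)) * (sqrt (real n) + real (k n))"
        by (simp add: algebra_simps)
      also have "\<dots> \<le> 1 * (sqrt (real n) + sqrt (real n))"
        using k[of n] by (intro mult_mono) auto
      finally show ?thesis by simp
    qed
    finally show ?thesis using C0 by (simp add: mult_left_mono)
  qed
  have k_lim: "filterlim k at_top sequentially"
    unfolding k_def
    by (intro filterlim_compose[OF filterlim_nat_sequentially]
        filterlim_compose[OF filterlim_floor_sequentially]
        filterlim_compose[OF sqrt_at_top] filterlim_real_sequentially)
  have lim1: "(\<lambda>n. x ((k n)\<^sup>2) / real ((k n)\<^sup>2)) \<longlonglongrightarrow> L"
    using filterlim_compose[OF sq k_lim] .
  have inv: "(\<lambda>n. 1 / sqrt (real n)) \<longlonglongrightarrow> 0"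
    by (intro tendsto_divide_0[OF tendsto_const] filterlim_at_top_imp_at_infinity
        filterlim_compose[OF sqrt_at_top] filterlim_real_sequentially)
  have lim2: "(\<lambda>n. real ((k n)\<^sup>2) / real n) \<longlonglongrightarrow> 1"
  proof (rule tendsto_sandwich[where f="\<lambda>n. (1 - 1 / sqrt (real n))\<^sup>2" and h="\<lambda>n. 1"])
    show "eventually (\<lambda>n. (1 - 1 / sqrt (real n))\<^sup>2 \<le> real ((k n)\<^sup>2) / real n) sequentially"
      using eventually_ge_at_top[of 1]
    proof eventually_elim
      case (elim n)
      have s: "1 \<le> sqrt (real n)" using elim by simp
      have "1 - 1 / sqrt (real n) = (sqrt (real n) - 1) / sqrt (real n)" using s by (simp add: field_simps)
      also have "(\<dots>)\<^sup>2 = (sqrt (real n) - 1)\<^sup>2 / real n" by (simp add: power_divide)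
      also have "\<dots> \<le> (real (k n))\<^sup>2 / real n"
        using k(2)[of n] s by (intro divide_right_mono power_mono) auto
      finally show ?case by simp
    qed
    show "eventually (\<lambda>n. real ((k n)\<^sup>2) / real n \<le> 1) sequentially"
      using eventually_ge_at_top[of 1]
    proof eventually_elim
      case (elim n)
      then show ?case using k_sq[of n] by (simp add: divide_le_eq_1 flip: of_nat_power)
    qed
    show "(\<lambda>n. (1 - 1 / sqrt (real n))\<^sup>2) \<longlonglongrightarrow> 1"
      using tendsto_power[OF tendsto_diff[OF tendsto_const inv], of 1 2] by simp
  qed simp
  have lim3: "(\<lambda>n. (x n - x ((k n)\<^sup>2)) / real n) \<longlonglongrightarrow> 0"
  proof (rule Lim_null_comparison)
    show "eventually (\<lambda>n. norm ((x n - x ((k n)\<^sup>2)) / real n) \<le> 2 * C * (1 / sqrt (real n))) sequentially"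
    proof (rule always_eventually, rule allI)
      fix n
      have "norm ((x n - x ((k n)\<^sup>2)) / real n) \<le> C * (2 * sqrt (real n)) / real n"
        using close[of n] by (simp add: divide_right_mono)
      also have "\<dots> = 2 * C * (sqrt (real n) / real n)" by simp
      also have "sqrt (real n) / real n = 1 / sqrt (real n)" by (simp add: sqrt_divide_self_eq inverse_eq_divide)
      finally show "norm ((x n - x ((k n)\<^sup>2)) / real n) \<le> 2 * C * (1 / sqrt (real n))" .
    qed
    show "(\<lambda>n. 2 * C * (1 / sqrt (real n))) \<longlonglongrightarrow> 0"
      using tendsto_mult[OF tendsto_const inv, of "2 * C"] by simp
  qed
  have "(\<lambda>n. x ((k n)\<^sup>2) / real ((k n)\<^sup>2) * (real ((k n)\<^sup>2) / real n) + (x n - x ((k n)\<^sup>2)) / real n) \<longlonglongrightarrow> L * 1 + 0"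
    by (intro tendsto_add tendsto_mult lim1 lim2 lim3)
  moreover have "eventually (\<lambda>n. x ((k n)\<^sup>2) / real ((k n)\<^sup>2) * (real ((k n)\<^sup>2) / real n) + (x n - x ((k n)\<^sup>2)) / real n =
      x n / real n) sequentially"
    using eventually_ge_at_top[of 1]
  proof eventually_elim
    case (elim n)
    have "0 < real (k n)" using k(2)[of n] real_sqrt_ge_1_iff[of "real n"] elim by linarith
    then show ?case by (simp add: diff_divide_distrib)
  qed
  ultimately show ?thesis by (simp add: tendsto_cong)
qed

section \<open>The transition operator and first-passage series\<close>

fun wd :: "'a \<times> 'a \<Rightarrow> 'a list" where
  "wd (a, b) = [a, b]"

lemma length_wd [simp]: "length (wd s) = 2"
  by (cases s) auto

lemma wd_eq_iff [simp]: "wd s = wd t \<longleftrightarrow> s = t"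
  by (cases s; cases t) auto

lemma wd_neq [simp]: "wd s \<noteq> []" "wd s \<noteq> [c]" "[] \<noteq> wd s" "[c] \<noteq> wd s"
  by (cases s; auto)+

lemma length_ge_2E:
  assumes "2 \<le> length w" obtains w' s where "w = w' @ wd s"
proof -
  obtain x v where "w = v @ [x]" using assms by (cases w rule: rev_cases) auto
  moreover then obtain y u where "v = u @ [y]" using assms by (cases v rule: rev_cases) auto
  ultimately show ?thesis using that[of u "(y, x)"] by simp
qed

locale suffix_kernel =
  fixes p :: "'a::finite list \<Rightarrow> 'a list pmf"
  assumes rule: "suffix_rule p"
begin

section \<open>One-step expectations and expectations along restricted paths\<close>

definition step :: "('a list \<Rightarrow> real) \<Rightarrow> 'a list \<Rightarrow> real" where
  "step f w = measure_pmf.expectation (suffix_step p w) f"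

text \<open>Only the states at times \<open>0\<close> to \<open>n - 1\<close> are confined to
  \<open>B\<close>; the state at time \<open>n\<close> is seen by \<open>f\<close> alone. First
  passages, restricted visits and plain expectations are all instances.\<close>

primrec run :: "'a list set \<Rightarrow> ('a list \<Rightarrow> real) \<Rightarrow> nat \<Rightarrow> 'a list \<Rightarrow> real" where
  "run B f 0 = f"
| "run B f (Suc n) = (\<lambda>w. indicator B w * step (run B f n) w)"

definition p1 where "p1 s c = pmf (p (wd s)) [c]"
definition p2 where "p2 s t = pmf (p (wd s)) (wd t)"
definition p3 where "p3 s d t = pmf (p (wd s)) (d # wd t)"

lemma p_nonneg [simp]: "0 \<le> p1 s c" "0 \<le> p2 s t" "0 \<le> p3 s d t"
  by (auto simp: p1_def p2_def p3_def)

lemma support_length: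
  assumes "v \<in> set_pmf (suffix_step p w)"
  shows "length w - 1 \<le> length v" "length v \<le> length w + 1"
proof -
  obtain u where u: "v = take (length w - 2) w @ u" "u \<in> set_pmf (p (drop (length w - 2) w))"
    using assms by (auto simp: suffix_step_def)
  let ?d = "drop (length w - 2) w"
  have "length ?d \<le> 2" by auto
  then have "length ?d - 1 \<le> length u" "length u \<le> length ?d + 1"
    using rule u(2) unfolding suffix_rule_def by blast+
  then show "length w - 1 \<le> length v" "length v \<le> length w + 1"
    using u(1) by auto
qed

lemma finite_support [simp]: "finite (set_pmf (suffix_step p w))"
proof (rule finite_subset)
  show "set_pmf (suffix_step p w) \<subseteq> {v. set v \<subseteq> UNIV \<and> length v \<le> length w + 1}"
    using support_length(2)[of _ w] by auto
  show "finite {v :: 'a list. set v \<subseteq> UNIV \<and> length v \<le> length w + 1}"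
    by (rule finite_lists_length_le) simp
qed

lemma step_sum_eq: "step f w = (\<Sum>v\<in>set_pmf (suffix_step p w). f v * pmf (suffix_step p w) v)"
  unfolding step_def by (rule integral_measure_pmf_real) auto

lemma step_add: "step (\<lambda>v. f v + g v) w = step f w + step g w"
  by (simp add: step_sum_eq sum.distrib distrib_right)

lemma step_diff: "step (\<lambda>v. f v - g v) w = step f w - step g w"
  by (simp add: step_sum_eq sum_subtractf left_diff_distrib)

lemma step_cmult: "step (\<lambda>v. c * f v) w = c * step f w"
  by (simp add: step_sum_eq mult.assoc flip: sum_distrib_left)

lemma step_multc: "step (\<lambda>v. f v * c) w = step f w * c"
  using step_cmult[of c f w] by (simp add: mult.commute)

lemma step_const [simp]: "step (\<lambda>v. c) w = c"
  by (simp add: step_def)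

lemma step_sum: "step (\<lambda>v. \<Sum>i\<in>I. f i v) w = (\<Sum>i\<in>I. step (f i) w)"
  unfolding step_sum_eq sum_distrib_right by (rule sum.swap)

lemma step_mono:
  "(\<And>v. v \<in> set_pmf (suffix_step p w) \<Longrightarrow> f v \<le> g v) \<Longrightarrow> step f w \<le> step g w"
  by (simp add: step_sum_eq sum_mono mult_right_mono)

lemma step_cong:
  "(\<And>v. v \<in> set_pmf (suffix_step p w) \<Longrightarrow> f v = g v) \<Longrightarrow> step f w = step g w"
  by (simp add: step_sum_eq)

lemma step_nonneg: "(\<And>v. 0 \<le> f v) \<Longrightarrow> 0 \<le> step f w"
  by (simp add: step_sum_eq sum_nonneg)

lemma step_pos_iff:
  assumes "\<And>v. 0 \<le> f v"
  shows "0 < step f w \<longleftrightarrow> (\<exists>v\<in>set_pmf (suffix_step p w). 0 < f v)"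
proof -
  have "step f w = 0 \<longleftrightarrow> (\<forall>v\<in>set_pmf (suffix_step p w). f v = 0)"
    unfolding step_sum_eq
    by (subst sum_nonneg_eq_0_iff) (auto simp: assms pmf_eq_0_set_pmf)
  then show ?thesis using step_nonneg[of f w, OF assms] assms
    by (metis less_eq_real_def less_irrefl)
qed

lemma step_tendsto:
  "(\<And>v. (\<lambda>n. f n v) \<longlonglongrightarrow> g v) \<Longrightarrow> (\<lambda>n. step (f n) w) \<longlonglongrightarrow> step g w"
  unfolding step_sum_eq by (intro tendsto_sum tendsto_mult tendsto_const)

text \<open>The kernel reads and rewrites the last two letters only, so any prefix is carried
  along.\<close>

lemma step_shift: "2 \<le> length s \<Longrightarrow> step f (x @ s) = step (\<lambda>t. f (x @ t)) s"
proof -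
  assume "2 \<le> length s"
  then have "suffix_step p (x @ s) = map_pmf ((@) x) (suffix_step p s)"
    by (simp add: suffix_step_def map_pmf_comp)
  then show ?thesis by (simp add: step_def)
qed

lemma step_Cons: "2 \<le> length s \<Longrightarrow> step f (d # s) = step (\<lambda>t. f (d # t)) s"
  using step_shift[of s f "[d]"] by simp

lemma step_wd:
  "step f (w @ wd s) = (\<Sum>c\<in>UNIV. p1 s c * f (w @ [c])) + (\<Sum>t\<in>UNIV. p2 s t * f (w @ wd t)) +
     (\<Sum>d\<in>UNIV. \<Sum>t\<in>UNIV. p3 s d t * f (w @ d # wd t))"
proof -
  let ?A1 = "range (\<lambda>c :: 'a. [c])" and ?A2 = "range (wd :: 'a \<times> 'a \<Rightarrow> 'a list)"
    and ?A3 = "range (\<lambda>(d :: 'a, t). d # wd t)"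
  have st: "suffix_step p (wd s) = p (wd s)"
    by (simp add: suffix_step_def map_pmf_ident)
  have "step f (w @ wd s) = step (\<lambda>v. f (w @ v)) (wd s)"
    by (rule step_shift) simp
  also have "\<dots> = (\<Sum>v\<in>?A1 \<union> ?A2 \<union> ?A3. f (w @ v) * pmf (p (wd s)) v)"
    unfolding step_def st
  proof (rule integral_measure_pmf_real)
    show "finite (?A1 \<union> ?A2 \<union> ?A3)" by simp
    fix v assume "v \<in> set_pmf (p (wd s))"
    then have "1 \<le> length v" "length v \<le> 3"
      using support_length[of v "wd s"] by (auto simp: st)
    then consider "length v = 1" | "length v = 2" | "length v = 3" by linarith
    then show "v \<in> ?A1 \<union> ?A2 \<union> ?A3"
    proof cases
      case 1
      then show ?thesis by (auto simp: length_Suc_conv)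
    next
      case 2
      then obtain a b where "v = wd (a, b)" by (auto simp: length_Suc_conv numeral_2_eq_2)
      then show ?thesis by blast
    next
      case 3
      then obtain d a b where "v = (case (d, (a, b)) of (d, t) \<Rightarrow> d # wd t)"
        by (auto simp: length_Suc_conv numeral_3_eq_3)
      then show ?thesis by blast
    qed
  qed
  also have "\<dots> = (\<Sum>v\<in>?A1. f (w @ v) * pmf (p (wd s)) v) + (\<Sum>v\<in>?A2. f (w @ v) * pmf (p (wd s)) v) +
      (\<Sum>v\<in>?A3. f (w @ v) * pmf (p (wd s)) v)"
  proof -
    have len: "v \<in> ?A1 \<Longrightarrow> length v = 1" "v \<in> ?A2 \<Longrightarrow> length v = 2" "v \<in> ?A3 \<Longrightarrow> length v = 3" for v :: "'a list"
      by auto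
    have "?A1 \<inter> ?A2 = {}" "(?A1 \<union> ?A2) \<inter> ?A3 = {}"
      using len by fastforce+
    then show ?thesis by (simp add: sum.union_disjoint)
  qed
  also have "(\<Sum>v\<in>?A1. f (w @ v) * pmf (p (wd s)) v) = (\<Sum>c\<in>UNIV. p1 s c * f (w @ [c]))"
    by (subst sum.reindex) (auto simp: inj_on_def p1_def mult.commute)
  also have "(\<Sum>v\<in>?A2. f (w @ v) * pmf (p (wd s)) v) = (\<Sum>t\<in>UNIV. p2 s t * f (w @ wd t))"
    by (subst sum.reindex) (auto simp: inj_on_def p2_def mult.commute)
  also have "(\<Sum>v\<in>?A3. f (w @ v) * pmf (p (wd s)) v) = (\<Sum>d\<in>UNIV. \<Sum>t\<in>UNIV. p3 s d t * f (w @ d # wd t))"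
    unfolding sum_UNIV_prod[of "\<lambda>(d, t). p3 s d t * f (w @ d # wd t)", simplified, symmetric]
    by (subst sum.reindex) (auto simp: inj_on_def p3_def mult.commute intro!: sum.cong)
  finally show ?thesis .
qed

lemma run_nonneg: "(\<And>v. 0 \<le> f v) \<Longrightarrow> 0 \<le> run B f n w"
  by (induction n arbitrary: w) (auto intro!: mult_nonneg_nonneg step_nonneg)

lemma run_mono:
  "B \<subseteq> C \<Longrightarrow> (\<And>v. 0 \<le> f v) \<Longrightarrow> (\<And>v. f v \<le> g v) \<Longrightarrow> run B f n w \<le> run C g n w"
proof (induction n arbitrary: w)
  case (Suc n)
  have "0 \<le> step (run B f n) w" "step (run B f n) w \<le> step (run C g n) w"
    using Suc by (auto intro!: step_nonneg step_mono run_nonneg)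
  then show ?case using Suc.prems(1) by (auto simp: indicator_def)
qed simp

lemma run_add: "run UNIV f (m + n) = run UNIV (run UNIV f n) m"
  by (induction m) auto

lemma run_add_fun: "run B (\<lambda>v. f v + g v) n = (\<lambda>w. run B f n w + run B g n w)"
  by (induction n) (simp_all add: step_add distrib_left)

lemma run_cmult: "run B (\<lambda>v. c * f v) n = (\<lambda>w. c * run B f n w)"
  by (induction n) (auto simp: step_cmult)

lemma run_const [simp]: "run UNIV (\<lambda>v. c) n = (\<lambda>w. c)"
  by (induction n) auto

lemma run_sum: "run B (\<lambda>v. \<Sum>i\<in>I. f i v) n = (\<lambda>w. \<Sum>i\<in>I. run B (f i) n w)"
  by (induction n) (auto simp: step_sum sum_distrib_left)

lemma run_tendsto:
  "(\<And>v. (\<lambda>N. f N v) \<longlonglongrightarrow> g v) \<Longrightarrow> (\<lambda>N. run B (f N) n w) \<longlonglongrightarrow> run B g n w"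
  by (induction n arbitrary: w) (auto intro!: tendsto_mult step_tendsto)

lemma path_prob_run:
  "path_prob (suffix_step p) n (\<lambda>i. if i < n then B else C) = run B (indicator C) n"
proof (induction n)
  case (Suc n)
  have "(\<lambda>i. if Suc i < Suc n then B else C) = (\<lambda>i. if i < n then B else C)" by simp
  then show ?case by (intro ext) (simp add: Suc step_def)
qed (simp add: fun_eq_iff)

text \<open>The summands belong to disjoint events: the first visit to \<open>C\<close> at time
  \<open>k\<close>, all earlier states being in \<open>B\<close>.\<close>

lemma sum_run_first_le_1:
  assumes "B \<inter> C = {}"
  shows "(\<Sum>k\<le>N. run B (indicator C) k w) \<le> 1"
proof (induction N arbitrary: w)
  case (Suc N)
  have "(\<Sum>k\<le>Suc N. run B (indicator C) k w) =
      indicator C w + indicator B w * step (\<lambda>v. \<Sum>k\<le>N. run B (indicator C) k v) w"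
    by (simp add: sum.atMost_Suc_shift step_sum sum_distrib_left del: sum.atMost_Suc)
  moreover have "step (\<lambda>v. \<Sum>k\<le>N. run B (indicator C) k v) w \<le> 1"
    using step_mono[of w "\<lambda>v. \<Sum>k\<le>N. run B (indicator C) k v" "\<lambda>v. 1"] Suc by simp
  ultimately show ?case using assms by (cases "w \<in> B"; cases "w \<in> C") (simp_all, blast)
qed (simp add: indicator_def)

text \<open>\<open>run (- {v}) (indicator {v}) k w\<close> is the probability that the first visit
  to \<open>v\<close> happens at time \<open>k\<close>; from there the chain starts afresh.\<close>

lemma renewal:
  "run UNIV (indicator {v}) n w =
     (\<Sum>k\<le>n. run (- {v}) (indicator {v}) k w * run UNIV (indicator {v}) (n - k) v)"
proof (induction n arbitrary: w)
  case (Suc n)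
  let ?q = "run (- {v}) (indicator {v})" and ?g = "\<lambda>k. run UNIV (indicator {v}) k v"
  have split: "(\<Sum>k\<le>Suc n. ?q k w * ?g (Suc n - k)) =
      ?q 0 w * ?g (Suc n) + (\<Sum>k\<le>n. ?q (Suc k) w * ?g (n - k))"
    by (simp add: sum.atMost_Suc_shift del: sum.atMost_Suc run.simps)
  show ?case
  proof (cases "w = v")
    case True
    then show ?thesis unfolding split by simp
  next
    case False
    have "run UNIV (indicator {v}) (Suc n) w = step (\<lambda>u. \<Sum>k\<le>n. ?q k u * ?g (n - k)) w"
      by (simp add: Suc[abs_def])
    then show ?thesis using False unfolding split by (simp add: step_sum step_multc)
  qed
qed simp

definition reachable :: "'a list \<Rightarrow> bool" where
  "reachable w \<longleftrightarrow> (\<exists>m. 0 < run UNIV (indicator {w}) m [])"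

text \<open>With \<open>F\<close> bounding the return probability, partial sums \<open>S\<close> of
  visits from \<open>v\<close> to \<open>v\<close> satisfy \<open>S \<le> 1 + F * S\<close>. From
  another start, the first-hitting probabilities sum to at most \<open>1\<close>.\<close>

lemma summable_visits:
  assumes q: "\<And>N. step (\<lambda>s. \<Sum>k\<le>N. run (- {v}) (indicator {v}) k s) v \<le> F" and F: "F < 1"
  shows "summable (\<lambda>n. run UNIV (indicator {v}) n w)"
proof -
  let ?q = "run (- {v}) (indicator {v})" and ?g = "\<lambda>k w. run UNIV (indicator {v}) k w"
  have nn: "0 \<le> ?q k w" "0 \<le> ?g k w" for k w by (auto intro!: run_nonneg)
  have gle: "?g k w \<le> 1" for k w
  proof -
    have "?g k w \<le> run UNIV (\<lambda>v. 1) k w" by (rule run_mono) (auto simp: indicator_def)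
    then show ?thesis by simp
  qed
  have main: "(\<Sum>n\<le>N. ?g n v) \<le> 1 / (1 - F)" for N
  proof -
    let ?S = "\<Sum>n\<le>N. ?g n v" and ?f = "\<lambda>k. step (?q k) v"
    have g: "?g (Suc n) v = (\<Sum>k\<le>n. ?f k * ?g (n - k) v)" for n
    proof -
      have "?g (Suc n) v = step (\<lambda>u. \<Sum>k\<le>n. ?q k u * ?g (n - k) v) v"
        by (simp add: renewal[of v n, abs_def])
      then show ?thesis by (simp add: step_sum step_multc)
    qed
    have "?S \<le> (\<Sum>n\<le>Suc N. ?g n v)"
      using nn(2)[of "Suc N" v] by simp
    also have "\<dots> = 1 + (\<Sum>n\<le>N. \<Sum>k\<le>n. ?f k * ?g (n - k) v)"
      unfolding g[symmetric] by (simp add: sum.atMost_Suc_shift del: sum.atMost_Suc run.simps(2))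
    also have "\<dots> \<le> 1 + (\<Sum>k\<le>N. ?f k) * ?S"
      using sum_cauchy_le[of ?f "\<lambda>n. ?g n v" N] nn by (auto intro!: step_nonneg)
    also have "\<dots> \<le> 1 + F * ?S"
      using q[of N] nn by (auto simp: step_sum intro!: mult_right_mono sum_nonneg)
    finally show ?thesis using F by (simp add: field_simps)
  qed
  show ?thesis
  proof (rule summableI_nonneg_bounded[where x="1 / (1 - F)"])
    fix N
    have "(\<Sum>n<N. ?g n w) \<le> (\<Sum>n\<le>N. ?g n w)" using nn by (intro sum_mono2) auto
    also have "\<dots> = (\<Sum>n\<le>N. \<Sum>k\<le>n. ?q k w * ?g (n - k) v)"
      using renewal[of v _ w] by simp
    also have "\<dots> \<le> (\<Sum>k\<le>N. ?q k w) * (\<Sum>n\<le>N. ?g n v)"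
      using sum_cauchy_le[of "\<lambda>k. ?q k w" "\<lambda>n. ?g n v" N] nn by auto
    also have "\<dots> \<le> 1 * (\<Sum>n\<le>N. ?g n v)"
      using nn by (intro mult_right_mono sum_run_first_le_1 sum_nonneg) auto
    finally show "(\<Sum>n<N. ?g n w) \<le> 1 / (1 - F)" using main[of N] by simp
  qed (rule nn)
qed

abbreviation long :: "'a list set" where
  "long \<equiv> {w. 2 \<le> length w}"

text \<open>In the notation of the paper \<open>h\<close> is \<open>H\<close>, \<open>g\<close> is \<open>G\<close> with a bar, \<open>escape\<close> is \<open>\<xi>\<close> (which ignores the
  first letter), and \<open>M0\<close>, \<open>M1\<close> collect the moves that keep the length, possibly after an excursion,
  and those that add a letter.\<close>

definition fp where "fp c n = run long (indicator {[c]}) n"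
definition gb where "gb t n = run long (indicator {wd t}) n"
definition h where "h z s c = (\<Sum>n. fp c n (wd s) * z ^ n)" for z :: real
definition g where "g z s t = (\<Sum>n. gb t n (wd s) * z ^ n)" for z :: real
definition M0 where "M0 z s t = z * (p2 s t + (\<Sum>r\<in>UNIV. p3 s (fst t) r * h z r (snd t)))"
definition M1 where "M1 s t = (\<Sum>d\<in>UNIV. p3 s d t)"
definition M where "M s t = M0 1 s t + M1 s t"
definition u where "u s = 1 - (\<Sum>c\<in>UNIV. h 1 s c)"
definition escape where "escape s = (\<Sum>t\<in>UNIV. M1 s t * u t)"

lemma run_short: "length w < 2 \<Longrightarrow> run long f n w = (if n = 0 then f w else 0)"
  by (cases n) auto

lemma fp_nonneg [simp]: "0 \<le> fp c n w" and gb_nonneg [simp]: "0 \<le> gb t n w"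
  unfolding fp_def gb_def by (auto intro!: run_nonneg)

text \<open>Decomposition at the first time the word has been eaten up to its first two positions:
  before that time, the walk never looks at the first letter.\<close>

lemma run_Cons:
  assumes \<phi>: "\<And>w. 3 \<le> length w \<Longrightarrow> \<phi> w = 0" and "t \<noteq> []"
  shows "run long \<phi> n (d # t) = (\<Sum>k\<le>n. \<Sum>e\<in>UNIV. fp e k t * run long \<phi> (n - k) [d, e])"
  using \<open>t \<noteq> []\<close>
proof (induction n arbitrary: t)
  case 0
  show ?case
  proof (cases "length t < 2")
    case True
    then obtain e where "t = [e]" using 0 by (cases t) auto
    then have "fp c 0 t = (if c = e then 1 else 0)" for c by (auto simp: fp_def indicator_def)
    then show ?thesis using \<open>t = [e]\<close> by (simp add: if_distrib[of "\<lambda>x. x * _"] cong: if_cong)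
  next
    case False
    then have "fp e 0 t = 0" for e by (auto simp: fp_def indicator_def)
    then show ?thesis using False \<phi>[of "d # t"] by simp
  qed
next
  case (Suc n)
  show ?case
  proof (cases "length t < 2")
    case True
    then obtain e where t: "t = [e]" using Suc.prems by (cases t) auto
    have "fp c k t = (if k = 0 then of_bool (c = e) else 0)" for c k
      by (auto simp: fp_def run_short t)
    then show ?thesis unfolding t
      by (simp add: sum.atMost_Suc_shift if_distrib[of "\<lambda>x. x * _"] of_bool_def cong: if_cong
          del: sum.atMost_Suc run.simps)
  next
    case False
    have "run long \<phi> (Suc n) (d # t) = step (\<lambda>v. run long \<phi> n (d # v)) t"
      using False by (simp add: step_Cons)
    also have "\<dots> = step (\<lambda>v. \<Sum>k\<le>n. \<Sum>e\<in>UNIV. fp e k v * run long \<phi> (n - k) [d, e]) t"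
    proof (rule step_cong)
      fix v assume "v \<in> set_pmf (suffix_step p t)"
      then have "v \<noteq> []" using support_length(1)[of v t] False by auto
      then show "run long \<phi> n (d # v) = (\<Sum>k\<le>n. \<Sum>e\<in>UNIV. fp e k v * run long \<phi> (n - k) [d, e])"
        by (rule Suc.IH)
    qed
    also have "\<dots> = (\<Sum>k\<le>n. \<Sum>e\<in>UNIV. fp e (Suc k) t * run long \<phi> (n - k) [d, e])"
      using False by (simp add: step_sum step_multc fp_def)
    also have "\<dots> = (\<Sum>k\<le>Suc n. \<Sum>e\<in>UNIV. fp e k t * run long \<phi> (Suc n - k) [d, e])"
    proof -
      have "fp e 0 t = 0" for e using False by (auto simp: fp_def indicator_def)
      then show ?thesis by (simp add: sum.atMost_Suc_shift del: sum.atMost_Suc run.simps)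
    qed
    finally show ?thesis .
  qed
qed

section \<open>Generating functions and their first-step equations\<close>

definition summable_at :: "real \<Rightarrow> bool" where
  "summable_at z \<longleftrightarrow> 0 \<le> z \<and> (\<forall>s c. summable (\<lambda>n. fp c n (wd s) * z ^ n))"

lemma summable_atD: "summable_at z \<Longrightarrow> summable (\<lambda>n. fp c n (wd s) * z ^ n)"
  and summable_at_nonneg: "summable_at z \<Longrightarrow> 0 \<le> z"
  unfolding summable_at_def by blast+

text \<open>The convolution in \<open>run_Cons\<close> becomes a Cauchy product; the terms are
  nonnegative, so convergence is absolute.\<close>

lemma sums_Cons:
  assumes z: "0 \<le> z" and \<phi>: "\<And>w. 3 \<le> length w \<Longrightarrow> \<phi> w = 0" "\<And>w. 0 \<le> \<phi> w" and t: "t \<noteq> []"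
    and st: "\<And>e. (\<lambda>n. fp e n t * z ^ n) sums F e"
    and s\<phi>: "\<And>e. (\<lambda>n. run long \<phi> n [d, e] * z ^ n) sums S e"
  shows "(\<lambda>n. run long \<phi> n (d # t) * z ^ n) sums (\<Sum>e\<in>UNIV. F e * S e)"
proof -
  have "(\<lambda>n. \<Sum>k\<le>n. (fp e k t * z ^ k) * (run long \<phi> (n - k) [d, e] * z ^ (n - k))) sums (F e * S e)" for e
    using Cauchy_product_sums[of "\<lambda>n. fp e n t * z ^ n" "\<lambda>n. run long \<phi> n [d, e] * z ^ n"]
      st[of e] s\<phi>[of e] z
    by (simp add: sums_iff run_nonneg \<phi>(2))
  then have "(\<lambda>n. \<Sum>e\<in>UNIV. \<Sum>k\<le>n. (fp e k t * z ^ k) * (run long \<phi> (n - k) [d, e] * z ^ (n - k)))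
      sums (\<Sum>e\<in>UNIV. F e * S e)"
    by (intro sums_sum)
  moreover have "(\<Sum>e\<in>UNIV. \<Sum>k\<le>n. (fp e k t * z ^ k) * (run long \<phi> (n - k) [d, e] * z ^ (n - k))) =
      run long \<phi> n (d # t) * z ^ n" for n
  proof -
    have "(fp e k t * z ^ k) * (run long \<phi> (n - k) [d, e] * z ^ (n - k)) =
        fp e k t * run long \<phi> (n - k) [d, e] * z ^ n" if "k \<le> n" for e k
    proof -
      have "z ^ n = z ^ k * z ^ (n - k)" using that by (simp flip: power_add)
      then show ?thesis by simp
    qed
    then have "(\<Sum>e\<in>UNIV. \<Sum>k\<le>n. (fp e k t * z ^ k) * (run long \<phi> (n - k) [d, e] * z ^ (n - k))) =
        (\<Sum>e\<in>UNIV. \<Sum>k\<le>n. fp e k t * run long \<phi> (n - k) [d, e] * z ^ n)"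
      by (intro sum.cong) auto
    also have "\<dots> = (\<Sum>k\<le>n. \<Sum>e\<in>UNIV. fp e k t * run long \<phi> (n - k) [d, e] * z ^ n)"
      by (rule sum.swap)
    finally show ?thesis
      using run_Cons[where \<phi>=\<phi> and t=t and n=n and d=d, OF \<phi>(1) t] by (simp add: sum_distrib_right)
  qed
  ultimately show ?thesis by simp
qed

text \<open>Read from right to left: once \<open>d\<close> lies below \<open>r\<close>, the descent
  through \<open>r\<close> ends at the pair \<open>(d, e)\<close> with weight
  \<open>h z r e\<close>.\<close>

lemma sum_M0_Cons:
  "(\<Sum>t\<in>UNIV. M0 z s t * S t) = z * ((\<Sum>t\<in>UNIV. p2 s t * S t) +
     (\<Sum>d\<in>UNIV. \<Sum>r\<in>UNIV. p3 s d r * (\<Sum>e\<in>UNIV. h z r e * S (d, e))))"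
proof -
  have "(\<Sum>t\<in>UNIV. (\<Sum>r\<in>UNIV. p3 s (fst t) r * h z r (snd t)) * S t) =
      (\<Sum>d\<in>UNIV. \<Sum>e\<in>UNIV. (\<Sum>r\<in>UNIV. p3 s d r * h z r e) * S (d, e))"
    by (subst sum_UNIV_prod) simp
  also have "\<dots> = (\<Sum>d\<in>UNIV. \<Sum>r\<in>UNIV. p3 s d r * (\<Sum>e\<in>UNIV. h z r e * S (d, e)))"
    unfolding sum_distrib_left sum_distrib_right
    by (subst (2) sum.swap) (simp add: mult_ac)
  finally show ?thesis
    unfolding M0_def by (simp add: sum.distrib distrib_right mult.assoc sum_distrib_left[symmetric])
qed

text \<open>One equation serves both \<open>h\<close> and \<open>g\<close>. The first step leads to
  one, two or three letters; from three letters the walk must first descend to two, because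
  \<open>\<phi>\<close> vanishes on longer words.\<close>

lemma first_step_series:
  assumes z: "summable_at z" and \<phi>: "\<And>w. 3 \<le> length w \<Longrightarrow> \<phi> w = 0" "\<And>w. 0 \<le> \<phi> w"
    and S: "\<And>s. (\<lambda>n. run long \<phi> n (wd s) * z ^ n) sums S s"
  shows "S s = \<phi> (wd s) + z * (\<Sum>c\<in>UNIV. p1 s c * \<phi> [c]) + (\<Sum>t\<in>UNIV. M0 z s t * S t)"
proof -
  have z0: "0 \<le> z" and hz: "(\<lambda>n. fp c n (wd r) * z ^ n) sums h z r c" for r c
    using summable_at_nonneg[OF z] summable_sums[OF summable_atD[OF z]] by (simp_all add: h_def)
  have 1: "(\<lambda>n. run long \<phi> n [c] * z ^ n) sums \<phi> [c]" for c
  proof -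
    have "(\<lambda>n. run long \<phi> n [c] * z ^ n) = (\<lambda>n. if n = 0 then \<phi> [c] else 0)"
      by (auto simp: run_short)
    then show ?thesis using sums_If_finite[of "\<lambda>n. n = 0" "\<lambda>n. \<phi> [c]"] by simp
  qed
  have 3: "(\<lambda>n. run long \<phi> n (d # wd r) * z ^ n) sums (\<Sum>e\<in>UNIV. h z r e * S (d, e))" for d r
    using S[of "(d, _)"] by (intro sums_Cons z0 \<phi> hz) auto
  have "run long \<phi> (Suc n) (wd s) * z ^ n = (\<Sum>c\<in>UNIV. p1 s c * (run long \<phi> n [c] * z ^ n)) +
      (\<Sum>t\<in>UNIV. p2 s t * (run long \<phi> n (wd t) * z ^ n)) +
      (\<Sum>d\<in>UNIV. \<Sum>t\<in>UNIV. p3 s d t * (run long \<phi> n (d # wd t) * z ^ n))" for n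
    using step_wd[of "run long \<phi> n" "[]" s]
    by (simp add: distrib_right sum_distrib_right mult.assoc)
  moreover have "(\<lambda>n. (\<Sum>c\<in>UNIV. p1 s c * (run long \<phi> n [c] * z ^ n)) +
      (\<Sum>t\<in>UNIV. p2 s t * (run long \<phi> n (wd t) * z ^ n)) +
      (\<Sum>d\<in>UNIV. \<Sum>t\<in>UNIV. p3 s d t * (run long \<phi> n (d # wd t) * z ^ n))) sums
     ((\<Sum>c\<in>UNIV. p1 s c * \<phi> [c]) + (\<Sum>t\<in>UNIV. p2 s t * S t) +
      (\<Sum>d\<in>UNIV. \<Sum>r\<in>UNIV. p3 s d r * (\<Sum>e\<in>UNIV. h z r e * S (d, e))))"
    by (intro sums_add sums_sum sums_mult 1 3 S)
  ultimately have "(\<lambda>n. run long \<phi> (Suc n) (wd s) * z ^ n) sums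
     ((\<Sum>c\<in>UNIV. p1 s c * \<phi> [c]) + (\<Sum>t\<in>UNIV. p2 s t * S t) +
      (\<Sum>d\<in>UNIV. \<Sum>r\<in>UNIV. p3 s d r * (\<Sum>e\<in>UNIV. h z r e * S (d, e))))" (is "_ sums ?R")
    by presburger
  from sums_mult[OF this, of z]
  have "(\<lambda>n. run long \<phi> (Suc n) (wd s) * z ^ Suc n) sums (z * ?R)"
    by (simp add: mult_ac del: run.simps)
  then have "(\<lambda>n. run long \<phi> n (wd s) * z ^ n) sums (z * ?R + run long \<phi> 0 (wd s) * z ^ 0)"
    by (rule sums_Suc)
  with S[of s] have "S s = z * ?R + run long \<phi> 0 (wd s) * z ^ 0" by (rule sums_unique2)
  then show ?thesis unfolding sum_M0_Cons by (simp add: distrib_left)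
qed

lemma h_eq:
  assumes "summable_at z"
  shows "h z s c = z * p1 s c + (\<Sum>t\<in>UNIV. M0 z s t * h z t c)"
proof -
  have sm: "(\<lambda>n. run long (indicator {[c]}) n (wd s) * z ^ n) sums h z s c" for s
    using summable_sums[OF summable_atD[OF assms]] by (simp add: h_def fp_def)
  have ind: "indicator {[c]} w = (0 :: real)" if "3 \<le> length w" for w
    using that by (auto simp: indicator_def)
  have "h z s c = indicator {[c]} (wd s) + z * (\<Sum>e\<in>UNIV. p1 s e * indicator {[c]} [e]) +
      (\<Sum>t\<in>UNIV. M0 z s t * h z t c)"
    by (rule first_step_series[OF assms ind _ sm]) auto
  then show ?thesis by (simp add: indicator_def)
qed

lemma g_eq:
  assumes "summable_at z" "\<And>s. summable (\<lambda>n. gb t n (wd s) * z ^ n)"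
  shows "g z s t = of_bool (s = t) + (\<Sum>r\<in>UNIV. M0 z s r * g z r t)"
proof -
  have sm: "(\<lambda>n. run long (indicator {wd t}) n (wd s) * z ^ n) sums g z s t" for s
    using summable_sums[OF assms(2)] by (simp add: g_def gb_def)
  have ind: "indicator {wd t} w = (0 :: real)" if "3 \<le> length w" for w
  proof -
    have "length w \<noteq> length (wd t)" using that by simp
    then show ?thesis by (auto simp: indicator_def)
  qed
  have "g z s t = indicator {wd t} (wd s) + z * (\<Sum>e\<in>UNIV. p1 s e * indicator {wd t} [e]) +
      (\<Sum>r\<in>UNIV. M0 z s r * g z r t)"
    by (rule first_step_series[OF assms(1) ind _ sm]) auto
  then show ?thesis by (simp add: indicator_def)
qed

lemma sum_fp_le_1: "(\<Sum>n\<le>N. \<Sum>c\<in>UNIV. fp c n w) \<le> 1"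
proof -
  have "(\<lambda>v. \<Sum>c\<in>UNIV. indicator {[c]} v) = (indicator {v :: 'a list. length v = 1} :: _ \<Rightarrow> real)"
  proof
    fix v :: "'a list"
    show "(\<Sum>c\<in>UNIV. indicator {[c]} v) = (indicator {v. length v = 1} v :: real)"
    proof (cases "length v = 1")
      case True
      then obtain e where "v = [e]" by (auto simp: length_Suc_conv)
      then show ?thesis by (simp add: indicator_def of_bool_def)
    qed (auto simp: indicator_def)
  qed
  then have "(\<Sum>c\<in>UNIV. fp c n w) = run long (indicator {v. length v = 1}) n w" for n
    using run_sum[of long "\<lambda>c. indicator {[c]}" UNIV n] by (simp add: fp_def)
  then show ?thesis using sum_run_first_le_1[of long "{v. length v = 1}" w N]
    by (auto simp: disjoint_iff)
qed

lemma fp_summable: "summable (\<lambda>n. fp c n w)"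
proof (rule summableI_nonneg_bounded)
  fix N
  have "(\<Sum>n<N. fp c n w) \<le> (\<Sum>n\<le>N. fp c n w)" by (rule sum_mono2) auto
  also have "\<dots> \<le> (\<Sum>n\<le>N. \<Sum>c\<in>UNIV. fp c n w)" by (intro sum_mono member_le_sum) auto
  finally show "(\<Sum>n<N. fp c n w) \<le> 1" using sum_fp_le_1[of w N] by simp
qed simp

lemma summable_at_1 [simp]: "summable_at 1"
  by (simp add: summable_at_def fp_summable)

lemma h_sums: "(\<lambda>n. fp c n (wd s)) sums h 1 s c"
  by (simp add: h_def fp_summable summable_sums)

lemma h_nonneg [simp]: "0 \<le> h 1 s c"
  by (simp add: h_def suminf_nonneg fp_summable)

lemma u_nonneg [simp]: "0 \<le> u s"
proof -
  have "(\<lambda>n. \<Sum>c\<in>UNIV. fp c n (wd s)) sums (\<Sum>c\<in>UNIV. h 1 s c)"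
    by (intro sums_sum h_sums)
  then have "(\<Sum>c\<in>UNIV. h 1 s c) \<le> 1"
    using sum_fp_le_1[of "wd s"]
    unfolding sums_def_le by (intro LIMSEQ_le_const2) auto
  then show ?thesis by (simp add: u_def)
qed

lemma M_nonneg [simp]: "0 \<le> M0 1 s t" "0 \<le> M1 s t" "0 \<le> M s t"
  by (auto simp: M_def M0_def M1_def intro!: add_nonneg_nonneg sum_nonneg)

lemma escape_nonneg [simp]: "0 \<le> escape s"
  by (auto simp: escape_def intro!: sum_nonneg)

lemma sum_p: "(\<Sum>c\<in>UNIV. p1 s c) + (\<Sum>t\<in>UNIV. p2 s t) + (\<Sum>d\<in>UNIV. \<Sum>t\<in>UNIV. p3 s d t) = 1"
  using step_wd[of "\<lambda>_. 1" "[]" s] by simp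

lemma escape_p3: "escape s = (\<Sum>d\<in>UNIV. \<Sum>t\<in>UNIV. p3 s d t * u t)"
  unfolding escape_def M1_def sum_distrib_right by (rule sum.swap)

text \<open>Sum the equation of \<open>h\<close> over the final letter and subtract from total mass
  \<open>1\<close>. A step to \<open>d # wd r\<close> fails to descend with weight
  \<open>u r\<close>, which gives the term \<open>escape\<close>.\<close>

lemma u_eq: "u s = escape s + (\<Sum>t\<in>UNIV. M0 1 s t * u t)"
proof -
  have "(\<Sum>c\<in>UNIV. h 1 s c) = (\<Sum>c\<in>UNIV. p1 s c) + (\<Sum>c\<in>UNIV. \<Sum>t\<in>UNIV. M0 1 s t * h 1 t c)"
    by (subst h_eq) (auto simp: sum.distrib)
  also have "(\<Sum>c\<in>UNIV. \<Sum>t\<in>UNIV. M0 1 s t * h 1 t c) = (\<Sum>t\<in>UNIV. M0 1 s t * (1 - u t))"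
    by (subst sum.swap) (simp add: u_def sum_distrib_left)
  also have "\<dots> = (\<Sum>t\<in>UNIV. M0 1 s t * 1) - (\<Sum>t\<in>UNIV. M0 1 s t * u t)"
    by (simp add: right_diff_distrib sum_subtractf)
  also have "(\<Sum>t\<in>UNIV. M0 1 s t * 1) = (\<Sum>t\<in>UNIV. p2 s t) + (\<Sum>d\<in>UNIV. \<Sum>r\<in>UNIV. p3 s d r * (1 - u r))"
    by (subst sum_M0_Cons[of 1 s "\<lambda>_. 1"]) (simp add: u_def)
  also have "(\<Sum>d\<in>UNIV. \<Sum>r\<in>UNIV. p3 s d r * (1 - u r)) = (\<Sum>d\<in>UNIV. \<Sum>t\<in>UNIV. p3 s d t) - escape s"
    by (simp add: escape_p3 right_diff_distrib sum_subtractf)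
  finally show ?thesis using sum_p[of s] by (simp add: u_def)
qed

text \<open>Once \<open>u\<close> is known to be positive, this says that the Doob transform of
  \<open>M\<close> by \<open>u\<close> is stochastic.\<close>

lemma M_u: "(\<Sum>t\<in>UNIV. M s t * u t) = u s"
  using u_eq[of s] by (simp add: M_def distrib_right sum.distrib escape_def)

text \<open>\<open>ext m \<beta> w\<close> is the sum of \<open>\<beta>\<close> over the successive record lows of the length, expected for the
  walk started at \<open>w\<close> and stopped below length \<open>m\<close>; the list is reversed for the recursion.\<close>

fun ext_rev :: "nat \<Rightarrow> ('a \<times> 'a \<Rightarrow> real) \<Rightarrow> 'a list \<Rightarrow> real" where
  "ext_rev m \<beta> (b # a # w) = (if length w + 2 < m then 0
     else \<beta> (a, b) + (\<Sum>c\<in>UNIV. h 1 (a, b) c * ext_rev m \<beta> (c # w)))"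
| "ext_rev m \<beta> _ = 0"

definition ext where "ext m \<beta> w = ext_rev m \<beta> (rev w)"

lemma ext_wd:
  "m \<le> length w + 2 \<Longrightarrow> ext m \<beta> (w @ wd s) = \<beta> s + (\<Sum>c\<in>UNIV. h 1 s c * ext m \<beta> (w @ [c]))"
  by (cases s) (simp add: ext_def)

lemma ext_short: "length w < m \<or> length w < 2 \<Longrightarrow> ext m \<beta> w = 0"
proof (cases "length w < 2")
  case True
  then have "w = [] \<or> (\<exists>c. w = [c])" by (cases w) auto
  then show ?thesis by (auto simp: ext_def)
next
  case False
  assume *: "length w < m \<or> length w < 2"
  from False obtain v a b where "w = v @ wd (a, b)"
    by (metis length_ge_2E not_less surj_pair)
  then show ?thesis using * by (simp add: ext_def)
qed

lemma ext_nonneg: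
  assumes "\<And>s. 0 \<le> \<beta> s" shows "0 \<le> ext m \<beta> w"
proof -
  have "0 \<le> ext_rev m \<beta> v" if "\<And>s. 0 \<le> \<beta> s" for m \<beta> v
    using that by (induction m \<beta> v rule: ext_rev.induct) (auto intro!: add_nonneg_nonneg sum_nonneg)
  from this[OF assms] show ?thesis by (simp add: ext_def)
qed

text \<open>Contributions from below the current pair cancel by \<open>h_eq\<close>, since
  \<open>h\<close> already averages over how the pair is removed. Only the top term feels the step,
  and it is transformed by \<open>M\<close>.\<close>

lemma step_ext:
  assumes "m \<le> length w + 2"
  shows "step (ext m \<beta>) (w @ wd s) = ext m \<beta> (w @ wd s) + (\<Sum>t\<in>UNIV. M s t * \<beta> t) - \<beta> s"
proof -
  let ?E = "\<lambda>c. ext m \<beta> (w @ [c])"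
  have e2: "ext m \<beta> (w @ wd t) = \<beta> t + (\<Sum>c\<in>UNIV. h 1 t c * ?E c)" for t
    using ext_wd assms by blast
  have e3: "ext m \<beta> (w @ d # wd t) = \<beta> t + (\<Sum>e\<in>UNIV. h 1 t e * ext m \<beta> (w @ wd (d, e)))" for d t
    using ext_wd[of m "w @ [d]" \<beta> t] assms by simp
  have "step (ext m \<beta>) (w @ wd s) = (\<Sum>c\<in>UNIV. p1 s c * ?E c) +
      (\<Sum>t\<in>UNIV. M0 1 s t * ext m \<beta> (w @ wd t)) + (\<Sum>d\<in>UNIV. \<Sum>t\<in>UNIV. p3 s d t * \<beta> t)"
    unfolding step_wd e3 sum_M0_Cons by (simp add: distrib_left sum.distrib)
  also have "(\<Sum>d\<in>UNIV. \<Sum>t\<in>UNIV. p3 s d t * \<beta> t) = (\<Sum>t\<in>UNIV. M1 s t * \<beta> t)"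
    unfolding M1_def sum_distrib_right by (rule sum.swap)
  also have "(\<Sum>t\<in>UNIV. M0 1 s t * ext m \<beta> (w @ wd t)) =
      (\<Sum>t\<in>UNIV. M0 1 s t * \<beta> t) + (\<Sum>c\<in>UNIV. (\<Sum>t\<in>UNIV. M0 1 s t * h 1 t c) * ?E c)"
    unfolding e2 distrib_left sum.distrib sum_distrib_left sum_distrib_right
    by (subst (2) sum.swap) (simp add: mult.assoc)
  also have "(\<Sum>c\<in>UNIV. (\<Sum>t\<in>UNIV. M0 1 s t * h 1 t c) * ?E c) =
      (\<Sum>c\<in>UNIV. h 1 s c * ?E c) - (\<Sum>c\<in>UNIV. p1 s c * ?E c)"
  proof -
    have "(\<Sum>t\<in>UNIV. M0 1 s t * h 1 t c) = h 1 s c - p1 s c" for c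
      using h_eq[of 1 s c] by simp
    then show ?thesis by (simp add: left_diff_distrib sum_subtractf)
  qed
  finally show ?thesis
    unfolding ext_wd[OF assms] M_def distrib_right sum.distrib by linarith
qed

text \<open>Chebyshev at time \<open>n\<close>; the factor \<open>2\<close> comes from
  \<open>n + 1 \<le> 2 * n\<close>.\<close>

lemma tail_bound:
  assumes B: "\<And>n. run UNIV (\<lambda>w. (\<Phi> w - real n * L)\<^sup>2) n [] \<le> B * (real n + 1)"
    and \<epsilon>: "0 < \<epsilon>" and n: "0 < n"
  shows "run UNIV (indicator {w. \<epsilon> * real n \<le> \<bar>\<Phi> w - real n * L\<bar>}) n [] \<le> 2 * B / \<epsilon>\<^sup>2 / real n"
proof -
  let ?c = "1 / (\<epsilon> * real n)\<^sup>2"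
  have c: "0 < ?c" using \<epsilon> n by simp
  have "run UNIV (indicator {w. \<epsilon> * real n \<le> \<bar>\<Phi> w - real n * L\<bar>}) n [] \<le>
      run UNIV (\<lambda>w. ?c * (\<Phi> w - real n * L)\<^sup>2) n []"
  proof (rule run_mono)
    fix w
    show "indicator {w. \<epsilon> * real n \<le> \<bar>\<Phi> w - real n * L\<bar>} w \<le> ?c * (\<Phi> w - real n * L)\<^sup>2"
    proof (cases "\<epsilon> * real n \<le> \<bar>\<Phi> w - real n * L\<bar>")
      case True
      then have "(\<epsilon> * real n)\<^sup>2 \<le> (\<Phi> w - real n * L)\<^sup>2"
        using power_mono[OF True, of 2] \<epsilon> by simp
      then show ?thesis using True \<epsilon> n by (simp add: field_simps)
    qed simp
  qed auto
  also have "\<dots> = ?c * run UNIV (\<lambda>w. (\<Phi> w - real n * L)\<^sup>2) n []" by (simp only: run_cmult)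
  also have "\<dots> \<le> ?c * (B * (real n + 1))" using B[of n] c by (intro mult_left_mono) auto
  also have "\<dots> \<le> ?c * (B * (2 * real n))"
  proof -
    have "0 \<le> run UNIV (\<lambda>w. (\<Phi> w - real 0 * L)\<^sup>2) 0 []" by simp
    also have "\<dots> \<le> B" using B[of 0] by simp
    finally have "0 \<le> B" .
    then show ?thesis using c n by (intro mult_left_mono) auto
  qed
  also have "\<dots> = 2 * B / \<epsilon>\<^sup>2 / real n" using n \<epsilon> by (simp add: power2_eq_square field_simps)
  finally show ?thesis .
qed

end

section \<open>Irreducibility and positivity of the escape probabilities\<close>

text \<open>Transience and suffix-irreducibility as statements about \<open>run\<close>, free of
  probability spaces; transience takes the form of finite expected visits.\<close>

locale suffix_walk = suffix_kernel +
  assumes summable_run: "reachable v \<Longrightarrow> summable (\<lambda>n. run UNIV (indicator {v}) n w)"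
    and irreducible: "1 \<le> m \<Longrightarrow> 0 < run UNIV (indicator {w}) m [] \<Longrightarrow>
      \<exists>n\<ge>1. 0 < run {v. length w \<le> length v} (indicator {w @ v @ wd s |v. True}) n w"
begin

lemma run_Suc_pos: "0 < run B f (Suc n) w \<longleftrightarrow> w \<in> B \<and> 0 < step (run B f n) w"
  by (cases "w \<in> B") simp_all

lemma run_pos_obtain:
  assumes "0 < run B f n w" "\<And>v. 0 \<le> f v"
  obtains x where "0 < f x" "0 < run B (indicator {x}) n w"
  using assms(1)
proof (induction n arbitrary: w thesis)
  case (Suc n)
  then have B: "w \<in> B" and "0 < step (run B f n) w" by (simp_all only: run_Suc_pos)
  then obtain v where v: "v \<in> set_pmf (suffix_step p w)" "0 < run B f n v"
    using step_pos_iff[of "run B f n" w] run_nonneg[of f B n] assms(2) by auto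
  then obtain x where x: "0 < f x" "0 < run B (indicator {x}) n v" using Suc.IH by blast
  have "0 < step (run B (indicator {x}) n) w"
    by (subst step_pos_iff) (use v x in \<open>auto intro!: run_nonneg\<close>)
  then show ?case using Suc.prems(1)[OF x(1)] B by simp
qed auto

lemma run_pos_trans:
  assumes "0 < run UNIV (indicator {v}) m w" "0 < run UNIV (indicator {x}) n v"
  shows "0 < run UNIV (indicator {x}) (m + n) w"
proof -
  let ?c = "run UNIV (indicator {x}) n v"
  have "?c * run UNIV (indicator {v}) m w \<le> run UNIV (run UNIV (indicator {x}) n) m w"
    unfolding run_cmult[of UNIV ?c "indicator {v}" m, THEN fun_cong, symmetric]
    using assms(2) by (intro run_mono) (auto simp: indicator_def intro!: run_nonneg)
  then show ?thesis using assms by (simp add: run_add) (meson less_le_trans mult_pos_pos)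
qed

text \<open>\<open>irreducible\<close> applies only to words visited at a time at least
  \<open>1\<close>, hence the initial step to some \<open>v\<close>.\<close>

lemma pair_reachable: obtains w m where "1 \<le> m" "0 < run UNIV (indicator {w @ wd s}) m []"
proof -
  obtain v where "v \<in> set_pmf (suffix_step p [])" using set_pmf_not_empty by fastforce
  then have v: "0 < run UNIV (indicator {v}) 1 []"
    using step_pos_iff[of "indicator {v}" "[]"] by (force simp: indicator_def)
  then obtain n where "0 < run {x. length v \<le> length x} (indicator {v @ x @ wd s |x. True}) n v"
    using irreducible[of 1 v s] by auto
  also have "\<dots> \<le> run UNIV (indicator {v @ x @ wd s |x. True}) n v"
    by (rule run_mono) auto
  finally obtain x where "0 < (indicator {v @ x @ wd s |x. True} x :: real)"
      "0 < run UNIV (indicator {x}) n v"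
    by (rule run_pos_obtain) auto
  moreover then obtain y where "x = (v @ y) @ wd s" by (auto simp: indicator_def split: if_splits)
  ultimately show ?thesis using that[of "1 + n" "v @ y"] run_pos_trans[OF v] by auto
qed

text \<open>A minimum principle: \<open>ext m \<beta>\<close> is nonnegative, and where it vanishes
  on words of length at least \<open>m\<close>, so does \<open>\<beta>\<close> at the last pair. By
  \<open>step_ext\<close> its one-step mean is then \<open>0\<close>, so it vanishes at every
  possible successor.\<close>

lemma run_pos_ext_zero:
  assumes "0 < run {v. m \<le> length v} f n w" "2 \<le> m" "ext m \<beta> w = 0" "\<And>s. 0 \<le> \<beta> s"
    and M\<beta>: "\<And>s. \<beta> s = 0 \<Longrightarrow> (\<Sum>t\<in>UNIV. M s t * \<beta> t) = 0" and f: "\<And>v. 0 \<le> f v"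
  shows "\<exists>v. 0 < f v \<and> ext m \<beta> v = 0"
  using assms(1,3)
proof (induction n arbitrary: w)
  case (Suc n)
  then have len: "m \<le> length w" and "0 < step (run {v. m \<le> length v} f n) w"
    by (simp_all only: run_Suc_pos mem_Collect_eq)
  then obtain v where v: "v \<in> set_pmf (suffix_step p w)" "0 < run {v. m \<le> length v} f n v"
    using step_pos_iff[of "run {v. m \<le> length v} f n" w] run_nonneg[of f _ n] f by auto
  obtain w' s where w: "w = w' @ wd s" using length_ge_2E[of w] len \<open>2 \<le> m\<close> by auto
  have m: "m \<le> length w' + 2" using len w by simp
  have nn: "0 \<le> ext m \<beta> x" for x by (rule ext_nonneg) (rule assms(4))
  have "0 \<le> (\<Sum>c\<in>UNIV. h 1 s c * ext m \<beta> (w' @ [c]))" by (intro sum_nonneg) (simp add: nn)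
  then have "\<beta> s = 0" using ext_wd[OF m, of \<beta> s] Suc.prems(2) assms(4)[of s] w by simp
  then have "step (ext m \<beta>) w = 0" using step_ext[OF m, of \<beta> s] M\<beta>[of s] Suc.prems(2) w by simp
  then have "ext m \<beta> v = 0" using step_pos_iff[of "ext m \<beta>" w] nn v(1)
    by (metis less_eq_real_def less_irrefl)
  then show ?case using Suc.IH v(2) by blast
qed auto

text \<open>Irreducibility of \<open>M\<close>: for a closed set \<open>S\<close>, the extension of the indicator of its complement
  stays zero along every path that does not get shorter than its starting word.\<close>

lemma closed_UNIV:
  assumes "S \<noteq> {}" and closed: "\<And>s t. s \<in> S \<Longrightarrow> 0 < M s t \<Longrightarrow> t \<in> S"
  shows "S = UNIV"
proof -
  obtain s0 where s0: "s0 \<in> S" using assms(1) by auto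
  define \<beta> :: "'a \<times> 'a \<Rightarrow> real" where "\<beta> = indicator (- S)"
  obtain w m where wm: "1 \<le> m" "0 < run UNIV (indicator {w @ wd s0}) m []"
    using pair_reachable[of s0] by blast
  let ?m = "length (w @ wd s0)"
  have M\<beta>: "(\<Sum>t\<in>UNIV. M s t * \<beta> t) = 0" if "\<beta> s = 0" for s
  proof (rule sum.neutral, rule ballI)
    fix t
    have "s \<in> S" using that by (auto simp: \<beta>_def indicator_def split: if_splits)
    then have "t \<in> S \<or> M s t = 0" using closed[of s t] M_nonneg(3)[of s t] by linarith
    then show "M s t * \<beta> t = 0" by (auto simp: \<beta>_def)
  qed
  \<comment> \<open>The cutoff at the length of the start word removes all terms from below, leaving
    only \<open>\<beta> s0\<close>, which is \<open>0\<close>.\<close>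
  have e0: "ext ?m \<beta> (w @ wd s0) = 0"
    using ext_short[of "w @ [c]" ?m \<beta> for c] s0 by (subst ext_wd) (auto simp: \<beta>_def)
  have "t \<in> S" for t
  proof -
    obtain n where "0 < run {v. ?m \<le> length v} (indicator {(w @ wd s0) @ v @ wd t |v. True}) n (w @ wd s0)"
      using irreducible[OF wm, of t] by blast
    from run_pos_ext_zero[OF this _ e0 _ M\<beta>] obtain v
      where "0 < (indicator {(w @ wd s0) @ v @ wd t |v. True} v :: real)" "ext ?m \<beta> v = 0"
      by (auto simp: \<beta>_def)
    then obtain x where x: "ext ?m \<beta> ((w @ wd s0 @ x) @ wd t) = 0"
      by (auto simp: indicator_def split: if_splits)
    have nn: "0 \<le> ext ?m \<beta> y" for y by (rule ext_nonneg) (auto simp: \<beta>_def)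
    have "0 \<le> (\<Sum>c\<in>UNIV. h 1 t c * ext ?m \<beta> ((w @ wd s0 @ x) @ [c]))"
      by (intro sum_nonneg mult_nonneg_nonneg nn) simp
    moreover have "ext ?m \<beta> ((w @ wd s0 @ x) @ wd t) = \<beta> t + (\<Sum>c\<in>UNIV. h 1 t c * ext ?m \<beta> ((w @ wd s0 @ x) @ [c]))"
      by (rule ext_wd) simp
    moreover have "0 \<le> \<beta> t" by (simp add: \<beta>_def)
    ultimately have "\<beta> t = 0" using x by linarith
    then show ?thesis by (auto simp: \<beta>_def indicator_def split: if_splits)
  qed
  then show ?thesis by auto
qed

section \<open>Positivity of \<open>u\<close>\<close>

definition low :: "'a list set" where "low = {w. length w \<le> 1}"

lemma finite_low [simp]: "finite low"
  unfolding low_def using finite_lists_length_le[of "UNIV :: 'a set" 1] by simp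

text \<open>There are finitely many such words; each is either reachable, with finite expected
  visits, or never visited from the empty word.\<close>

lemma low_summable: "summable (\<lambda>n. run UNIV (indicator low) n [])"
proof -
  have "(indicator low :: 'a list \<Rightarrow> real) = (\<lambda>w. \<Sum>v\<in>low. indicator {v} w)"
  proof
    fix w
    have "(\<Sum>v\<in>low. indicator {v} w :: real) = (\<Sum>v\<in>low. if v = w then 1 else 0)"
      by (intro sum.cong) (auto simp: indicator_def)
    then show "(indicator low w :: real) = (\<Sum>v\<in>low. indicator {v} w)" by (simp add: indicator_def)
  qed
  then have "run UNIV (indicator low) n [] = (\<Sum>v\<in>low. run UNIV (indicator {v}) n [])" for n
    by (simp add: run_sum)
  moreover have "summable (\<lambda>n. run UNIV (indicator {v}) n [])" for v
  proof (cases "reachable v")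
    case False
    then have "run UNIV (indicator {v}) n [] = 0" for n
      unfolding reachable_def using run_nonneg[of "indicator {v}" UNIV n "[]"]
      by (metis indicator_pos_le less_eq_real_def)
    then show ?thesis by simp
  qed (rule summable_run)
  ultimately show ?thesis by (simp add: summable_sum)
qed

text \<open>Vanishing \<open>u\<close> makes every descent from two letters certain. A longer word
  is eaten from the right: first its tail down to one letter \<open>e\<close>, then the pair
  \<open>[d, e]\<close>.\<close>

lemma fp_sums_1:
  assumes u0: "\<And>s. u s = 0" and "t \<noteq> []"
  shows "\<exists>F. (\<forall>c. (\<lambda>n. fp c n t) sums F c) \<and> (\<Sum>c\<in>UNIV. F c) = 1"
  using \<open>t \<noteq> []\<close>
proof (induction t)
  case (Cons d t)
  show ?case
  proof (cases "t = []")
    case True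
    have "(\<lambda>n. fp c n [d]) sums of_bool (c = d)" for c
    proof -
      have "(\<lambda>n. fp c n [d]) = (\<lambda>n. if n = 0 then of_bool (c = d) else 0)"
        by (auto simp: fp_def run_short indicator_def)
      then show ?thesis using sums_If_finite[of "\<lambda>n. n = 0" "\<lambda>n. of_bool (c = d)"] by simp
    qed
    then show ?thesis using True by (intro exI[of _ "\<lambda>c. of_bool (c = d)"]) (simp add: of_bool_def)
  next
    case False
    then obtain F where F: "\<And>c. (\<lambda>n. fp c n t) sums F c" "(\<Sum>c\<in>UNIV. F c) = 1"
      using Cons by auto
    have "(\<lambda>n. fp c n (d # t)) sums (\<Sum>e\<in>UNIV. F e * h 1 (d, e) c)" for c
    proof -
      have ind: "indicator {[c]} w = (0 :: real)" if "3 \<le> length w" for w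
        using that by (auto simp: indicator_def)
      have hs: "(\<lambda>n. run long (indicator {[c]}) n [d, e] * 1 ^ n) sums h 1 (d, e) c" for e
        using h_sums[of c "(d, e)"] by (simp add: fp_def)
      have "(\<lambda>n. run long (indicator {[c]}) n (d # t) * 1 ^ n) sums (\<Sum>e\<in>UNIV. F e * h 1 (d, e) c)"
        by (rule sums_Cons[OF _ ind _ False _ hs]) (use F(1) in auto)
      then show ?thesis by (simp add: fp_def)
    qed
    moreover have "(\<Sum>c\<in>UNIV. \<Sum>e\<in>UNIV. F e * h 1 (d, e) c) = 1"
    proof -
      have "(\<Sum>c\<in>UNIV. h 1 (d, e) c) = 1" for e using u0[of "(d, e)"] by (simp add: u_def)
      then show ?thesis using F(2) by (subst sum.swap) (simp flip: sum_distrib_left)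
    qed
    ultimately show ?thesis by (intro exI[of _ "\<lambda>c. \<Sum>e\<in>UNIV. F e * h 1 (d, e) c"]) auto
  qed
qed simp

text \<open>If \<open>u\<close> vanished, the walk would almost surely be in \<open>low\<close> at
  time \<open>m\<close> or later, so the expected number of such visits would be at least
  \<open>1\<close> for every \<open>m\<close>. This contradicts the vanishing tails of the series in
  \<open>low_summable\<close>.\<close>

lemma u_not_all_zero: "\<exists>s. u s \<noteq> 0"
proof (rule ccontr)
  assume "\<nexists>s. u s \<noteq> 0"
  then have u0: "u s = 0" for s by blast
  \<comment> \<open>Probability of reaching one letter within \<open>N\<close> steps. At the empty
    word every \<open>fp\<close> is \<open>0\<close>, but that word is itself in \<open>low\<close>,
    hence the value \<open>1\<close>.\<close>
  define \<tau> where "\<tau> N w = (if w = [] then 1 else \<Sum>n\<le>N. \<Sum>c\<in>UNIV. fp c n w)" for N w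
  define R where "R n w = run UNIV (indicator low) n w" for n w
  have Rnn: "0 \<le> R n w" for n w unfolding R_def by (rule run_nonneg) simp
  have \<tau>R: "\<tau> N w \<le> (\<Sum>n\<le>N. R n w)" for N w
  proof (cases "w = []")
    case True
    have "R 0 w \<le> (\<Sum>n\<le>N. R n w)" by (rule member_le_sum) (auto simp: Rnn)
    then show ?thesis using True by (simp add: \<tau>_def R_def low_def)
  next
    case False
    have "(\<Sum>c\<in>UNIV. fp c n w) \<le> R n w" for n
    proof -
      have le: "(\<Sum>c\<in>UNIV. indicator {[c]} v :: real) \<le> indicator low v" for v :: "'a list"
      proof (cases "\<exists>d. v = [d]")
        case True
        then show ?thesis by (auto simp: low_def indicator_def of_bool_def)
      qed (auto simp: indicator_def)
      have "(\<Sum>c\<in>UNIV. fp c n w) = run long (\<lambda>v. \<Sum>c\<in>UNIV. indicator {[c]} v) n w"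
        by (simp add: run_sum fp_def)
      also have "\<dots> \<le> R n w" unfolding R_def
        by (rule run_mono) (auto intro!: le sum_nonneg)
      finally show ?thesis .
    qed
    then show ?thesis using False by (simp add: \<tau>_def sum_mono)
  qed
  have lim: "(\<lambda>N. \<tau> N w) \<longlonglongrightarrow> 1" for w
  proof (cases "w = []")
    case False
    from fp_sums_1[OF u0 this] obtain F where F: "\<And>c. (\<lambda>n. fp c n w) sums F c" "(\<Sum>c\<in>UNIV. F c) = 1"
      by auto
    have "(\<lambda>n. \<Sum>c\<in>UNIV. fp c n w) sums (\<Sum>c\<in>UNIV. F c)" by (intro sums_sum F)
    then show ?thesis using F(2) False by (simp add: sums_def_le \<tau>_def)
  qed (simp add: \<tau>_def)
  have sR: "summable (\<lambda>n. R n [])" unfolding R_def by (rule low_summable)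
  obtain m where m: "(\<Sum>i. R (i + m) []) < 1"
    using suminf_exist_split[OF zero_less_one sR] Rnn
    by (metis (no_types, lifting) abs_less_iff order_refl real_norm_def)
  have "run UNIV (\<tau> N) m [] \<le> (\<Sum>i. R (i + m) [])" for N
  proof -
    have "run UNIV (\<tau> N) m [] \<le> run UNIV (\<lambda>w. \<Sum>n\<le>N. R n w) m []"
      by (rule run_mono) (auto simp: \<tau>R, auto simp: \<tau>_def intro!: sum_nonneg)
    also have "\<dots> = (\<Sum>n\<le>N. R (n + m) [])"
      unfolding R_def by (subst run_sum) (simp add: run_add[symmetric] add.commute)
    also have "\<dots> \<le> (\<Sum>i. R (i + m) [])"
      using summable_ignore_initial_segment[OF sR] Rnn by (intro sum_le_suminf) auto
    finally show ?thesis .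
  qed
  moreover have "(\<lambda>N. run UNIV (\<tau> N) m []) \<longlonglongrightarrow> run UNIV (\<lambda>w. 1) m []"
    by (rule run_tendsto) (rule lim)
  ultimately have "1 \<le> (\<Sum>i. R (i + m) [])"
    by (intro LIMSEQ_le_const2[of "\<lambda>N. run UNIV (\<tau> N) m []"]) auto
  then show False using m by simp
qed

text \<open>By \<open>M_u\<close> the zeros of \<open>u\<close> form a set closed under
  \<open>M\<close>, so one zero would make \<open>u\<close> vanish everywhere.\<close>

lemma u_pos: "0 < u s"
proof (rule ccontr)
  assume "\<not> 0 < u s"
  then have s: "u s = 0" using u_nonneg[of s] by linarith
  have "{s. u s = 0} = UNIV"
  proof (rule closed_UNIV)
    fix s t assume st: "s \<in> {s. u s = 0}" "0 < M s t"
    have "M s t * u t \<le> (\<Sum>t\<in>UNIV. M s t * u t)"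
      by (rule member_le_sum) auto
    then have "M s t * u t \<le> 0" using st(1) M_u[of s] by simp
    then show "t \<in> {s. u s = 0}" using st(2) u_nonneg[of t]
      by (metis (mono_tags, lifting) mem_Collect_eq mult_pos_pos less_eq_real_def not_less)
  qed (use s in blast)
  then show False using u_not_all_zero by auto
qed

text \<open>The confined walk never reads the prefix \<open>x\<close>, so its visits are among those
  of the walk on the longer words.\<close>

lemma gb_le_run: "gb t n w \<le> run UNIV (indicator {x @ wd t}) n (x @ w)"
proof (induction n arbitrary: w)
  case (Suc n)
  show ?case
  proof (cases "2 \<le> length w")
    case True
    have "gb t (Suc n) w = step (gb t n) w" using True by (simp add: gb_def)
    also have "\<dots> \<le> step (\<lambda>v. run UNIV (indicator {x @ wd t}) n (x @ v)) w"
      by (rule step_mono) (rule Suc)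
    also have "\<dots> = run UNIV (indicator {x @ wd t}) (Suc n) (x @ w)"
      using True by (simp add: step_shift)
    finally show ?thesis .
  next
    case False
    then show ?thesis using run_nonneg[of "indicator {x @ wd t}" UNIV "Suc n" "x @ w"]
      by (simp add: gb_def del: run.simps) (simp add: run_short)
  qed
qed (simp add: gb_def indicator_def)

text \<open>Transience constrains only reachable words, so \<open>s\<close> is placed at the end of
  a reachable word \<open>x @ wd s\<close>. Then \<open>x @ wd t\<close> is either reachable as well
  or never hit from there.\<close>

lemma gb_summable: "summable (\<lambda>n. gb t n (wd s))"
proof -
  obtain x m where xm: "0 < run UNIV (indicator {x @ wd s}) m []" using pair_reachable[of s] by blast
  have "summable (\<lambda>n. run UNIV (indicator {x @ wd t}) n (x @ wd s))"
  proof (cases "reachable (x @ wd t)")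
    case False
    have "run UNIV (indicator {x @ wd t}) n (x @ wd s) = 0" for n
    proof (rule ccontr)
      assume "run UNIV (indicator {x @ wd t}) n (x @ wd s) \<noteq> 0"
      then have "0 < run UNIV (indicator {x @ wd t}) n (x @ wd s)"
        using run_nonneg[of "indicator {x @ wd t}" UNIV n "x @ wd s"] by simp
      then show False using run_pos_trans[OF xm] False by (auto simp: reachable_def)
    qed
    then show ?thesis by simp
  qed (rule summable_run)
  then show ?thesis by (rule summable_comparison_test') (use gb_le_run[of t _ "wd s" x] in auto)
qed

lemma g_nonneg [simp]: "0 \<le> g 1 s t"
  by (simp add: g_def suminf_nonneg gb_summable)

lemma g_left: "g 1 s t = of_bool (s = t) + (\<Sum>r\<in>UNIV. M0 1 s r * g 1 r t)"
  by (rule g_eq) (auto simp: gb_summable)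

text \<open>The last-step counterpart of \<open>g_left\<close> without a path decomposition: a right
  inverse of \<open>1 - M0 1\<close> is also a left inverse.\<close>

lemma g_right: "g 1 s t = of_bool (s = t) + (\<Sum>r\<in>UNIV. g 1 s r * M0 1 r t)"
proof -
  have inv: "(\<Sum>r\<in>UNIV. (of_bool (i = r) - M0 1 i r) * g 1 r j) = of_bool (i = j)" for i j
    using g_left[of i j] by (simp add: left_diff_distrib sum_subtractf)
  have "(\<Sum>r\<in>UNIV. g 1 s r * (of_bool (r = t) - M0 1 r t)) = of_bool (s = t)"
    by (rule finite_matrix_left_inverse[where A="\<lambda>i r. of_bool (i = r) - M0 1 i r" and B="g 1"]) (rule inv)
  then show ?thesis by (simp add: right_diff_distrib sum_subtractf)
qed

text \<open>Decomposition at the last two-letter word of a walk that never falls below two letters.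
  Algebraically, \<open>u_eq\<close> says that \<open>1 - M0 1\<close> maps \<open>u\<close> to
  \<open>escape\<close>, and \<open>g 1\<close> is its inverse.\<close>

lemma g_escape: "(\<Sum>t\<in>UNIV. g 1 s t * escape t) = u s"
proof -
  have "(\<Sum>t\<in>UNIV. g 1 s t * escape t) = (\<Sum>t\<in>UNIV. g 1 s t * u t) - (\<Sum>t\<in>UNIV. g 1 s t * (\<Sum>r\<in>UNIV. M0 1 t r * u r))"
  proof -
    have "escape t = u t - (\<Sum>r\<in>UNIV. M0 1 t r * u r)" for t using u_eq[of t] by simp
    then show ?thesis by (simp add: right_diff_distrib sum_subtractf)
  qed
  also have "(\<Sum>t\<in>UNIV. g 1 s t * (\<Sum>r\<in>UNIV. M0 1 t r * u r)) = (\<Sum>r\<in>UNIV. (\<Sum>t\<in>UNIV. g 1 s t * M0 1 t r) * u r)"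
    unfolding sum_distrib_left sum_distrib_right by (subst sum.swap) (simp add: mult.assoc)
  also have "\<dots> = (\<Sum>r\<in>UNIV. (g 1 s r - of_bool (s = r)) * u r)"
  proof -
    have "(\<Sum>t\<in>UNIV. g 1 s t * M0 1 t r) = g 1 s r - of_bool (s = r)" for r
      using g_right[of s r] by simp
    then show ?thesis by simp
  qed
  also have "\<dots> = (\<Sum>r\<in>UNIV. g 1 s r * u r) - u s"
    by (simp add: left_diff_distrib sum_subtractf)
  finally show ?thesis by simp
qed

subsection \<open>Correctors and exponential decay\<close>

lemma sum_M_max:
  assumes "\<And>r. \<beta> r \<le> q * u r"
  shows "(\<Sum>r\<in>UNIV. M s r * \<beta> r) \<le> q * u s"
proof -
  have "(\<Sum>r\<in>UNIV. M s r * \<beta> r) \<le> (\<Sum>r\<in>UNIV. M s r * (q * u r))"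
    using assms by (intro sum_mono mult_left_mono) auto
  also have "\<dots> = q * (\<Sum>r\<in>UNIV. M s r * u r)" by (simp add: sum_distrib_left mult_ac)
  finally show ?thesis by (simp add: M_u)
qed

text \<open>A maximum of \<open>\<beta> / u\<close> forces \<open>\<beta> t0 \<le> 0\<close>, a
  minimum the reverse. So \<open>M\<close> fixes \<open>\<beta>\<close>, the set of maximizers of
  \<open>\<beta> / u\<close> is closed under \<open>M\<close>, and the quotient is constant; the
  constant is \<open>0\<close> because \<open>\<beta> t0 = 0\<close>.\<close>

lemma harmonic_const:
  assumes "\<And>s. \<beta> s - (\<Sum>t\<in>UNIV. M s t * \<beta> t) + \<beta> t0 = 0"
  shows "\<beta> s = 0"
proof -
  define q where "q s = \<beta> s / u s" for s
  have \<beta>: "\<beta> s = q s * u s" for s using u_pos[of s] by (simp add: q_def)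
  obtain t where t: "\<And>s. q s \<le> q t" using obtain_argmax[of q] by blast
  obtain t' where t': "\<And>s. - q s \<le> - q t'" using obtain_argmax[of "\<lambda>s. - q s"] by blast
  have "(\<Sum>r\<in>UNIV. M t r * \<beta> r) \<le> q t * u t"
    by (rule sum_M_max) (use t u_nonneg \<beta> in \<open>auto intro!: mult_right_mono\<close>)
  then have "\<beta> t0 \<le> 0" using assms[of t] \<beta>[of t] by simp
  moreover have "(\<Sum>r\<in>UNIV. M t' r * - \<beta> r) \<le> - q t' * u t'"
    by (rule sum_M_max) (use t' u_nonneg \<beta> in \<open>auto intro!: mult_right_mono\<close>)
  then have "0 \<le> \<beta> t0" using assms[of t'] \<beta>[of t'] by (simp add: sum_negf)
  ultimately have t0: "\<beta> t0 = 0" by simp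
  have "{s. q s = q t} = UNIV"
  proof (rule closed_UNIV)
    fix s r assume s: "s \<in> {s. q s = q t}" and sr: "0 < M s r"
    have "(\<Sum>r\<in>UNIV. M s r * (u r * (q t - q r))) = q t * (\<Sum>r\<in>UNIV. M s r * u r) - (\<Sum>r\<in>UNIV. M s r * \<beta> r)"
      unfolding sum_distrib_left sum_subtractf[symmetric] by (intro sum.cong) (auto simp: \<beta> algebra_simps)
    also have "\<dots> = 0" using assms[of s] t0 s \<beta>[of s] by (simp add: M_u)
    finally have "M s r * (u r * (q t - q r)) = 0"
      using t by (subst (asm) sum_nonneg_eq_0_iff) auto
    then show "r \<in> {s. q s = q t}" using sr u_pos[of r] by simp
  qed auto
  then have "s \<in> {s. q s = q t}" "t0 \<in> {s. q s = q t}" by (simp_all only: UNIV_I)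
  then have "q s = q t0" by simp
  moreover have "q t0 = 0" using t0 by (simp add: q_def)
  ultimately show ?thesis using \<beta>[of s] by simp
qed

text \<open>\<open>1 - M\<close> annihilates \<open>u\<close>, hence is not onto. Adding the value
  at one fixed pair \<open>t0\<close> makes it injective and thus onto, and this value is the
  constant \<open>L\<close>.\<close>

lemma poisson: "\<exists>\<beta> L. \<forall>s. (\<Sum>t\<in>UNIV. M s t * \<beta> t) - \<beta> s = L - d s"
proof -
  fix t0 :: "'a \<times> 'a"
  let ?F = "\<lambda>\<beta> s. \<beta> s - (\<Sum>t\<in>UNIV. M s t * \<beta> t) + \<beta> t0"
  have "\<exists>\<beta>. ?F \<beta> = d"
  proof (rule finite_linear_injective_imp_surjective)
    fix \<beta> assume "?F \<beta> = (\<lambda>i. 0)"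
    then have "\<beta> s - (\<Sum>t\<in>UNIV. M s t * \<beta> t) + \<beta> t0 = 0" for s by (rule fun_cong)
    then show "\<beta> = (\<lambda>i. 0)" using harmonic_const by blast
  qed (auto simp: algebra_simps sum.distrib sum_distrib_left)
  then obtain \<beta> where "?F \<beta> = d" by blast
  then have "d s = \<beta> s - (\<Sum>t\<in>UNIV. M s t * \<beta> t) + \<beta> t0" for s by auto
  then show ?thesis by (intro exI[of _ \<beta>] exI[of _ "\<beta> t0"]) simp
qed

text \<open>A bound \<open>K\<close> for shorter words persists if
  \<open>\<bar>\<beta> s\<bar> + (1 - u s) * K \<le> K\<close>; hence \<open>K\<close> is the
  maximum of \<open>\<bar>\<beta>\<bar>\<close> over the minimum of \<open>u\<close>.\<close>

lemma ext_bounded: "\<exists>K\<ge>0. \<forall>w. \<bar>ext m \<beta> w\<bar> \<le> K"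
proof -
  obtain s1 where s1: "\<And>s. \<bar>\<beta> s\<bar> \<le> \<bar>\<beta> s1\<bar>" using obtain_argmax[of "\<lambda>s. \<bar>\<beta> s\<bar>"] by blast
  obtain s2 where s2: "\<And>s. u s2 \<le> u s" using obtain_argmax[of "\<lambda>s. - u s"] by auto
  define K where "K = \<bar>\<beta> s1\<bar> / u s2"
  have K: "0 \<le> K" "\<bar>\<beta> s1\<bar> = K * u s2" using u_pos[of s2] by (auto simp: K_def)
  have "\<bar>ext_rev m \<beta> v\<bar> \<le> K" for v
  proof (induction v rule: measure_induct_rule[of length])
    case (less v)
    consider "length v < 2" | a b w where "v = b # a # w"
      by (cases v; cases "tl v") auto
    then show ?case
    proof cases
      case 1
      then have "ext_rev m \<beta> v = 0" by (cases v; cases "tl v") auto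
      then show ?thesis using K by simp
    next
      case 2
      let ?S = "\<Sum>c\<in>UNIV. h 1 (a, b) c * ext_rev m \<beta> (c # w)"
      have "\<bar>?S\<bar> \<le> (\<Sum>c\<in>UNIV. h 1 (a, b) c * K)"
        using 2 less by (intro order_trans[OF sum_abs] sum_mono) (auto simp: abs_mult intro!: mult_left_mono)
      also have "\<dots> = (1 - u (a, b)) * K" by (simp add: u_def sum_distrib_right)
      also have "\<dots> \<le> (1 - u s2) * K" using s2 K by (intro mult_right_mono) auto
      finally have "\<bar>?S\<bar> \<le> K - K * u s2" by (simp add: algebra_simps)
      moreover have "\<bar>\<beta> (a, b)\<bar> \<le> K * u s2" using s1[of "(a, b)"] K by simp
      ultimately show ?thesis using 2 K(1) by (auto intro: order_trans[OF abs_triangle_ineq])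
    qed
  qed
  then show ?thesis using K(1) by (auto simp: ext_def)
qed

section \<open>Drift of the length and its corrector\<close>

definition drift where "drift l s = step (word_length l) (wd s) - word_length l (wd s)"
text \<open>Expected length of a letter \<open>d\<close> written by the step for good:
  \<open>u t\<close> is the probability that the walk on top of \<open>d\<close> never uncovers
  it.\<close>

definition gain where "gain l s = (\<Sum>d\<in>UNIV. \<Sum>t\<in>UNIV. p3 s d t * (l d * u t))"

lemma word_length_append [simp]: "word_length l (v @ w) = word_length l v + word_length l w"
  by (simp add: word_length_def)

lemma word_length_Cons [simp]: "word_length l (c # w) = l c + word_length l w"
  by (simp add: word_length_def)

lemma word_length_Nil [simp]: "word_length l [] = 0"
  by (simp add: word_length_def)

lemma step_word_length: "step (word_length l) (w @ wd s) = word_length l (w @ wd s) + drift l s"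
  by (subst step_shift) (simp_all add: drift_def step_add)

text \<open>The witness is the length of the pair minus the expected length of the letter left after
  its descent. Changes in this quantity telescope; what remains is the letters that are
  final.\<close>

lemma drift_gain: "\<exists>\<gamma>. \<forall>s. drift l s - gain l s = (\<Sum>t\<in>UNIV. M s t * \<gamma> t) - \<gamma> s"
proof (intro exI allI)
  fix s
  let ?W = "\<lambda>t. word_length l (wd t)" and ?h = "\<lambda>t. \<Sum>c\<in>UNIV. h 1 t c * l c"
  have 1: "(\<Sum>t\<in>UNIV. M0 1 s t * ?h t) = ?h s - (\<Sum>c\<in>UNIV. p1 s c * l c)"
  proof -
    have "(\<Sum>t\<in>UNIV. M0 1 s t * ?h t) = (\<Sum>c\<in>UNIV. (\<Sum>t\<in>UNIV. M0 1 s t * h 1 t c) * l c)"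
      unfolding sum_distrib_left sum_distrib_right by (subst sum.swap) (simp add: mult.assoc)
    also have "\<dots> = (\<Sum>c\<in>UNIV. (h 1 s c - p1 s c) * l c)"
    proof -
      have "(\<Sum>t\<in>UNIV. M0 1 s t * h 1 t c) = h 1 s c - p1 s c" for c using h_eq[of 1 s c] by simp
      then show ?thesis by simp
    qed
    finally show ?thesis by (simp add: left_diff_distrib sum_subtractf)
  qed
  have 2: "(\<Sum>t\<in>UNIV. M0 1 s t * ?W t) = (\<Sum>t\<in>UNIV. p2 s t * ?W t) +
      (\<Sum>d\<in>UNIV. \<Sum>r\<in>UNIV. p3 s d r * (l d - l d * u r + ?h r))"
  proof -
    have "(\<Sum>e\<in>UNIV. h 1 r e * ?W (d, e)) = l d - l d * u r + ?h r" for d r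
      by (simp add: u_def algebra_simps sum.distrib sum_distrib_left)
    then show ?thesis by (subst sum_M0_Cons) simp
  qed
  have 3: "(\<Sum>t\<in>UNIV. M1 s t * (?W t - ?h t)) = (\<Sum>d\<in>UNIV. \<Sum>t\<in>UNIV. p3 s d t * (?W t - ?h t))"
    unfolding M1_def sum_distrib_right by (rule sum.swap)
  have 4: "step (word_length l) (wd s) = (\<Sum>c\<in>UNIV. p1 s c * l c) + (\<Sum>t\<in>UNIV. p2 s t * ?W t) +
      (\<Sum>d\<in>UNIV. \<Sum>t\<in>UNIV. p3 s d t * (l d + ?W t))"
    using step_wd[of "word_length l" "[]" s] by simp
  have 5: "(\<Sum>d\<in>UNIV. \<Sum>r\<in>UNIV. p3 s d r * (l d - l d * u r + ?h r)) +
      (\<Sum>d\<in>UNIV. \<Sum>t\<in>UNIV. p3 s d t * (?W t - ?h t)) =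
      (\<Sum>d\<in>UNIV. \<Sum>t\<in>UNIV. p3 s d t * (l d + ?W t)) - gain l s"
    unfolding gain_def sum.distrib[symmetric] sum_subtractf[symmetric]
    by (intro sum.cong refl) (simp add: algebra_simps)
  have "(\<Sum>t\<in>UNIV. M s t * (?W t - ?h t)) =
      (\<Sum>t\<in>UNIV. M0 1 s t * ?W t) - (\<Sum>t\<in>UNIV. M0 1 s t * ?h t) + (\<Sum>t\<in>UNIV. M1 s t * (?W t - ?h t))"
    by (simp add: M_def distrib_right sum.distrib right_diff_distrib sum_subtractf)
  then show "drift l s - gain l s = (\<Sum>t\<in>UNIV. M s t * (?W t - ?h t)) - (?W s - ?h s)"
    using 1 2 3 4 5 unfolding drift_def by linarith
qed

text \<open>\<open>\<beta>\<close> solves the Poisson equation for \<open>drift l\<close>, so adding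
  \<open>ext\<close> replaces the pair-dependent drift by the constant \<open>L\<close>. Words
  without a last pair are excluded.\<close>

lemma corrected_length:
  obtains \<beta> L K where "\<And>s. (\<Sum>t\<in>UNIV. M s t * \<beta> t) - \<beta> s = L - drift l s"
    "\<And>w. 2 \<le> length w \<Longrightarrow> step (\<lambda>v. word_length l v + ext 2 \<beta> v) w = word_length l w + ext 2 \<beta> w + L"
    "0 \<le> K" "\<And>w. \<bar>ext 2 \<beta> w\<bar> \<le> K"
proof -
  obtain \<beta> L where \<beta>: "\<And>s. (\<Sum>t\<in>UNIV. M s t * \<beta> t) - \<beta> s = L - drift l s"
    using poisson[of "drift l"] by blast
  obtain K where K: "0 \<le> K" "\<And>w. \<bar>ext 2 \<beta> w\<bar> \<le> K" using ext_bounded by blast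
  have "step (\<lambda>v. word_length l v + ext 2 \<beta> v) w = word_length l w + ext 2 \<beta> w + L"
    if len: "2 \<le> length w" for w
  proof -
    obtain w' s where w: "w = w' @ wd s" using length_ge_2E len by blast
    show ?thesis using \<beta>[of s] step_ext[of 2 w' \<beta> s] step_word_length[of l w' s]
      unfolding w by (simp add: step_add)
  qed
  then show ?thesis using that \<beta> K by blast
qed

text \<open>A corrected length with positive drift yields an exponential supermartingale.\<close>

lemma exponential_decay:
  assumes drift: "\<And>w. 2 \<le> length w \<Longrightarrow> step \<Phi> w = \<Phi> w + L" and L: "0 < L"
    and C: "\<And>w v. v \<in> set_pmf (suffix_step p w) \<Longrightarrow> \<bar>\<Phi> v - \<Phi> w\<bar> \<le> C"
  obtains \<rho> where "0 < \<rho>" "\<rho> < 1"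
    "\<And>v. \<exists>A. \<forall>n s. run long (indicator {v}) n (wd s) \<le> A * \<rho> ^ n"
proof -
  have C0: "0 \<le> C"
  proof -
    obtain v where "v \<in> set_pmf (suffix_step p [])" using set_pmf_not_empty by fastforce
    from C[OF this] show ?thesis by linarith
  qed
  define D where "D = C + 1"
  have D: "1 \<le> D" "C \<le> D" using C0 by (auto simp: D_def)
  \<comment> \<open>The first bound keeps exponents in the range of \<open>exp_le_quadratic\<close>;
    the second makes the quadratic error at most half of the linear decrease
    \<open>\<theta> * L\<close>.\<close>
  define \<theta> where "\<theta> = min (1 / D) (L / (2 * D\<^sup>2))"
  have \<theta>: "0 < \<theta>" "\<theta> * D \<le> 1" "\<theta> * D\<^sup>2 \<le> L / 2"
  proof -
    show "0 < \<theta>" using D L by (simp add: \<theta>_def)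
    have "\<theta> * D \<le> 1 / D * D" unfolding \<theta>_def using D by (intro mult_right_mono) auto
    then show "\<theta> * D \<le> 1" using D by simp
    have "\<theta> * D\<^sup>2 \<le> L / (2 * D\<^sup>2) * D\<^sup>2" unfolding \<theta>_def by (intro mult_right_mono) auto
    then show "\<theta> * D\<^sup>2 \<le> L / 2" using D by simp
  qed
  \<comment> \<open>The entry \<open>1 / 2\<close> secures positivity of the rate.\<close>
  define \<rho> where "\<rho> = max (1 / 2) (1 - \<theta> * L / 2)"
  have \<rho>: "0 < \<rho>" "\<rho> < 1" using \<theta> L by (auto simp: \<rho>_def)
  define f where "f w = exp (- (\<theta> * \<Phi> w))" for w
  have f: "0 < f w" for w by (simp add: f_def)
  have step_f: "step f w \<le> \<rho> * f w" if len: "2 \<le> length w" for w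
  proof -
    have "step f w \<le> step (\<lambda>v. f w * (1 - \<theta> * (\<Phi> v - \<Phi> w) + (\<theta> * D)\<^sup>2)) w"
    proof (rule step_mono)
      fix v assume v: "v \<in> set_pmf (suffix_step p w)"
      let ?x = "- (\<theta> * (\<Phi> v - \<Phi> w))"
      have x: "\<bar>?x\<bar> \<le> \<theta> * D" using C[OF v] D \<theta>(1) by (auto simp: abs_mult intro!: mult_left_mono)
      have "f v = f w * exp ?x" unfolding f_def by (simp add: algebra_simps flip: exp_add)
      also have "\<dots> \<le> f w * (1 + ?x + ?x\<^sup>2)"
        using x \<theta>(2) f[of w] by (intro mult_left_mono exp_le_quadratic) auto
      also have "\<dots> \<le> f w * (1 + ?x + (\<theta> * D)\<^sup>2)"
      proof (intro mult_left_mono add_left_mono)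
        show "?x\<^sup>2 \<le> (\<theta> * D)\<^sup>2" using x power_mono[OF x, of 2] by simp
      qed (use f[of w] in auto)
      finally show "f v \<le> f w * (1 - \<theta> * (\<Phi> v - \<Phi> w) + (\<theta> * D)\<^sup>2)" by simp
    qed
    also have "\<dots> = f w * (1 - \<theta> * L + (\<theta> * D)\<^sup>2)"
      using drift[OF len] by (simp add: step_cmult step_add step_diff)
    also have "\<dots> \<le> f w * \<rho>"
    proof (rule mult_left_mono)
      have "(\<theta> * D)\<^sup>2 = \<theta> * (\<theta> * D\<^sup>2)" by (simp add: power2_eq_square)
      also have "\<dots> \<le> \<theta> * (L / 2)" using \<theta> by (intro mult_left_mono) auto
      finally show "1 - \<theta> * L + (\<theta> * D)\<^sup>2 \<le> \<rho>" by (simp add: \<rho>_def)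
    qed (use f[of w] in simp)
    finally show ?thesis by (simp add: mult.commute)
  qed
  have "\<exists>A. \<forall>n s. run long (indicator {v}) n (wd s) \<le> A * \<rho> ^ n" for v
  proof -
    have run: "run long (indicator {v}) n w \<le> \<rho> ^ n * f w / f v" for n w
    proof (induction n arbitrary: w)
      case 0
      show ?case using f[of v] f[of w] by (auto simp: indicator_def)
    next
      case (Suc n)
      show ?case
      proof (cases "2 \<le> length w")
        case True
        then have "run long (indicator {v}) (Suc n) w = step (run long (indicator {v}) n) w" by simp
        also have "\<dots> \<le> step (\<lambda>x. (\<rho> ^ n / f v) * f x) w"
          by (rule step_mono) (use Suc in simp)
        also have "\<dots> = (\<rho> ^ n / f v) * step f w" by (rule step_cmult)
        also have "\<dots> \<le> (\<rho> ^ n / f v) * (\<rho> * f w)"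
          using f[of v] \<rho> by (intro mult_left_mono step_f True) auto
        also have "\<dots> = \<rho> ^ Suc n * f w / f v" by simp
        finally show ?thesis .
      next
        case False
        then show ?thesis using f[of w] f[of v] \<rho> by simp
      qed
    qed
    obtain s0 where s0: "\<And>s. f (wd s) \<le> f (wd s0)" using obtain_argmax[of "\<lambda>s. f (wd s)"] by blast
    have "run long (indicator {v}) n (wd s) \<le> (f (wd s0) / f v) * \<rho> ^ n" for n s
    proof -
      have "\<rho> ^ n * f (wd s) / f v \<le> \<rho> ^ n * f (wd s0) / f v"
        using s0[of s] f[of v] \<rho> by (intro divide_right_mono mult_left_mono) auto
      then show ?thesis using run[of n "wd s"] by (simp add: mult.commute)
    qed
    then show ?thesis by blast
  qed
  then show ?thesis using that \<rho> by blast
qed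

lemma word_length_increment:
  "\<exists>C. \<forall>w. \<forall>v\<in>set_pmf (suffix_step p w). \<bar>word_length l v - word_length l w\<bar> \<le> C"
proof -
  obtain a where a: "\<And>b. \<bar>l b\<bar> \<le> \<bar>l a\<bar>" using obtain_argmax[of "\<lambda>b. \<bar>l b\<bar>"] by blast
  have bound: "\<bar>word_length l v\<bar> \<le> real (length v) * \<bar>l a\<bar>" for v
  proof (induction v)
    case (Cons b v)
    then show ?case using a[of b] by (simp add: distrib_right)
  qed simp
  show ?thesis
  \<comment> \<open>A step replaces at most two letters by at most three.\<close>
  proof (intro exI[of _ "5 * \<bar>l a\<bar>"] allI ballI)
    fix w v assume v: "v \<in> set_pmf (suffix_step p w)"
    let ?x = "take (length w - 2) w" and ?y = "drop (length w - 2) w"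
    obtain z where z: "v = ?x @ z" using v by (auto simp: suffix_step_def)
    have "length z \<le> 3" using support_length(2)[OF v] z by auto
    then have "real (length z) * \<bar>l a\<bar> \<le> 3 * \<bar>l a\<bar>" by (intro mult_right_mono) auto
    moreover have "real (length ?y) * \<bar>l a\<bar> \<le> 2 * \<bar>l a\<bar>" by (intro mult_right_mono) auto
    moreover have "word_length l w = word_length l ?x + word_length l ?y"
      by (metis append_take_drop_id word_length_append)
    moreover have "word_length l v = word_length l ?x + word_length l z"
      by (simp only: z word_length_append)
    ultimately show "\<bar>word_length l v - word_length l w\<bar> \<le> 5 * \<bar>l a\<bar>"
      using bound[of z] bound[of ?y] by linarith
  qed
qed

lemma corrected_increment:
  assumes "\<And>w. \<bar>ext 2 \<beta> w\<bar> \<le> K"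
  shows "\<exists>C. \<forall>w. \<forall>v\<in>set_pmf (suffix_step p w).
    \<bar>(word_length l v + ext 2 \<beta> v) - (word_length l w + ext 2 \<beta> w)\<bar> \<le> C"
proof -
  obtain C where C: "\<And>w v. v \<in> set_pmf (suffix_step p w) \<Longrightarrow> \<bar>word_length l v - word_length l w\<bar> \<le> C"
    using word_length_increment[of l] by blast
  show ?thesis
  proof (intro exI[of _ "C + 2 * K"] allI ballI)
    fix w v assume "v \<in> set_pmf (suffix_step p w)"
    from C[OF this] assms[of v] assms[of w]
    show "\<bar>(word_length l v + ext 2 \<beta> v) - (word_length l w + ext 2 \<beta> w)\<bar> \<le> C + 2 * K" by linarith
  qed
qed

text \<open>On long words the cross term has mean zero, so the second moment grows by at most
  \<open>E\<^sup>2\<close>. On short words the cross term may be of order \<open>n\<close>, but the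
  expected number of visits there is finite, so the total stays linear in \<open>n\<close>.\<close>

lemma second_moment:
  assumes drift: "\<And>w. 2 \<le> length w \<Longrightarrow> step \<Phi> w = \<Phi> w + L"
    and C: "\<And>w v. v \<in> set_pmf (suffix_step p w) \<Longrightarrow> \<bar>\<Phi> v - \<Phi> w\<bar> \<le> C"
  shows "\<exists>B. \<forall>n. run UNIV (\<lambda>w. (\<Phi> w - real n * L)\<^sup>2) n [] \<le> B * (real n + 1)"
proof -
  define E where "E = C + \<bar>L\<bar>"
  have "finite (\<Phi> ` low)" by simp
  then obtain F where F: "\<And>w. w \<in> low \<Longrightarrow> \<bar>\<Phi> w\<bar> \<le> F"
    using finite_imp_bounded[of "\<Phi> ` low"] by (auto simp: bounded_iff)
  have "[] \<in> low" by (simp add: low_def)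
  from F[OF this] have F0: "0 \<le> F" by linarith
  obtain v where "v \<in> set_pmf (suffix_step p [])" using set_pmf_not_empty by fastforce
  from C[OF this] have E0: "0 \<le> E" unfolding E_def by linarith
  \<comment> \<open>At a short word \<open>\<Phi> w - n * L\<close> is at most
    \<open>(F + \<bar>L\<bar>) * (n + 1)\<close> in absolute value, so \<open>D * (n + 1)\<close>
    bounds the cross term.\<close>
  define D where "D = 2 * (F + \<bar>L\<bar>) * E"
  have D0: "0 \<le> D" using F0 E0 by (simp add: D_def)
  define R where "R n = run UNIV (indicator low) n []" for n
  have Rnn: "0 \<le> R n" for n unfolding R_def by (rule run_nonneg) simp
  define A where "A n = run UNIV (\<lambda>w. (\<Phi> w - real n * L)\<^sup>2) n []" for n
  have one: "step (\<lambda>v. (\<Phi> v - real (Suc n) * L)\<^sup>2) w \<le>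
      (\<Phi> w - real n * L)\<^sup>2 + (E\<^sup>2 + D * (real n + 1) * indicator low w)" for n w
  proof -
    let ?y = "\<Phi> w - real n * L"
    have sq: "(\<Phi> v - real (Suc n) * L)\<^sup>2 = ?y\<^sup>2 + 2 * ?y * (\<Phi> v - \<Phi> w - L) + (\<Phi> v - \<Phi> w - L)\<^sup>2" for v
      by (simp add: power2_eq_square algebra_simps)
    have E: "(\<Phi> v - \<Phi> w - L)\<^sup>2 \<le> E\<^sup>2" "\<bar>\<Phi> v - \<Phi> w - L\<bar> \<le> E" if "v \<in> set_pmf (suffix_step p w)" for v
    proof -
      show *: "\<bar>\<Phi> v - \<Phi> w - L\<bar> \<le> E" using C[OF that] by (simp add: E_def)
      show "(\<Phi> v - \<Phi> w - L)\<^sup>2 \<le> E\<^sup>2" using power_mono[OF *, of 2] by simp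
    qed
    show ?thesis
    proof (cases "2 \<le> length w")
      case True
      have "step (\<lambda>v. (\<Phi> v - real (Suc n) * L)\<^sup>2) w \<le> step (\<lambda>v. ?y\<^sup>2 + 2 * ?y * (\<Phi> v - \<Phi> w - L) + E\<^sup>2) w"
        by (rule step_mono) (use sq E in auto)
      also have "\<dots> = ?y\<^sup>2 + E\<^sup>2"
        using drift[OF True] by (simp add: step_add step_cmult step_diff)
      finally show ?thesis using D0 by (auto intro: order_trans)
    next
      case False
      then have w: "w \<in> low" by (simp add: low_def)
      have "\<bar>real n * L\<bar> \<le> \<bar>L\<bar> * (real n + 1)" by (simp add: abs_mult algebra_simps)
      moreover have "F \<le> F * (real n + 1)" using F0 by (simp add: algebra_simps)
      ultimately have y: "\<bar>?y\<bar> \<le> (F + \<bar>L\<bar>) * (real n + 1)"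
        using F[OF w] by (simp add: distrib_right)
      have "step (\<lambda>v. (\<Phi> v - real (Suc n) * L)\<^sup>2) w \<le> step (\<lambda>v. ?y\<^sup>2 + D * (real n + 1) + E\<^sup>2) w"
      proof (rule step_mono)
        fix v assume v: "v \<in> set_pmf (suffix_step p w)"
        have "?y * (\<Phi> v - \<Phi> w - L) \<le> \<bar>?y\<bar> * \<bar>\<Phi> v - \<Phi> w - L\<bar>"
          by (simp flip: abs_mult)
        also have "\<dots> \<le> ((F + \<bar>L\<bar>) * (real n + 1)) * E"
          using y E(2)[OF v] F0 by (intro mult_mono) auto
        finally have "2 * ?y * (\<Phi> v - \<Phi> w - L) \<le> D * (real n + 1)"
          by (simp add: D_def algebra_simps)
        then show "(\<Phi> v - real (Suc n) * L)\<^sup>2 \<le> ?y\<^sup>2 + D * (real n + 1) + E\<^sup>2"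
          using E(1)[OF v] sq[of v] by linarith
      qed
      then show ?thesis using w by simp
    qed
  qed
  have rec: "A (Suc n) \<le> A n + E\<^sup>2 + D * (real n + 1) * R n" for n
  proof -
    have "A (Suc n) = run UNIV (step (\<lambda>v. (\<Phi> v - real (Suc n) * L)\<^sup>2)) n []"
      using run_add[of "\<lambda>v. (\<Phi> v - real (Suc n) * L)\<^sup>2" n 1] by (simp add: A_def)
    also have "\<dots> \<le> run UNIV (\<lambda>w. (\<Phi> w - real n * L)\<^sup>2 + (E\<^sup>2 + D * (real n + 1) * indicator low w)) n []"
      by (rule run_mono) (rule subset_refl, rule step_nonneg, simp, rule one)
    also have "\<dots> = A n + (E\<^sup>2 + D * (real n + 1) * R n)"
      by (simp add: run_add_fun run_cmult A_def R_def)
    finally show ?thesis by simp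
  qed
  let ?S = "\<Sum>n. R n"
  have sR: "summable R" unfolding R_def by (rule low_summable)
  have "A n \<le> A 0 + real n * E\<^sup>2 + D * real n * (\<Sum>k<n. R k)" for n
  proof (induction n)
    case (Suc n)
    have "D * real n * (\<Sum>k<n. R k) \<le> D * (real n + 1) * (\<Sum>k<n. R k)"
      using D0 Rnn by (intro mult_right_mono mult_left_mono sum_nonneg) auto
    then show ?case using Suc rec[of n] by (simp add: algebra_simps)
  qed simp
  moreover have "D * real n * (\<Sum>k<n. R k) \<le> D * real n * ?S" for n
    using D0 Rnn sR by (intro mult_left_mono sum_le_suminf) auto
  moreover have "A 0 + real n * E\<^sup>2 + D * real n * ?S \<le> (A 0 + E\<^sup>2 + D * ?S) * (real n + 1)" for n
  proof -
    have "0 \<le> A 0" "0 \<le> ?S" using Rnn sR by (auto simp: A_def intro: suminf_nonneg)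
    then show ?thesis using D0 by (simp add: algebra_simps)
  qed
  ultimately have "A n \<le> (A 0 + E\<^sup>2 + D * ?S) * (real n + 1)" for n
    by (meson add_left_mono order_trans)
  then show ?thesis unfolding A_def by blast
qed

end

section \<open>The invariant measure\<close>

locale suffix_walk_invariant = suffix_walk p for p :: "'a::finite list \<Rightarrow> 'a list pmf" +
  fixes \<nu> :: "('a \<times> 'a \<times> 'a) pmf"
  assumes support: "pmf \<nu> (d, s) \<noteq> 0 \<Longrightarrow> escape s \<noteq> 0"
    and invariant: "escape t \<noteq> 0 \<Longrightarrow> (\<Sum>s\<in>UNIV. \<Sum>d\<in>UNIV.
      pmf \<nu> (d, s) * (escape t / escape s * (\<Sum>r\<in>UNIV. p3 s a r * g 1 r t))) = pmf \<nu> (a, t)"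
begin

section \<open>A positive left fixed vector of \<open>M\<close>\<close>

definition \<pi> where "\<pi> s = (\<Sum>d\<in>UNIV. pmf \<nu> (d, s)) / escape s"
text \<open>Agrees with \<open>\<pi>\<close> where \<open>escape\<close> is nonzero. Elsewhere
  \<open>\<pi>\<close> is \<open>0\<close>, while \<open>\<mu>\<close> still weighs the pairs that
  \<open>\<nu>\<close> does not see; this makes it a fixed vector on all pairs.\<close>

definition \<mu> where "\<mu> t = (\<Sum>s\<in>UNIV. \<pi> s * (\<Sum>r\<in>UNIV. M1 s r * g 1 r t))"

lemma \<nu>_eq: "pmf \<nu> (a, t) = escape t * (\<Sum>s\<in>UNIV. \<pi> s * (\<Sum>r\<in>UNIV. p3 s a r * g 1 r t))"
proof (cases "escape t = 0")
  case True
  then show ?thesis using support[of a t] by auto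
next
  case False
  have "(\<Sum>s\<in>UNIV. \<Sum>d\<in>UNIV. pmf \<nu> (d, s) * (escape t / escape s * (\<Sum>r\<in>UNIV. p3 s a r * g 1 r t))) =
      escape t * (\<Sum>s\<in>UNIV. \<pi> s * (\<Sum>r\<in>UNIV. p3 s a r * g 1 r t))"
  proof -
    have eq: "(\<Sum>d\<in>UNIV. pmf \<nu> (d, s) * (escape t / escape s * x)) = escape t * (\<pi> s * x)" for s x
      unfolding sum_distrib_right[symmetric] by (simp add: \<pi>_def)
    show ?thesis unfolding eq by (rule sum_distrib_left[symmetric])
  qed
  then show ?thesis using invariant[OF False] by simp
qed

lemma \<pi>_nonneg [simp]: "0 \<le> \<pi> s"
  by (auto simp: \<pi>_def intro!: divide_nonneg_nonneg sum_nonneg)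

lemma \<mu>_nonneg: "0 \<le> \<mu> s"
  by (auto simp: \<mu>_def intro!: sum_nonneg mult_nonneg_nonneg)

lemma \<pi>_escape: "(\<Sum>s\<in>UNIV. \<pi> s * escape s) = 1"
proof -
  have "\<pi> s * escape s = (\<Sum>d\<in>UNIV. pmf \<nu> (d, s))" for s
  proof (cases "escape s = 0")
    case True
    then have "pmf \<nu> (d, s) = 0" for d using support[of d s] by blast
    then show ?thesis using True by simp
  qed (simp add: \<pi>_def)
  then have "(\<Sum>s\<in>UNIV. \<pi> s * escape s) = (\<Sum>s\<in>UNIV. \<Sum>d\<in>UNIV. pmf \<nu> (d, s))" by simp
  also have "\<dots> = (\<Sum>x\<in>UNIV. pmf \<nu> x)" by (subst sum.swap) (simp add: sum_UNIV_prod)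
  also have "\<dots> = 1" by (rule sum_pmf_eq_1) auto
  finally show ?thesis .
qed

lemma \<pi>_eq_\<mu>: "escape t \<noteq> 0 \<Longrightarrow> \<pi> t = \<mu> t"
proof -
  assume t: "escape t \<noteq> 0"
  have "\<pi> t = (\<Sum>a\<in>UNIV. \<Sum>s\<in>UNIV. \<pi> s * (\<Sum>r\<in>UNIV. p3 s a r * g 1 r t))"
    using t by (simp add: \<pi>_def[of t] \<nu>_eq sum_distrib_left[symmetric])
  also have "\<dots> = (\<Sum>s\<in>UNIV. \<pi> s * (\<Sum>a\<in>UNIV. \<Sum>r\<in>UNIV. p3 s a r * g 1 r t))"
    by (subst sum.swap) (simp add: sum_distrib_left)
  also have "\<dots> = \<mu> t"
    unfolding \<mu>_def M1_def sum_distrib_right by (subst (2) sum.swap) simp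
  finally show ?thesis .
qed

text \<open>Since \<open>u\<close> is positive everywhere, any step to three letters gives a chance
  of escape. Hence \<open>\<pi>\<close> and \<open>\<mu>\<close> are interchangeable in front of
  \<open>p3\<close>.\<close>

lemma escape_0: "escape s = 0 \<Longrightarrow> p3 s d r = 0"
proof -
  assume "escape s = 0"
  then have "(\<Sum>r\<in>UNIV. p3 s d r * u r) = 0"
    unfolding escape_p3 by (subst (asm) sum_nonneg_eq_0_iff) (auto intro!: sum_nonneg)
  then have "p3 s d r * u r = 0" by (subst (asm) sum_nonneg_eq_0_iff) auto
  then show ?thesis using u_pos[of r] by simp
qed

lemma \<pi>_p3: "\<pi> s * p3 s d r = \<mu> s * p3 s d r"
  using \<pi>_eq_\<mu>[of s] escape_0[of s d r] by (cases "escape s = 0") auto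

lemma \<pi>_M1: "\<pi> s * M1 s r = \<mu> s * M1 s r"
  by (simp add: M1_def sum_distrib_left \<pi>_p3)

text \<open>\<open>\<mu>\<close> is the flow \<open>m\<close> into the next level times
  \<open>g 1\<close>; by \<open>g_right\<close>, multiplication by \<open>1 - M0 1\<close> recovers
  \<open>m\<close>.\<close>

lemma \<mu>_M1: "(\<Sum>s\<in>UNIV. \<mu> s * M1 s t) = \<mu> t - (\<Sum>s\<in>UNIV. \<mu> s * M0 1 s t)"
proof -
  define m where "m r = (\<Sum>s\<in>UNIV. \<pi> s * M1 s r)" for r
  have \<mu>: "\<mu> t = (\<Sum>r\<in>UNIV. m r * g 1 r t)" for t
    unfolding \<mu>_def m_def sum_distrib_left sum_distrib_right
    by (subst sum.swap) (simp add: mult.assoc)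
  have "(\<Sum>s\<in>UNIV. \<mu> s * M0 1 s t) = (\<Sum>r\<in>UNIV. m r * (\<Sum>s\<in>UNIV. g 1 r s * M0 1 s t))"
    unfolding \<mu> sum_distrib_left sum_distrib_right
    by (subst sum.swap) (simp add: mult.assoc)
  also have "\<dots> = (\<Sum>r\<in>UNIV. m r * (g 1 r t - of_bool (r = t)))"
  proof -
    have "(\<Sum>s\<in>UNIV. g 1 r s * M0 1 s t) = g 1 r t - of_bool (r = t)" for r
      using g_right[of r t] by simp
    then show ?thesis by simp
  qed
  also have "\<dots> = \<mu> t - m t" by (simp add: right_diff_distrib sum_subtractf \<mu>)
  finally show ?thesis by (simp add: m_def \<pi>_M1)
qed

lemma \<mu>_M: "(\<Sum>s\<in>UNIV. \<mu> s * M s t) = \<mu> t"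
  using \<mu>_M1[of t] by (simp add: M_def distrib_left sum.distrib)

lemma \<mu>_balance: "(\<Sum>s\<in>UNIV. \<mu> s * ((\<Sum>t\<in>UNIV. M s t * \<beta> t) - \<beta> s)) = 0"
proof -
  have "(\<Sum>s\<in>UNIV. \<mu> s * (\<Sum>t\<in>UNIV. M s t * \<beta> t)) = (\<Sum>t\<in>UNIV. (\<Sum>s\<in>UNIV. \<mu> s * M s t) * \<beta> t)"
    unfolding sum_distrib_left sum_distrib_right by (subst sum.swap) (simp add: mult.assoc)
  then show ?thesis by (simp add: right_diff_distrib sum_subtractf \<mu>_M)
qed

lemma \<mu>_escape: "(\<Sum>s\<in>UNIV. \<mu> s * escape s) = 1"
proof -
  have eq: "\<mu> s * escape s = \<pi> s * escape s" for s by (cases "escape s = 0") (simp_all add: \<pi>_eq_\<mu>)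
  show ?thesis using \<pi>_escape by (simp only: eq)
qed

lemma \<mu>_pos: "0 < \<mu> s"
proof -
  have "{s. 0 < \<mu> s} = UNIV"
  proof (rule closed_UNIV)
    show "{s. 0 < \<mu> s} \<noteq> {}"
    proof
      assume "{s. 0 < \<mu> s} = {}"
      then have "\<mu> s = 0" for s using \<mu>_nonneg[of s] by (auto simp: less_le)
      then show False using \<mu>_escape by simp
    qed
    fix s t assume "s \<in> {s. 0 < \<mu> s}" "0 < M s t"
    then have "0 < \<mu> s * M s t" by simp
    also have "\<dots> \<le> (\<Sum>s\<in>UNIV. \<mu> s * M s t)"
      by (rule member_le_sum) (auto intro!: mult_nonneg_nonneg \<mu>_nonneg)
    finally show "t \<in> {s. 0 < \<mu> s}" by (simp add: \<mu>_M)
  qed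
  then show ?thesis by blast
qed

lemma sum_\<mu>_pos: "0 < (\<Sum>s\<in>UNIV. \<mu> s)"
  by (rule sum_pos) (auto simp: \<mu>_pos)

text \<open>Summing out the last pair in \<open>\<nu>_eq\<close> collapses \<open>g 1\<close> and
  \<open>escape\<close> to \<open>u\<close> by \<open>g_escape\<close>.\<close>

lemma \<nu>_gain: "(\<Sum>a\<in>UNIV. \<Sum>t\<in>UNIV. pmf \<nu> (a, t) * l a) = (\<Sum>s\<in>UNIV. \<mu> s * gain l s)"
proof -
  have "(\<Sum>t\<in>UNIV. pmf \<nu> (a, t) * l a) = (\<Sum>s\<in>UNIV. \<Sum>r\<in>UNIV. \<mu> s * (p3 s a r * (l a * u r)))" for a
  proof -
    have "(\<Sum>t\<in>UNIV. pmf \<nu> (a, t) * l a) =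
        (\<Sum>t\<in>UNIV. \<Sum>s\<in>UNIV. \<Sum>r\<in>UNIV. \<pi> s * p3 s a r * l a * (g 1 r t * escape t))"
      unfolding \<nu>_eq sum_distrib_left sum_distrib_right by (intro sum.cong refl) (simp add: mult_ac)
    also have "\<dots> = (\<Sum>s\<in>UNIV. \<Sum>r\<in>UNIV. \<Sum>t\<in>UNIV. \<pi> s * p3 s a r * l a * (g 1 r t * escape t))"
      by (subst sum.swap, rule sum.cong, rule refl, rule sum.swap)
    also have "\<dots> = (\<Sum>s\<in>UNIV. \<Sum>r\<in>UNIV. \<pi> s * p3 s a r * l a * u r)"
      by (simp only: sum_distrib_left[symmetric] g_escape)
    finally show ?thesis by (simp add: \<pi>_p3 mult.assoc)
  qed
  then have "(\<Sum>a\<in>UNIV. \<Sum>t\<in>UNIV. pmf \<nu> (a, t) * l a) =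
      (\<Sum>a\<in>UNIV. \<Sum>s\<in>UNIV. \<Sum>r\<in>UNIV. \<mu> s * (p3 s a r * (l a * u r)))"
    by simp
  also have "\<dots> = (\<Sum>s\<in>UNIV. \<mu> s * gain l s)"
    unfolding gain_def sum_distrib_left by (rule sum.swap)
  finally show ?thesis .
qed

text \<open>Under \<open>\<mu>\<close> the Poisson equation equates \<open>L\<close> with the drift,
  and \<open>drift_gain\<close> exchanges the drift for the gain.\<close>

lemma speed_eq:
  assumes "\<And>s. (\<Sum>t\<in>UNIV. M s t * \<beta> t) - \<beta> s = L - drift l s"
  shows "L * (\<Sum>s\<in>UNIV. \<mu> s) = (\<Sum>s\<in>UNIV. \<mu> s * gain l s)"
proof -
  obtain \<gamma> where \<gamma>: "\<And>s. drift l s - gain l s = (\<Sum>t\<in>UNIV. M s t * \<gamma> t) - \<gamma> s"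
    using drift_gain by blast
  have "(\<Sum>s\<in>UNIV. \<mu> s * (L - drift l s)) = 0"
    using \<mu>_balance[of \<beta>] unfolding assms .
  moreover have "(\<Sum>s\<in>UNIV. \<mu> s * (drift l s - gain l s)) = 0"
    using \<mu>_balance[of \<gamma>] unfolding \<gamma>[symmetric] .
  ultimately show ?thesis
    by (simp add: right_diff_distrib sum_subtractf sum_distrib_left mult.commute)
qed

lemma gain_pos:
  assumes "\<And>a. 0 \<le> l a" "0 < l a" "0 < p3 s a r"
  shows "0 < (\<Sum>s\<in>UNIV. \<mu> s * gain l s)"
proof -
  have nn: "0 \<le> gain l s" for s unfolding gain_def using assms(1) by (intro sum_nonneg) auto
  have "0 < p3 s a r * (l a * u r)" using assms u_pos[of r] by simp
  also have "\<dots> \<le> (\<Sum>t\<in>UNIV. p3 s a t * (l a * u t))"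
    using assms(1) by (intro member_le_sum) auto
  also have "\<dots> \<le> gain l s" unfolding gain_def
    using assms(1) by (intro member_le_sum[of a UNIV "\<lambda>d. \<Sum>t\<in>UNIV. p3 s d t * (l d * u t)"] sum_nonneg) auto
  finally have "0 < \<mu> s * gain l s" using \<mu>_pos[of s] by simp
  also have "\<dots> \<le> (\<Sum>s\<in>UNIV. \<mu> s * gain l s)"
    using nn \<mu>_nonneg by (intro member_le_sum) auto
  finally show ?thesis .
qed

text \<open>For unit letter lengths the gain is \<open>escape\<close>, so \<open>L\<close> times the
  sum of \<open>\<mu>\<close> is \<open>1\<close> and the corrected length has positive
  drift.\<close>

lemma decay:
  obtains \<rho> where "0 < \<rho>" "\<rho> < 1"
    "\<And>v. \<exists>A. \<forall>n s. run long (indicator {v}) n (wd s) \<le> A * \<rho> ^ n"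
proof -
  let ?l = "\<lambda>_ :: 'a. 1 :: real"
  obtain \<beta> L K where \<beta>: "\<And>s. (\<Sum>t\<in>UNIV. M s t * \<beta> t) - \<beta> s = L - drift ?l s"
    "\<And>w. 2 \<le> length w \<Longrightarrow> step (\<lambda>v. word_length ?l v + ext 2 \<beta> v) w = word_length ?l w + ext 2 \<beta> w + L"
    "0 \<le> K" "\<And>w. \<bar>ext 2 \<beta> w\<bar> \<le> K"
    by (rule corrected_length[of ?l]) blast
  have "gain ?l s = escape s" for s by (simp add: gain_def escape_p3)
  then have "L * (\<Sum>s\<in>UNIV. \<mu> s) = 1" using speed_eq[OF \<beta>(1)] \<mu>_escape by simp
  then have L: "0 < L" using sum_\<mu>_pos by (metis zero_less_mult_pos2 zero_less_one)
  obtain C where C: "\<And>w v. v \<in> set_pmf (suffix_step p w) \<Longrightarrow>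
      \<bar>(word_length ?l v + ext 2 \<beta> v) - (word_length ?l w + ext 2 \<beta> w)\<bar> \<le> C"
    using corrected_increment[OF \<beta>(4), of ?l] by blast
  show ?thesis
    by (rule exponential_decay[OF \<beta>(2) L C]) (assumption | rule that)+
qed

lemma power_series_region:
  obtains z0 where "1 < z0" "\<And>v s. summable (\<lambda>n. run long (indicator {v}) n (wd s) * z0 ^ n)"
    "\<And>v s z. 0 \<le> z \<Longrightarrow> z \<le> z0 \<Longrightarrow> summable (\<lambda>n. run long (indicator {v}) n (wd s) * z ^ n)"
proof -
  obtain \<rho> where \<rho>: "0 < \<rho>" "\<rho> < 1"
    "\<And>v. \<exists>A. \<forall>n s. run long (indicator {v}) n (wd s) \<le> A * \<rho> ^ n"
    by (rule decay) blast
  \<comment> \<open>The midpoint of \<open>1\<close> and \<open>1 / \<rho>\<close>: termwise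
    differentiation at \<open>1\<close> needs convergence at a larger point.\<close>
  define z0 where "z0 = (1 + 1 / \<rho>) / 2"
  have z0: "1 < z0" "\<rho> * z0 < 1" using \<rho> by (auto simp: z0_def field_simps)
  have "summable (\<lambda>n. run long (indicator {v}) n (wd s) * z ^ n)" if z: "0 \<le> z" "z \<le> z0" for v s z
  proof -
    obtain A where A: "\<And>n s. run long (indicator {v}) n (wd s) \<le> A * \<rho> ^ n" using \<rho>(3) by blast
    have "\<rho> * z \<le> \<rho> * z0" using z \<rho> by simp
    then have "\<rho> * z < 1" using z0 by linarith
    then have "summable (\<lambda>n. A * (\<rho> * z) ^ n)"
      using z \<rho> by (intro summable_mult summable_geometric) auto
    moreover have "norm (run long (indicator {v}) n (wd s) * z ^ n) \<le> A * (\<rho> * z) ^ n" for n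
    proof -
      have "0 \<le> run long (indicator {v}) n (wd s)" by (rule run_nonneg) simp
      moreover have "run long (indicator {v}) n (wd s) * z ^ n \<le> A * \<rho> ^ n * z ^ n"
        using z by (intro mult_right_mono A) auto
      ultimately show ?thesis using z by (simp add: power_mult_distrib mult.assoc)
    qed
    ultimately show ?thesis by (rule summable_comparison_test'[where N=0])
  qed
  then show ?thesis using that[of z0] z0 by auto
qed

text \<open>Differentiating the \<open>g\<close> equation applied to \<open>escape\<close> gives
  \<open>y' - M0 1 y' = ?E\<close>; differentiating the \<open>h\<close> equation summed over
  letters gives \<open>M \<tau> - \<tau> = ?E + escape - 1\<close>. Under \<open>\<mu>\<close> the
  first turns the weighted derivative into \<open>1\<close> plus the sum of
  \<open>\<mu> * ?E\<close>, and the second equates this with the sum of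
  \<open>\<mu>\<close>.\<close>

lemma Lambda_eq:
  obtains D where
    "\<And>s a t. ((\<lambda>z. \<Sum>r\<in>UNIV. p3 s a r * z * g z r t) has_real_derivative D s a t) (at 1)"
    "(\<Sum>s\<in>UNIV. \<pi> s * (\<Sum>a\<in>UNIV. \<Sum>t\<in>UNIV. escape t * D s a t)) = (\<Sum>s\<in>UNIV. \<mu> s)"
proof -
  obtain z0 where z0: "1 < z0"
    and sm: "\<And>v s. summable (\<lambda>n. run long (indicator {v}) n (wd s) * z0 ^ n)"
      "\<And>v s z. 0 \<le> z \<Longrightarrow> z \<le> z0 \<Longrightarrow> summable (\<lambda>n. run long (indicator {v}) n (wd s) * z ^ n)"
    by (rule power_series_region) blast
  have at: "summable_at z" if "0 \<le> z" "z \<le> z0" for z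
    using sm(2)[OF that] that by (simp add: summable_at_def fp_def)
  have gs: "summable (\<lambda>n. gb t n (wd s) * z ^ n)" if "0 \<le> z" "z \<le> z0" for t s z
    using sm(2)[OF that] by (simp add: gb_def)
  define h' where "h' s c = (\<Sum>n. diffs (\<lambda>n. fp c n (wd s)) n * 1 ^ n)" for s c
  define g' where "g' s t = (\<Sum>n. diffs (\<lambda>n. gb t n (wd s)) n * 1 ^ n)" for s t
  have h': "((\<lambda>z. h z s c) has_real_derivative h' s c) (at 1)" for s c
    unfolding h_def h'_def by (rule termdiffs_strong[where K=z0]) (use sm(1) z0 in \<open>auto simp: fp_def\<close>)
  have g': "((\<lambda>z. g z s t) has_real_derivative g' s t) (at 1)" for s t
    unfolding g_def g'_def by (rule termdiffs_strong[where K=z0]) (use sm(1) z0 in \<open>auto simp: gb_def\<close>)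
  \<comment> \<open>The part of the derivative of \<open>M0\<close> that comes from
    \<open>h\<close>; the factor \<open>z\<close> contributes \<open>M0 1\<close> itself.\<close>
  define N where "N s t = (\<Sum>r\<in>UNIV. p3 s (fst t) r * h' r (snd t))" for s t
  have M0': "((\<lambda>z. M0 z s t) has_real_derivative M0 1 s t + N s t) (at 1)" for s t
    unfolding M0_def N_def by (auto intro!: derivative_eq_intros h' simp: mult.commute)
  define y' where "y' s = (\<Sum>t\<in>UNIV. g' s t * escape t)" for s
  have one: "1 \<in> {0<..<z0}" using z0 by simp
  have y'_eq: "y' s = (\<Sum>t\<in>UNIV. (M0 1 s t + N s t) * u t + y' t * M0 1 s t)" for s
  proof (rule DERIV_unique)
    let ?y = "\<lambda>z s. \<Sum>t\<in>UNIV. g z s t * escape t"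
    have dy: "((\<lambda>z. ?y z s) has_real_derivative y' s) (at 1)" for s
      unfolding y'_def by (auto intro!: derivative_eq_intros g')
    have eq: "?y z s = escape s + (\<Sum>t\<in>UNIV. M0 z s t * ?y z t)" if "z \<in> {0<..<z0}" for z
    proof -
      have geq: "g z s t = of_bool (s = t) + (\<Sum>r\<in>UNIV. M0 z s r * g z r t)" for t
        using that by (intro g_eq at gs) auto
      have "?y z s = (\<Sum>t\<in>UNIV. (of_bool (s = t) + (\<Sum>r\<in>UNIV. M0 z s r * g z r t)) * escape t)"
        by (intro sum.cong refl arg_cong2[where f="(*)"] geq)
      also have "\<dots> = escape s + (\<Sum>t\<in>UNIV. \<Sum>r\<in>UNIV. M0 z s r * (g z r t * escape t))"
        by (simp add: distrib_right sum.distrib sum_distrib_right mult.assoc)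
      also have "(\<Sum>t\<in>UNIV. \<Sum>r\<in>UNIV. M0 z s r * (g z r t * escape t)) = (\<Sum>t\<in>UNIV. M0 z s t * ?y z t)"
        unfolding sum_distrib_left by (rule sum.swap)
      finally show ?thesis .
    qed
    show "((\<lambda>z. ?y z s) has_real_derivative y' s) (at 1)" by (rule dy)
    have "((\<lambda>z. escape s + (\<Sum>t\<in>UNIV. M0 z s t * ?y z t)) has_real_derivative
        0 + (\<Sum>t\<in>UNIV. (M0 1 s t + N s t) * ?y 1 t + y' t * M0 1 s t)) (at 1)"
      by (intro DERIV_add DERIV_const DERIV_sum DERIV_mult M0' dy)
    then have "((\<lambda>z. escape s + (\<Sum>t\<in>UNIV. M0 z s t * ?y z t)) has_real_derivative
        (\<Sum>t\<in>UNIV. (M0 1 s t + N s t) * u t + y' t * M0 1 s t)) (at 1)"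
      by (simp only: g_escape add_0)
    then show "((\<lambda>z. ?y z s) has_real_derivative
        (\<Sum>t\<in>UNIV. (M0 1 s t + N s t) * u t + y' t * M0 1 s t)) (at 1)"
      by (rule has_field_derivative_transform_within_open[OF _ open_greaterThanLessThan one])
        (simp only: eq)
  qed
  have h'_eq: "h' s c = p1 s c + (\<Sum>t\<in>UNIV. (M0 1 s t + N s t) * h 1 t c + h' t c * M0 1 s t)" for s c
  proof (rule DERIV_unique)
    show "((\<lambda>z. h z s c) has_real_derivative h' s c) (at 1)" by (rule h')
    have "((\<lambda>z. z * p1 s c + (\<Sum>t\<in>UNIV. M0 z s t * h z t c)) has_real_derivative
        1 * p1 s c + (\<Sum>t\<in>UNIV. (M0 1 s t + N s t) * h 1 t c + h' t c * M0 1 s t)) (at 1)"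
      by (intro DERIV_add DERIV_cmult_right DERIV_ident DERIV_sum DERIV_mult M0' h')
    then have "((\<lambda>z. z * p1 s c + (\<Sum>t\<in>UNIV. M0 z s t * h z t c)) has_real_derivative
        p1 s c + (\<Sum>t\<in>UNIV. (M0 1 s t + N s t) * h 1 t c + h' t c * M0 1 s t)) (at 1)"
      by simp
    then show "((\<lambda>z. h z s c) has_real_derivative
        p1 s c + (\<Sum>t\<in>UNIV. (M0 1 s t + N s t) * h 1 t c + h' t c * M0 1 s t)) (at 1)"
      by (rule has_field_derivative_transform_within_open[OF _ open_greaterThanLessThan one])
        (rule h_eq[symmetric], rule at, auto)
  qed
  \<comment> \<open>Expected duration of the descent to one letter, counted only when the descent
    occurs.\<close>
  define \<tau> where "\<tau> s = (\<Sum>c\<in>UNIV. h' s c)" for s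
  let ?E = "\<lambda>s. \<Sum>t\<in>UNIV. (M0 1 s t + N s t) * u t"
  have sumN: "(\<Sum>t\<in>UNIV. N s t) = (\<Sum>t\<in>UNIV. M1 s t * \<tau> t)" for s
  proof -
    have "(\<Sum>t\<in>UNIV. N s t) = (\<Sum>d\<in>UNIV. \<Sum>e\<in>UNIV. \<Sum>r\<in>UNIV. p3 s d r * h' r e)"
      by (simp add: N_def sum_UNIV_prod)
    also have "\<dots> = (\<Sum>d\<in>UNIV. \<Sum>r\<in>UNIV. p3 s d r * \<tau> r)"
      unfolding \<tau>_def sum_distrib_left by (rule sum.cong, rule refl, rule sum.swap)
    also have "\<dots> = (\<Sum>t\<in>UNIV. M1 s t * \<tau> t)"
      unfolding M1_def sum_distrib_right by (rule sum.swap)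
    finally show ?thesis .
  qed
  have sumM0: "(\<Sum>c\<in>UNIV. p1 s c) + (\<Sum>t\<in>UNIV. M0 1 s t) = 1 - escape s" for s
  proof -
    have "(\<Sum>t\<in>UNIV. M0 1 s t * 1) = (\<Sum>t\<in>UNIV. p2 s t) + (\<Sum>d\<in>UNIV. \<Sum>r\<in>UNIV. p3 s d r * (1 - u r))"
      by (subst sum_M0_Cons[of 1 s "\<lambda>_. 1"]) (simp add: u_def)
    moreover have "(\<Sum>d\<in>UNIV. \<Sum>r\<in>UNIV. p3 s d r * (1 - u r)) = (\<Sum>d\<in>UNIV. \<Sum>t\<in>UNIV. p3 s d t) - escape s"
      by (simp add: escape_p3 right_diff_distrib sum_subtractf)
    ultimately show ?thesis using sum_p[of s] by simp
  qed
  have \<tau>_eq: "(\<Sum>t\<in>UNIV. M s t * \<tau> t) - \<tau> s = ?E s + escape s - 1" for s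
  proof -
    have "\<tau> s = (\<Sum>c\<in>UNIV. p1 s c) + (\<Sum>c\<in>UNIV. \<Sum>t\<in>UNIV. (M0 1 s t + N s t) * h 1 t c + h' t c * M0 1 s t)"
      unfolding \<tau>_def sum.distrib[symmetric] by (intro sum.cong refl h'_eq)
    also have "(\<Sum>c\<in>UNIV. \<Sum>t\<in>UNIV. (M0 1 s t + N s t) * h 1 t c + h' t c * M0 1 s t) =
        (\<Sum>t\<in>UNIV. (M0 1 s t + N s t) * (1 - u t) + M0 1 s t * \<tau> t)"
      by (subst sum.swap)
        (simp add: sum.distrib u_def \<tau>_def sum_distrib_left sum_distrib_right mult.commute)
    also have "\<dots> = (\<Sum>t\<in>UNIV. M0 1 s t) + (\<Sum>t\<in>UNIV. N s t) - ?E s + (\<Sum>t\<in>UNIV. M0 1 s t * \<tau> t)"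
      by (simp add: right_diff_distrib sum.distrib sum_subtractf)
    finally show ?thesis
      using sumM0[of s] unfolding sumN by (simp add: M_def distrib_right sum.distrib)
  qed
  have "(\<Sum>s\<in>UNIV. \<mu> s * (?E s + escape s - 1)) = 0"
    using \<mu>_balance[of \<tau>] unfolding \<tau>_eq .
  then have \<mu>E: "(\<Sum>s\<in>UNIV. \<mu> s * ?E s) + 1 = (\<Sum>s\<in>UNIV. \<mu> s)"
    using \<mu>_escape by (simp add: right_diff_distrib distrib_left sum_subtractf sum.distrib)
  define D where "D s a t = (\<Sum>r\<in>UNIV. p3 s a r * (g 1 r t + g' r t))" for s a t
  have dD: "((\<lambda>z. \<Sum>r\<in>UNIV. p3 s a r * z * g z r t) has_real_derivative D s a t) (at 1)" for s a t
    unfolding D_def by (auto intro!: derivative_eq_intros g' simp: algebra_simps)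
  have inner: "(\<Sum>a\<in>UNIV. \<Sum>t\<in>UNIV. escape t * D s a t) = escape s + (\<Sum>r\<in>UNIV. M1 s r * y' r)" for s
  proof -
    have "(\<Sum>t\<in>UNIV. escape t * D s a t) = (\<Sum>r\<in>UNIV. p3 s a r * (u r + y' r))" for a
    proof -
      have "(\<Sum>t\<in>UNIV. escape t * D s a t) = (\<Sum>t\<in>UNIV. \<Sum>r\<in>UNIV. p3 s a r * (g 1 r t * escape t + g' r t * escape t))"
        unfolding D_def sum_distrib_left by (intro sum.cong refl) (simp add: algebra_simps)
      also have "\<dots> = (\<Sum>r\<in>UNIV. \<Sum>t\<in>UNIV. p3 s a r * (g 1 r t * escape t + g' r t * escape t))"
        by (rule sum.swap)
      also have "\<dots> = (\<Sum>r\<in>UNIV. p3 s a r * (u r + y' r))"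
        by (simp only: sum_distrib_left[symmetric] sum.distrib g_escape y'_def)
      finally show ?thesis .
    qed
    then have "(\<Sum>a\<in>UNIV. \<Sum>t\<in>UNIV. escape t * D s a t) = (\<Sum>a\<in>UNIV. \<Sum>r\<in>UNIV. p3 s a r * (u r + y' r))"
      by simp
    also have "\<dots> = (\<Sum>r\<in>UNIV. M1 s r * (u r + y' r))"
      unfolding M1_def sum_distrib_right by (rule sum.swap)
    finally show ?thesis by (simp add: distrib_left sum.distrib escape_def)
  qed
  have "(\<Sum>s\<in>UNIV. \<pi> s * (\<Sum>a\<in>UNIV. \<Sum>t\<in>UNIV. escape t * D s a t)) =
      1 + (\<Sum>s\<in>UNIV. \<Sum>r\<in>UNIV. \<mu> s * M1 s r * y' r)"
    unfolding inner distrib_left sum.distrib \<pi>_escape sum_distrib_left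
    by (simp add: \<pi>_M1 flip: mult.assoc)
  \<comment> \<open>\<open>\<mu>_M1\<close> moves \<open>1 - M0 1\<close> from \<open>\<mu>\<close>
    onto \<open>y'\<close>, where it produces \<open>?E\<close>.\<close>
  also have "(\<Sum>s\<in>UNIV. \<Sum>r\<in>UNIV. \<mu> s * M1 s r * y' r) = (\<Sum>r\<in>UNIV. (\<mu> r - (\<Sum>s\<in>UNIV. \<mu> s * M0 1 s r)) * y' r)"
    by (subst sum.swap) (simp flip: sum_distrib_right \<mu>_M1)
  also have "\<dots> = (\<Sum>s\<in>UNIV. \<mu> s * (y' s - (\<Sum>t\<in>UNIV. y' t * M0 1 s t)))"
  proof -
    have "(\<Sum>r\<in>UNIV. (\<Sum>s\<in>UNIV. \<mu> s * M0 1 s r) * y' r) = (\<Sum>s\<in>UNIV. \<mu> s * (\<Sum>t\<in>UNIV. y' t * M0 1 s t))"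
      unfolding sum_distrib_left sum_distrib_right by (subst sum.swap) (simp add: mult_ac)
    then show ?thesis by (simp add: left_diff_distrib right_diff_distrib sum_subtractf)
  qed
  also have "\<dots> = (\<Sum>s\<in>UNIV. \<mu> s * ?E s)"
  proof -
    have "y' s - (\<Sum>t\<in>UNIV. y' t * M0 1 s t) = ?E s" for s
      using y'_eq[of s] by (simp add: sum.distrib)
    then show ?thesis by simp
  qed
  finally show ?thesis using that[OF dD] \<mu>E by simp
qed

end

section \<open>The chain on words\<close>

locale suffix_process = suffix_kernel p for p :: "'a::finite list \<Rightarrow> 'a list pmf" +
  fixes P :: "'a list \<Rightarrow> 'w measure" and X :: "nat \<Rightarrow> 'w \<Rightarrow> 'a list"
  assumes mc: "markov_chain_from (P w) X (suffix_step p) w"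
begin

lemma prob_run:
  "\<P>(\<omega> in P w. (\<forall>i<n. X i \<omega> \<in> B) \<and> X n \<omega> \<in> C) = run B (indicator C) n w"
proof -
  have "(\<forall>i<n. X i \<omega> \<in> B) \<and> X n \<omega> \<in> C \<longleftrightarrow> (\<forall>i\<le>n. X i \<omega> \<in> (if i < n then B else C))" for \<omega>
    by (auto simp: le_less)
  then show ?thesis using prob_path_event[OF mc, of w n "\<lambda>i. if i < n then B else C"]
    by (simp only: path_prob_run)
qed

lemma prob_step_run:
  "\<P>(\<omega> in P w. (\<forall>i\<in>{1..n}. X i \<omega> \<in> B) \<and> X (Suc n) \<omega> \<in> C) = step (run B (indicator C) n) w"
proof -
  let ?A = "\<lambda>i. if i = 0 then UNIV else if i < Suc n then B else C"
  have "(\<forall>i\<in>{1..n}. X i \<omega> \<in> B) \<and> X (Suc n) \<omega> \<in> C \<longleftrightarrow> (\<forall>i\<le>Suc n. X i \<omega> \<in> ?A i)" for \<omega>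
    by (auto simp: le_Suc_eq)
  moreover have "(\<lambda>i. ?A (Suc i)) = (\<lambda>i. if i < n then B else C)" by auto
  then have "path_prob (suffix_step p) (Suc n) ?A w = step (run B (indicator C) n) w"
    by (simp only: path_prob.simps path_prob_run step_def) simp
  ultimately show ?thesis using prob_path_event[OF mc, of w "Suc n" ?A] by simp
qed

lemma prob_at: "\<P>(\<omega> in P w. X n \<omega> \<in> C) = run UNIV (indicator C) n w"
  using prob_run[of w n UNIV C] by simp

text \<open>The series of \<open>H_fun\<close> starts at time \<open>1\<close>; the extra term of
  \<open>h\<close> at time \<open>0\<close> vanishes for a two-letter start.\<close>

lemma H_fun_eq: "H_fun P X s c 1 = h 1 s c"
proof -
  have "\<P>(\<omega> in P (wd s). X (Suc n) \<omega> = [c] \<and> (\<forall>m<Suc n. length (X m \<omega>) > 1)) = fp c (Suc n) (wd s)" for n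
    using prob_run[of "wd s" "Suc n" long "{[c]}"]
    by (simp add: fp_def Suc_le_eq conj_commute numeral_2_eq_2 del: run.simps)
  moreover have "fp c 0 (wd s) = 0" by (simp add: fp_def)
  ultimately show ?thesis
    unfolding H_fun_def h_def using suminf_split_head[OF fp_summable, of c "wd s"]
    by (cases s) simp
qed

text \<open>The length condition at time \<open>n\<close> is automatic at \<open>wd t\<close>. The
  series agree term by term, so \<open>z\<close> needs no restriction.\<close>

lemma Gbar_eq: "Gbar P X s t z = g z s t"
proof -
  have "X n \<omega> = wd t \<and> (\<forall>m\<le>n. length (X m \<omega>) \<ge> 2) \<longleftrightarrow>
      (\<forall>i<n. X i \<omega> \<in> long) \<and> X n \<omega> \<in> {wd t}" for n \<omega>
    by (auto simp: le_less)
  then have "\<P>(\<omega> in P (wd s). X n \<omega> = wd t \<and> (\<forall>m\<le>n. length (X m \<omega>) \<ge> 2)) = gb t n (wd s)" for n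
    using prob_run[of "wd s" n long "{wd t}"] by (simp only: gb_def)
  then show ?thesis unfolding Gbar_def g_def by (cases s; cases t) simp
qed

lemma xi_eq: "xi P X p (a, s) = escape s"
proof -
  have "xi P X p (a, s) = (\<Sum>x\<in>UNIV. case x of (d, t) \<Rightarrow> p3 s d t * u t)"
    unfolding xi_def
    by (cases s) (auto simp: H_fun_eq u_def p3_def split: prod.splits intro!: sum.cong)
  also have "\<dots> = escape s" by (simp add: sum_UNIV_prod[of "\<lambda>(d, t). p3 s d t * u t"] escape_p3)
  finally show ?thesis .
qed

text \<open>While three letters remain, the first is frozen and the rest moves as the walk confined
  to \<open>long\<close>.\<close>

lemma run_three:
  assumes "v \<noteq> []"
  shows "run {v. 3 \<le> length v} (indicator {c # wd t}) n (d # v) = of_bool (d = c) * gb t n v"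
  using assms
proof (induction n arbitrary: v)
  case 0
  then show ?case by (simp add: gb_def indicator_def)
next
  case (Suc n)
  show ?case
  proof (cases "2 \<le> length v")
    case True
    let ?f = "run {v. 3 \<le> length v} (indicator {c # wd t}) n"
    have "run {v. 3 \<le> length v} (indicator {c # wd t}) (Suc n) (d # v) = step (\<lambda>w. ?f (d # w)) v"
      using True by (simp add: step_Cons numeral_3_eq_3 numeral_2_eq_2)
    also have "\<dots> = step (\<lambda>w. of_bool (d = c) * gb t n w) v"
    proof (rule step_cong)
      fix w assume "w \<in> set_pmf (suffix_step p v)"
      then have "w \<noteq> []" using support_length(1)[of w v] True by auto
      then show "?f (d # w) = of_bool (d = c) * gb t n w" by (rule Suc.IH)
    qed
    also have "\<dots> = of_bool (d = c) * gb t (Suc n) v"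
      using True by (simp only: step_cmult) (simp add: gb_def)
    finally show ?thesis .
  qed (simp add: gb_def numeral_3_eq_3 numeral_2_eq_2)
qed

text \<open>Confinement begins only at time \<open>1\<close>, so the first step must write three
  letters, with \<open>c\<close> in front.\<close>

lemma K_fun_eq:
  assumes gs: "\<And>r. summable (\<lambda>n. gb t n (wd r))"
  shows "K_fun P X s (c, t) 1 = (\<Sum>r\<in>UNIV. p3 s c r * g 1 r t)"
proof -
  let ?B = "{v. 3 \<le> length v} :: 'a list set"
  have ev: "X (Suc n) \<omega> = c # wd t \<and> (\<forall>m\<in>{1..Suc n}. length (X m \<omega>) \<ge> 3) \<longleftrightarrow>
      (\<forall>i\<in>{1..n}. X i \<omega> \<in> ?B) \<and> X (Suc n) \<omega> \<in> {c # wd t}" for n \<omega>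
    by (auto simp: atLeastAtMostSuc_conv)
  have "\<P>(\<omega> in P (wd s). X (Suc n) \<omega> = c # wd t \<and> (\<forall>m\<in>{1..Suc n}. length (X m \<omega>) \<ge> 3)) =
      (\<Sum>r\<in>UNIV. p3 s c r * gb t n (wd r))" for n
  proof -
    let ?f = "run ?B (indicator {c # wd t}) n"
    have short: "?f v = 0" if "length v < 3" for v
      using that by (cases n) (auto simp: indicator_def)
    have "step ?f (wd s) = (\<Sum>d\<in>UNIV. \<Sum>r\<in>UNIV. p3 s d r * (of_bool (d = c) * gb t n (wd r)))"
      using step_wd[of ?f "[]" s] by (simp add: short run_three)
    also have "\<dots> = (\<Sum>d\<in>UNIV. of_bool (c = d) * (\<Sum>r\<in>UNIV. p3 s d r * gb t n (wd r)))"
      unfolding sum_distrib_left by (intro sum.cong refl) auto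
    also have "\<dots> = (\<Sum>r\<in>UNIV. p3 s c r * gb t n (wd r))"
      by (rule sum_of_bool_mult)
    finally show ?thesis using prob_step_run[of "wd s" n ?B "{c # wd t}"] by (simp only: ev)
  qed
  then have "K_fun P X s (c, t) 1 = (\<Sum>n. \<Sum>r\<in>UNIV. p3 s c r * gb t n (wd r))"
    unfolding K_fun_def by (cases s; cases t) simp
  also have "\<dots> = (\<Sum>r\<in>UNIV. p3 s c r * g 1 r t)"
    using gs by (simp add: suminf_sum summable_mult suminf_mult g_def)
  finally show ?thesis .
qed

lemma sum_first_hit_complement:
  "(\<Sum>k\<le>N. run (- {v}) (indicator {v}) k s) + run (- {v}) (indicator (- {v})) N s = 1"
proof (induction N arbitrary: s)
  case (Suc N)
  have "(\<Sum>k\<le>Suc N. run (- {v}) (indicator {v}) k s) + run (- {v}) (indicator (- {v})) (Suc N) s =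
      indicator {v} s + indicator (- {v}) s *
        step (\<lambda>s. (\<Sum>k\<le>N. run (- {v}) (indicator {v}) k s) + run (- {v}) (indicator (- {v})) N s) s"
    by (simp add: sum.atMost_Suc_shift step_sum step_add sum_distrib_left distrib_left del: sum.atMost_Suc)
  moreover have "step (\<lambda>s. (\<Sum>k\<le>N. run (- {v}) (indicator {v}) k s) + run (- {v}) (indicator (- {v})) N s) s = 1"
    by (simp only: Suc step_const)
  ultimately show ?case by (cases "s = v") (simp_all del: sum.atMost_Suc run.simps)
qed (simp add: indicator_def)

text \<open>Computed through the complement: no visit to \<open>v\<close> at times \<open>1\<close>
  to \<open>N + 1\<close> is a single path event.\<close>

lemma return_prob:
  "step (\<lambda>s. \<Sum>k\<le>N. run (- {v}) (indicator {v}) k s) v \<le> \<P>(\<omega> in P v. \<exists>n\<ge>1. X n \<omega> = v)"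
proof -
  interpret prob_space "P v" using mc[of v] by (simp add: markov_chain_from_def)
  have X[measurable]: "X i \<in> measurable (P v) (count_space UNIV)" for i
    using mc[of v] by (simp add: markov_chain_from_def)
  let ?A = "{\<omega> \<in> space (P v). (\<forall>i\<in>{1..N}. X i \<omega> \<in> - {v}) \<and> X (Suc N) \<omega> \<in> - {v}}"
  have "step (\<lambda>s. \<Sum>k\<le>N. run (- {v}) (indicator {v}) k s) v =
      step (\<lambda>s. 1 - run (- {v}) (indicator (- {v})) N s) v"
  proof (rule step_cong)
    fix s
    show "(\<Sum>k\<le>N. run (- {v}) (indicator {v}) k s) = 1 - run (- {v}) (indicator (- {v})) N s"
      using sum_first_hit_complement[where v=v and N=N and s=s] by simp
  qed
  also have "\<dots> = 1 - prob ?A"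
    using prob_step_run[of v N "- {v}" "- {v}"] by (simp add: step_diff)
  also have "\<dots> = prob (space (P v) - ?A)" by (subst prob_compl) auto
  also have "\<dots> \<le> \<P>(\<omega> in P v. \<exists>n\<ge>1. X n \<omega> = v)"
    by (rule finite_measure_mono) auto
  finally show ?thesis .
qed

text \<open>At time \<open>k\<^sup>2\<close> the Chebyshev bound is of order
  \<open>1 / k\<^sup>2\<close>, hence summable, and Borel-Cantelli applies to each threshold
  \<open>1 / (j + 1)\<close>.\<close>

lemma law_of_large_numbers:
  assumes B: "\<And>n. run UNIV (\<lambda>w. (\<Phi> w - real n * L)\<^sup>2) n [] \<le> B * (real n + 1)"
    and C: "\<And>w v. v \<in> set_pmf (suffix_step p w) \<Longrightarrow> \<bar>\<Phi> v - \<Phi> w\<bar> \<le> C"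
  shows "AE \<omega> in P []. (\<lambda>n. \<Phi> (X n \<omega>) / real n) \<longlonglongrightarrow> L"
proof -
  interpret prob_space "P []" using mc[of "[]"] by (simp add: markov_chain_from_def)
  have X[measurable]: "X i \<in> measurable (P []) (count_space UNIV)" for i
    using mc[of "[]"] by (simp add: markov_chain_from_def)
  define A where "A \<epsilon> k = {\<omega> \<in> space (P []). \<epsilon> * real (k\<^sup>2) \<le> \<bar>\<Phi> (X (k\<^sup>2) \<omega>) - real (k\<^sup>2) * L\<bar>}"
    for \<epsilon> :: real and k
  have "AE \<omega> in P []. \<forall>j. eventually (\<lambda>k. \<omega> \<in> space (P []) - A (1 / real (Suc j)) k) sequentially"
  proof (subst AE_all_countable, rule allI, rule borel_cantelli_AE1)
    fix j :: nat
    let ?\<epsilon> = "1 / real (Suc j)"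
    show "A ?\<epsilon> k \<in> events" for k unfolding A_def by measurable
    show "emeasure (P []) (A ?\<epsilon> k) < \<infinity>" for k by (simp add: emeasure_eq_measure)
    show "summable (\<lambda>k. prob (A ?\<epsilon> k))"
    proof (rule summable_comparison_test'[where N=1])
      show "summable (\<lambda>k. 2 * B / ?\<epsilon>\<^sup>2 * inverse (real k ^ 2))"
        by (intro summable_mult inverse_power_summable) simp
      fix k :: nat assume k: "1 \<le> k"
      have "prob (A ?\<epsilon> k) = run UNIV (indicator {w. ?\<epsilon> * real (k\<^sup>2) \<le> \<bar>\<Phi> w - real (k\<^sup>2) * L\<bar>}) (k\<^sup>2) []"
        using prob_at[of "[]" "k\<^sup>2" "{w. ?\<epsilon> * real (k\<^sup>2) \<le> \<bar>\<Phi> w - real (k\<^sup>2) * L\<bar>}"]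
        by (simp only: A_def mem_Collect_eq)
      also have "\<dots> \<le> 2 * B / ?\<epsilon>\<^sup>2 / real (k\<^sup>2)"
        by (rule tail_bound[OF B]) (use k in auto)
      finally show "norm (prob (A ?\<epsilon> k)) \<le> 2 * B / ?\<epsilon>\<^sup>2 * inverse (real k ^ 2)"
        by (simp add: divide_inverse)
    qed
  qed
  with AE_markov_step[OF mc[of "[]"]] show ?thesis
  proof eventually_elim
    case (elim \<omega>)
    show ?case
    proof (rule tendsto_quotient_from_squares)
      show "\<bar>\<Phi> (X (Suc n) \<omega>) - \<Phi> (X n \<omega>)\<bar> \<le> C" for n using elim(1) C by blast
      show "(\<lambda>k. \<Phi> (X (k\<^sup>2) \<omega>) / real (k\<^sup>2)) \<longlonglongrightarrow> L"
      proof (rule tendstoI)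
        fix e :: real assume "0 < e"
        then obtain j where j: "1 / real (Suc j) < e" using nat_approx_posE by blast
        have "eventually (\<lambda>k. \<omega> \<in> space (P []) - A (1 / real (Suc j)) k) sequentially" using elim(2) by blast
        then show "eventually (\<lambda>k. dist (\<Phi> (X (k\<^sup>2) \<omega>) / real (k\<^sup>2)) L < e) sequentially"
          using eventually_ge_at_top[of 1]
        proof eventually_elim
          case (elim k)
          then have "\<bar>\<Phi> (X (k\<^sup>2) \<omega>) - real (k\<^sup>2) * L\<bar> < 1 / real (Suc j) * real (k\<^sup>2)"
            by (auto simp: A_def)
          also have "\<dots> \<le> e * real (k\<^sup>2)" using j by (intro mult_right_mono) auto
          finally have lt: "\<bar>\<Phi> (X (k\<^sup>2) \<omega>) - real (k\<^sup>2) * L\<bar> < e * real (k\<^sup>2)" .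
          have pos: "0 < real (k\<^sup>2)" using elim(2) by simp
          have "\<Phi> (X (k\<^sup>2) \<omega>) / real (k\<^sup>2) - L = (\<Phi> (X (k\<^sup>2) \<omega>) - real (k\<^sup>2) * L) / real (k\<^sup>2)"
            using pos by (simp add: diff_divide_distrib)
          then show ?case using lt pos by (simp add: dist_real_def pos_divide_less_eq)
        qed
      qed
    qed
  qed
qed

end

text \<open>Strict positivity of the limit is stated under the condition that a letter of positive
  length can be written in front of a new pair; for \<open>l = 0\<close> the limit is
  \<open>0\<close>.\<close>

theorem theorem2p4:
  fixes P :: "'a::finite list \<Rightarrow> 'w measure"
    and X :: "nat \<Rightarrow> 'w \<Rightarrow> 'a list"
    and p :: "'a list \<Rightarrow> 'a list pmf"
    and \<nu> :: "('a \<times> 'a \<times> 'a) pmf"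
    and l :: "'a \<Rightarrow> real"
  assumes "suffix_chain P X p"
    and "transient_chain P X"
    and "suffix_irreducible P X"
    and "invariant_measure P X p \<nu>"
    and "\<And>a. 0 \<le> l a"
  shows "(\<exists>L\<ge>0.
            (AE \<omega> in P []. (\<lambda>n. word_length l (X n \<omega>) / real n) \<longlonglongrightarrow> L) \<and>
            L = Delta P X p \<nu> l / Lambda P X p \<nu> \<and>
            ((\<exists>a e f g h. 0 < l a \<and> 0 < pmf (p [e, f]) [a, g, h]) \<longrightarrow> 0 < L)) \<and>
         0 < Lambda P X p \<nu> \<and>
         (AE \<omega> in P []. (\<lambda>n. real (length (X n \<omega>)) / real n) \<longlonglongrightarrow> 1 / Lambda P X p \<nu>)"
proof -
  interpret suffix_process p P X
    using assms(1) by unfold_locales (auto simp: suffix_chain_def)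
  have law: "\<P>(\<omega> in P []. X m \<omega> = w) = run UNIV (indicator {w}) m []" for m w
    using prob_at[of "[]" m "{w}"] by simp
  interpret suffix_walk p
  proof unfold_locales
    fix v w assume "reachable v"
    then have "\<P>(\<omega> in P v. \<exists>n\<ge>1. X n \<omega> = v) < 1"
      using assms(2) unfolding transient_chain_def reachable_def law by blast
    then show "summable (\<lambda>n. run UNIV (indicator {v}) n w)"
      by (rule summable_visits[OF return_prob])
  next
    fix m and w :: "'a list" and s :: "'a \<times> 'a" assume m: "1 \<le> m" "0 < run UNIV (indicator {w}) m []"
    obtain a b where s: "s = (a, b)" by (cases s)
    obtain n where n: "1 \<le> n" "0 < \<P>(\<omega> in P w. (\<exists>w1. X n \<omega> = w @ w1 @ [a, b]) \<and>
        (\<forall>k<n. length (X k \<omega>) \<ge> length w))"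
      using assms(3) m unfolding suffix_irreducible_def law by blast
    have "(\<exists>w1. x = w @ w1 @ [a, b]) \<longleftrightarrow> x \<in> {w @ v @ wd s |v. True}" for x
      by (simp add: s)
    then have "0 < run {v. length w \<le> length v} (indicator {w @ v @ wd s |v. True}) n w"
      using n(2) prob_run[of w n "{v. length w \<le> length v}" "{w @ v @ wd s |v. True}"]
      by (simp add: conj_commute)
    then show "\<exists>n\<ge>1. 0 < run {v. length w \<le> length v} (indicator {w @ v @ wd s |v. True}) n w"
      using n(1) by blast
  qed
  have A3bar: "(a, s) \<in> A3bar P X p \<longleftrightarrow> escape s \<noteq> 0" for a s
    using escape_nonneg[of s] by (auto simp: A3bar_def xi_eq less_le)
  have \<nu>0: "pmf \<nu> x = 0" if "x \<notin> A3bar P X p" for x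
    using assms(4) that by (auto simp: invariant_measure_def set_pmf_iff)
  have K: "K_fun P X s (c, t) 1 = (\<Sum>r\<in>UNIV. p3 s c r * g 1 r t)" for s c t
    by (rule K_fun_eq[OF gb_summable])
  have q: "q_tilde P X p (d, s) (a, t) = escape t / escape s * (\<Sum>r\<in>UNIV. p3 s a r * g 1 r t)" for d s a t
    by (cases s) (simp add: q_tilde_def xi_eq K)
  have triple: "(\<Sum>x\<in>UNIV. f x) = (\<Sum>a\<in>UNIV. \<Sum>t\<in>UNIV. f (a, t))" for f :: "'a \<times> 'a \<times> 'a \<Rightarrow> real"
    by (rule sum_UNIV_prod)
  interpret suffix_walk_invariant p \<nu>
  proof unfold_locales
    show "escape s \<noteq> 0" if "pmf \<nu> (d, s) \<noteq> 0" for d s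
      using \<nu>0[of "(d, s)"] that A3bar by auto
    fix t a assume t: "escape t \<noteq> 0"
    have "pmf \<nu> (a, t) = (\<Sum>x\<in>A3bar P X p. pmf \<nu> x * q_tilde P X p x (a, t))"
      using assms(4) t unfolding invariant_measure_def by (simp add: A3bar)
    also have "\<dots> = (\<Sum>x\<in>UNIV. pmf \<nu> x * q_tilde P X p x (a, t))"
      by (rule sum.mono_neutral_left) (auto simp: \<nu>0)
    also have "\<dots> = (\<Sum>s\<in>UNIV. \<Sum>d\<in>UNIV. pmf \<nu> (d, s) * (escape t / escape s * (\<Sum>r\<in>UNIV. p3 s a r * g 1 r t)))"
      unfolding triple q by (rule sum.swap)
    finally show "(\<Sum>s\<in>UNIV. \<Sum>d\<in>UNIV. pmf \<nu> (d, s) * (escape t / escape s * (\<Sum>r\<in>UNIV. p3 s a r * g 1 r t))) =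
        pmf \<nu> (a, t)" by simp
  qed
  let ?S = "\<Sum>s\<in>UNIV. \<mu> s"

  \<comment> \<open>The sums extend to all triples, as \<open>xi\<close> vanishes off
    \<open>A3bar\<close> in the first index and \<open>\<nu>\<close> in the second. The weight
    \<open>F\<close> sees only the last pair of the second triple, so its first letter is summed
    into \<open>\<pi>\<close>.\<close>
  have sum_A3bar: "(\<Sum>x\<in>A3bar P X p. \<Sum>y\<in>A3bar P X p. pmf \<nu> y * (xi P X p x / xi P X p y) * F x y) =
      (\<Sum>s\<in>UNIV. \<pi> s * (\<Sum>a\<in>UNIV. \<Sum>t\<in>UNIV. escape t * G s a t))"
    if F: "\<And>a t d s. F (a, t) (d, s) = G s a t" for F G
  proof -
    have xi0: "xi P X p x = 0" if "x \<notin> A3bar P X p" for x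
      using that by (cases x) (auto simp: A3bar xi_eq)
    have "(\<Sum>x\<in>A3bar P X p. \<Sum>y\<in>A3bar P X p. pmf \<nu> y * (xi P X p x / xi P X p y) * F x y) =
        (\<Sum>x\<in>A3bar P X p. \<Sum>y\<in>UNIV. pmf \<nu> y * (xi P X p x / xi P X p y) * F x y)"
      by (intro sum.cong refl sum.mono_neutral_left) (auto simp: \<nu>0)
    also have "\<dots> = (\<Sum>x\<in>UNIV. \<Sum>y\<in>UNIV. pmf \<nu> y * (xi P X p x / xi P X p y) * F x y)"
      by (rule sum.mono_neutral_left) (auto simp: xi0)
    also have "\<dots> = (\<Sum>x\<in>UNIV. \<Sum>s\<in>UNIV. \<pi> s * (escape (snd x) * G s (fst x) (snd x)))"
    proof (rule sum.cong)
      fix x :: "'a \<times> 'a \<times> 'a"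
      obtain a t where x: "x = (a, t)" by (cases x)
      have "(\<Sum>y\<in>UNIV. pmf \<nu> y * (xi P X p x / xi P X p y) * F x y) =
          (\<Sum>s\<in>UNIV. \<Sum>d\<in>UNIV. pmf \<nu> (d, s) / escape s * (escape t * G s a t))"
        unfolding triple x by (subst sum.swap) (simp add: xi_eq F mult.assoc)
      also have "\<dots> = (\<Sum>s\<in>UNIV. \<pi> s * (escape t * G s a t))"
        unfolding sum_distrib_right[symmetric] sum_divide_distrib[symmetric] \<pi>_def ..
      finally show "(\<Sum>y\<in>UNIV. pmf \<nu> y * (xi P X p x / xi P X p y) * F x y) =
          (\<Sum>s\<in>UNIV. \<pi> s * (escape (snd x) * G s (fst x) (snd x)))" by (simp add: x)
    qed simp
    also have "\<dots> = (\<Sum>s\<in>UNIV. \<Sum>x\<in>UNIV. \<pi> s * (escape (snd x) * G s (fst x) (snd x)))"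
      by (rule sum.swap)
    also have "\<dots> = (\<Sum>s\<in>UNIV. \<pi> s * (\<Sum>a\<in>UNIV. \<Sum>t\<in>UNIV. escape t * G s a t))"
      unfolding sum_distrib_left[symmetric] triple by simp
    finally show ?thesis .
  qed

  have Lambda: "Lambda P X p \<nu> = ?S"
  proof -
    obtain D where D: "\<And>s a t. ((\<lambda>z. \<Sum>r\<in>UNIV. p3 s a r * z * g z r t) has_real_derivative D s a t) (at 1)"
      "(\<Sum>s\<in>UNIV. \<pi> s * (\<Sum>a\<in>UNIV. \<Sum>t\<in>UNIV. escape t * D s a t)) = ?S"
      by (rule Lambda_eq) blast
    define F where "F x y = deriv (\<lambda>z. \<Sum>r\<in>UNIV. p3 (snd y) (fst x) r * z * g z r (snd x)) 1"
      for x y :: "'a \<times> 'a \<times> 'a"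
    have F: "F (a, t) (d, s) = D s a t" for a t d s
      unfolding F_def using DERIV_imp_deriv[OF D(1)] by simp
    have F_eq: "deriv (\<lambda>z. \<Sum>(g, h)\<in>UNIV. pmf (p [e, f]) [a, g, h] * z * Gbar P X (g, h) (b, c) z) 1 =
        F (a, b, c) (d, e, f)" for a b c d e f
    proof -
      have "(\<lambda>z. \<Sum>(g, h)\<in>UNIV. pmf (p [e, f]) [a, g, h] * z * Gbar P X (g, h) (b, c) z) =
          (\<lambda>z. \<Sum>r\<in>UNIV. p3 (e, f) a r * z * g z r (b, c))"
        by (intro ext sum.cong refl) (auto simp: p3_def Gbar_eq split: prod.splits)
      then show ?thesis by (simp add: F_def)
    qed
    have "Lambda P X p \<nu> = (\<Sum>x\<in>A3bar P X p. \<Sum>y\<in>A3bar P X p. pmf \<nu> y * (xi P X p x / xi P X p y) * F x y)"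
      unfolding Lambda_def
      apply (rule sum.cong[OF refl])
      subgoal for x
        apply (cases x rule: prod_cases3)
        apply (simp only: prod.case)
        apply (rule sum.cong[OF refl])
        subgoal for a b c y
          by (cases y rule: prod_cases3)
            (simp only: prod.case, rule arg_cong2[where f="(*)"], rule refl, rule F_eq)
        done
      done
    then show ?thesis using sum_A3bar[of F D, OF F] D(2) by simp
  qed

  have Delta: "Delta P X p \<nu> l' = (\<Sum>s\<in>UNIV. \<mu> s * gain l' s)" for l'
  proof -
    define F where "F x y = l' (fst x) * (\<Sum>r\<in>UNIV. p3 (snd y) (fst x) r * g 1 r (snd x))"
      for x y :: "'a \<times> 'a \<times> 'a"
    have F: "F (a, t) (d, s) = l' a * (\<Sum>r\<in>UNIV. p3 s a r * g 1 r t)" for a t d s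
      by (simp add: F_def)
    have F_eq: "pmf \<nu> y * l' a * x * K_fun P X (e, f) (a, b, c) 1 = pmf \<nu> y * x * F (a, b, c) (d, e, f)"
      for a b c d e f x y
      by (simp add: F_def K)
    have "Delta P X p \<nu> l' = (\<Sum>x\<in>A3bar P X p. \<Sum>y\<in>A3bar P X p. pmf \<nu> y * (xi P X p x / xi P X p y) * F x y)"
      unfolding Delta_def
      apply (rule sum.cong[OF refl])
      subgoal for x
        apply (cases x rule: prod_cases3)
        apply (simp only: prod.case)
        apply (rule sum.cong[OF refl])
        subgoal for a b c y by (cases y rule: prod_cases3) (simp only: prod.case, rule F_eq)
        done
      done
    also have "\<dots> = (\<Sum>s\<in>UNIV. \<pi> s * (\<Sum>a\<in>UNIV. \<Sum>t\<in>UNIV. escape t * (l' a * (\<Sum>r\<in>UNIV. p3 s a r * g 1 r t))))"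
      by (rule sum_A3bar) (rule F)
    also have "\<dots> = (\<Sum>s\<in>UNIV. \<Sum>a\<in>UNIV. \<Sum>t\<in>UNIV. escape t * (\<pi> s * (\<Sum>r\<in>UNIV. p3 s a r * g 1 r t)) * l' a)"
      unfolding sum_distrib_left sum_distrib_right by (intro sum.cong refl) (simp add: mult_ac)
    also have "\<dots> = (\<Sum>a\<in>UNIV. \<Sum>t\<in>UNIV. \<Sum>s\<in>UNIV. escape t * (\<pi> s * (\<Sum>r\<in>UNIV. p3 s a r * g 1 r t)) * l' a)"
      by (subst sum.swap, rule sum.cong, rule refl, rule sum.swap)
    also have "\<dots> = (\<Sum>a\<in>UNIV. \<Sum>t\<in>UNIV. pmf \<nu> (a, t) * l' a)"
      unfolding \<nu>_eq sum_distrib_left[of "escape _"] sum_distrib_right[of _ _ "l' _"] ..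
    finally show ?thesis by (simp only: \<nu>_gain)
  qed

  have speed: "AE \<omega> in P []. (\<lambda>n. word_length l' (X n \<omega>) / real n) \<longlonglongrightarrow> Delta P X p \<nu> l' / ?S" for l'
  proof -
    obtain \<beta> L K where \<beta>: "\<And>s. (\<Sum>t\<in>UNIV. M s t * \<beta> t) - \<beta> s = L - drift l' s"
      "\<And>w. 2 \<le> length w \<Longrightarrow> step (\<lambda>v. word_length l' v + ext 2 \<beta> v) w = word_length l' w + ext 2 \<beta> w + L"
      "0 \<le> K" "\<And>w. \<bar>ext 2 \<beta> w\<bar> \<le> K"
      by (rule corrected_length[of l']) blast
    have L: "L = Delta P X p \<nu> l' / ?S"
      using speed_eq[OF \<beta>(1)] sum_\<mu>_pos by (simp add: Delta field_simps)
    obtain C where C: "\<And>w v. v \<in> set_pmf (suffix_step p w) \<Longrightarrow>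
        \<bar>(word_length l' v + ext 2 \<beta> v) - (word_length l' w + ext 2 \<beta> w)\<bar> \<le> C"
      using corrected_increment[OF \<beta>(4), of l'] by blast
    obtain B where B: "\<And>n. run UNIV (\<lambda>w. (word_length l' w + ext 2 \<beta> w - real n * L)\<^sup>2) n [] \<le> B * (real n + 1)"
      using second_moment[OF \<beta>(2) C] by blast
    have "AE \<omega> in P []. (\<lambda>n. (word_length l' (X n \<omega>) + ext 2 \<beta> (X n \<omega>)) / real n) \<longlonglongrightarrow> L"
      by (rule law_of_large_numbers[OF B C])
    then show ?thesis
    proof eventually_elim
      case (elim \<omega>)
      have "(\<lambda>n. ext 2 \<beta> (X n \<omega>) / real n) \<longlonglongrightarrow> 0"
      proof (rule Lim_null_comparison)
        show "eventually (\<lambda>n. norm (ext 2 \<beta> (X n \<omega>) / real n) \<le> K / real n) sequentially"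
          using \<beta>(4) by (intro always_eventually allI) (simp add: divide_right_mono)
        show "(\<lambda>n. K / real n) \<longlonglongrightarrow> 0" by (rule lim_const_over_n)
      qed
      from tendsto_diff[OF elim this] show ?case by (simp add: add_divide_distrib L)
    qed
  qed

  have nonneg: "0 \<le> Delta P X p \<nu> l"
    unfolding Delta gain_def using assms(5) by (intro sum_nonneg mult_nonneg_nonneg \<mu>_nonneg) auto
  have pos: "0 < Delta P X p \<nu> l" if "0 < l a" "0 < pmf (p [e, f]) [a, i, j]" for a e f i j
    unfolding Delta using gain_pos[of l a "(e, f)" "(i, j)"] assms(5) that by (simp add: p3_def)
  have "word_length (\<lambda>_. 1) w = real (length w)" for w :: "'a list"
    by (induction w) (auto simp: word_length_def)
  \<comment> \<open>With unit lengths the gain is \<open>escape\<close>, which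
    \<open>\<mu>_escape\<close> normalizes.\<close>
  moreover have "Delta P X p \<nu> (\<lambda>_. 1) = 1"
    by (simp add: Delta gain_def flip: escape_p3) (rule \<mu>_escape)
  ultimately have length: "AE \<omega> in P []. (\<lambda>n. real (length (X n \<omega>)) / real n) \<longlonglongrightarrow> 1 / ?S"
    using speed[of "\<lambda>_. 1"] by simp
  have "0 < Delta P X p \<nu> l / ?S" if "\<exists>a e f i j. 0 < l a \<and> 0 < pmf (p [e, f]) [a, i, j]"
    using that pos sum_\<mu>_pos by (auto intro!: divide_pos_pos)
  then show ?thesis
    unfolding Lambda using speed[of l] length sum_\<mu>_pos nonneg
    by (intro conjI exI[of _ "Delta P X p \<nu> l / ?S"]) auto
qed

end
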